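(* Fix real numbers $\alpha,\beta>0$ with $\alpha\neq\beta$ and $\alpha,\beta\neq 1$. Let $\psi$ be a smooth function on $\mathbb{R}$ supported on $[1,2]$. For $\lambda=(\lambda_1,\lambda_2)\in\mathbb{R}^2$ let $$\Phi^\lambda(t)=e^{i\lambda_1t^\alpha+i\lambda_2t^\beta}\,\frac{\psi(t)}{t}\quad (t>0),\qquad \Phi^\lambda(t)=0\quad (t\le 0),$$ and for $a>0$ let $\Phi_a^\lambda(t)=a^{-1}\Phi^\lambda(t/a)$. Let $|\lambda|=|\lambda_1|+|\lambda_2|$. Then there exist $\gamma_0>0$ and a constant $C<\infty$ (depending only on $\alpha,\beta,\psi$) such that for all $r\ge 1$ and all $F\in L^2(\mathbb{R})$, $$\Big\|\sup_{a>0,\ |\lambda|\ge r}|F*\Phi_a^\lambda|\Big\|_{L^2(\mathbb{R})}\le C\, r^{-\gamma_0}\|F\|_{L^2(\mathbb{R})}.$$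
   Context: The supremum runs over all $a>0$ and all $\lambda\in\mathbb{R}^2$ with $|\lambda_1|+|\lambda_2|\ge r$; $*$ denotes convolution on $\mathbb{R}$. *)

theory Defs
  imports "HOL-Analysis.Analysis"
begin

text \<open>Derivatives of all orders exist at every point; \<open>vector_derivative\<close> is only meaningful at
  points of differentiability, which is what each instance \<open>n\<close> asserts before passing to \<open>n + 1\<close>.\<close>

definition smooth :: "(real \<Rightarrow> complex) \<Rightarrow> bool" where
  "smooth f \<longleftrightarrow>
     (\<forall>n t. ((\<lambda>g s. vector_derivative g (at s)) ^^ n) f differentiable (at t))"

definition Phi ::
  "real \<Rightarrow> real \<Rightarrow> (real \<Rightarrow> complex) \<Rightarrow> real \<times> real \<Rightarrow> real \<Rightarrow> complex" where
  "Phi \<alpha> \<beta> \<psi> l t =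
     (if 0 < t
      then exp (\<i> * of_real (fst l * t powr \<alpha> + snd l * t powr \<beta>)) * (\<psi> t / of_real t)
      else 0)"

definition dilate :: "real \<Rightarrow> (real \<Rightarrow> complex) \<Rightarrow> real \<Rightarrow> complex" where
  "dilate a f t = of_real (inverse a) * f (t / a)"

definition convol :: "(real \<Rightarrow> complex) \<Rightarrow> (real \<Rightarrow> complex) \<Rightarrow> real \<Rightarrow> complex" where
  "convol f g x = (LINT y|lebesgue. f (x - y) * g y)"

text \<open>The supremum below may be infinite at individual points, so the norm is taken of
  \<open>ennreal\<close>-valued functions; the \<open>L\<^sup>2\<close> norm of a complex function \<open>F\<close> is that of \<open>\<bar>F\<bar>\<close>.
  \<open>enn2real\<close> sends \<open>\<infinity>\<close> to 0, hence the case distinction in the square root.\<close>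

definition L2norm :: "(real \<Rightarrow> ennreal) \<Rightarrow> ennreal" where
  "L2norm g =
     (let I = (\<integral>\<^sup>+ x. (g x)\<^sup>2 \<partial>lebesgue)
      in if I = \<infinity> then \<infinity> else ennreal (sqrt (enn2real I)))"

definition in_L2 :: "(real \<Rightarrow> complex) \<Rightarrow> bool" where
  "in_L2 F \<longleftrightarrow> F \<in> borel_measurable lebesgue \<and> L2norm (\<lambda>x. ennreal (cmod (F x))) < \<infinity>"

definition max_fun ::
  "real \<Rightarrow> real \<Rightarrow> (real \<Rightarrow> complex) \<Rightarrow> real \<Rightarrow> (real \<Rightarrow> complex) \<Rightarrow> real \<Rightarrow> ennreal" where
  "max_fun \<alpha> \<beta> \<psi> r F x =
     (SUP (a, l) \<in> {(a, l). 0 < a \<and> r \<le> \<bar>fst l\<bar> + \<bar>snd l\<bar>}.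
        ennreal (cmod (convol F (dilate a (Phi \<alpha> \<beta> \<psi> l)) x)))"

end

theory Submission
  imports Defs
begin

text \<open>The supremum is made linear. For finitely many parameters a measurable choice of an index
\<open>\<iota> x\<close> at every point \<open>x\<close> turns the maximal function into a linear operator \<open>T\<close>, and the norm of
\<open>T\<close> is the square root of that of \<open>TT*\<close>. The kernel of \<open>TT*\<close> at \<open>(x, y)\<close> is a correlation of two of
the dilated functions. Let \<open>a\<close> be the larger of their two dilations and \<open>h \<le> 1\<close> the quotient of the
smaller by the larger, let \<open>\<nu>\<close> be the frequency that goes with \<open>a\<close> and \<open>\<mu>\<close> the other one, and let
\<open>w = (x - y) / a\<close>. The kernel is then \<open>1 / a\<close> times
\<open>J w = \<integral> \<Phi>\<^sup>\<nu> (w + h u) \<cdot> cnj (\<Phi>\<^sup>\<mu> u) du\<close>.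

The heart of the matter is \<open>kernel_majorant\<close>: \<open>\<bar>J w\<bar>\<close> is at most \<open>H w\<close>, where \<open>H\<close> depends on \<open>\<nu>\<close> only,
not on \<open>h\<close> and \<open>\<mu>\<close>, is supported in \<open>[-1, 2]\<close>, and has \<open>\<integral> H\<^sup>4 = O (r powr (-1/137))\<close>. Because \<open>H\<close> belongs to
the point with the larger dilation, Hoelder's inequality bounds the quadratic form of \<open>TT*\<close> at \<open>f\<close> by
the \<open>L\<^sup>4\<close> norm of \<open>H\<close> and the maximal function \<open>(M (\<bar>f\<bar> powr (4/3))) powr (3/4)\<close> with the
Hardy--Littlewood operator \<open>M\<close>, which is bounded on \<open>L\<^sup>2\<close> since \<open>4/3 < 2\<close> (\<open>strong_type_maximal\<close>,
\<open>maximal_bilinear\<close>, \<open>maximal_sequence\<close>).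

To find \<open>H\<close>, let \<open>a = \<alpha> - 1\<close>, \<open>b = \<beta> - 1\<close> from here on, and let \<open>P\<^sub>\<nu>\<close> and \<open>P\<^sub>\<mu>\<close> be the two phases, so
that \<open>J\<close> has the phase \<open>Q u = P\<^sub>\<nu> (w + h u) - P\<^sub>\<mu> u\<close>. With \<open>\<theta> = u (d/du)\<close> the operator
\<open>(\<theta> - a) (\<theta> - b)\<close> annihilates the derivative of \<open>P\<^sub>\<mu>\<close>. What it leaves of \<open>Q'\<close> is \<open>h\<close> times a function
\<open>resid\<close> of \<open>w\<close>, \<open>t = w + h u\<close> and \<open>\<nu>\<close> alone, in which no cancellation with \<open>\<mu>\<close> can occur. Where this is
not small, one of \<open>Q'\<close>, \<open>Q''\<close>, \<open>Q'''\<close> is not small, so \<open>Q'\<close> itself is small only on a small set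
(\<open>sublevel_second_order\<close>), and integration by parts gives decay (\<open>oscillatory_integral_bound\<close>). In the
coordinates \<open>w = s t\<close> the residual is again a sum of the powers \<open>t powr a\<close> and \<open>t powr b\<close>, and its two
coefficients are polynomials in \<open>s\<close> that do not vanish identically because \<open>a\<close> and \<open>b\<close> are nonzero; as
the exponents are distinct, it is small only on a small set of pairs \<open>(w, t)\<close> (\<open>resid_sublevel_area\<close>), and the measure
of the section of this set at \<open>w\<close> enters \<open>H\<close>. For small \<open>h\<close> all \<open>t\<close> in question are close to \<open>w\<close>, where
the residual is \<open>a b\<close> times the derivative of \<open>P\<^sub>\<nu>\<close> at \<open>w\<close>; this adds to \<open>H\<close> the indicator of the set where
that derivative is small (\<open>resid_near_diagonal\<close>). If \<open>h \<bar>\<nu>\<bar>\<close> is negligible against \<open>\<bar>\<mu>\<bar>\<close>, then \<open>P\<^sub>\<mu>\<close>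
dominates \<open>Q'\<close> outright. All these bounds come with powers of a parameter \<open>\<omega>\<close>, which is a small
negative power of \<open>r\<close>.

Each convolution is a continuous function, so the full supremum is that of a countable subfamily
(\<open>countable_subfamily_SUP\<close>), and monotone convergence passes from finite subfamilies to this one.\<close>

abbreviation (input) l1 :: "real \<Rightarrow> real \<Rightarrow> real" where
  "l1 c d \<equiv> \<bar>c\<bar> + \<bar>d\<bar>"

abbreviation (input) sqnorm :: "(real \<Rightarrow> complex) \<Rightarrow> ennreal" where
  "sqnorm F \<equiv> \<integral>\<^sup>+z. (ennreal (norm (F z)))\<^sup>2 \<partial>lborel"

section \<open>Oscillatory integrals and sublevel sets\<close>

lemma measure_has_integral_restrict:
  fixes S :: "real set"
  assumes "S \<in> sets borel" "S \<subseteq> {A..B}"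
  shows "((\<lambda>x. if x \<in> S then 1 else 0) has_integral measure lborel S) {A..B}"
proof -
  have "emeasure lborel S \<le> emeasure lborel {A..B}"
    using assms by (intro emeasure_mono) auto
  also have "\<dots> < \<infinity>" by (cases "A \<le> B") auto
  finally have "((\<lambda>x. 1::real) has_integral measure lborel S) S"
    using assms by (intro has_integral_measure_lborel) auto
  then show ?thesis
    using has_integral_restrict[OF assms(2), of "\<lambda>x. 1::real"] by simp
qed

lemma measure_le_integral:
  fixes S :: "real set" and g :: "real \<Rightarrow> real"
  assumes "S \<in> sets borel" "S \<subseteq> {A..B}" "g integrable_on {A..B}"
    and "\<And>x. x \<in> {A..B} \<Longrightarrow> 0 \<le> g x" "\<And>x. x \<in> S \<Longrightarrow> 1 \<le> g x"
  shows "measure lborel S \<le> integral {A..B} g"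
  using assms(4,5)
  by (intro has_integral_le[OF measure_has_integral_restrict[OF assms(1,2)] integrable_integral[OF assms(3)]])
     auto

text \<open>The set is controlled without counting zeros or monotonicity intervals of \<open>f\<close>: on it the indicator
is at most twice \<open>f'\<^sup>2 L\<^sup>2 / (f\<^sup>2 + L\<^sup>2) / L'\<^sup>2\<close>, and \<open>f'\<^sup>2 L\<^sup>2 / (f\<^sup>2 + L\<^sup>2)\<close> is \<open>f'\<close> times the derivative of the
bounded function \<open>L arctan (f / L)\<close>, so one integration by parts suffices.\<close>

lemma sublevel_derivative:
  fixes f f' f'' :: "real \<Rightarrow> real"
  assumes AB: "A \<le> B" and L: "0 < L" "0 < L'"
    and f: "\<And>x. x \<in> {A..B} \<Longrightarrow> (f has_real_derivative f' x) (at x within {A..B})"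
    and f': "\<And>x. x \<in> {A..B} \<Longrightarrow> (f' has_real_derivative f'' x) (at x within {A..B})"
    and cf'': "continuous_on {A..B} f''"
    and D: "\<And>x. x \<in> {A..B} \<Longrightarrow> \<bar>f' x\<bar> \<le> D" "\<And>x. x \<in> {A..B} \<Longrightarrow> \<bar>f'' x\<bar> \<le> D"
  shows "measure lborel {x \<in> {A..B}. \<bar>f x\<bar> \<le> L \<and> L' \<le> \<bar>f' x\<bar>} \<le> 8 * (1 + (B - A)) * D * L / L'\<^sup>2"
proof -
  have cf: "continuous_on {A..B} f" and cf': "continuous_on {A..B} f'"
    using f f' by (meson DERIV_continuous continuous_on_eq_continuous_within)+
  have D0: "0 \<le> D" using D(1)[of A] AB by auto
  define S where "S = {x \<in> {A..B}. \<bar>f x\<bar> \<le> L \<and> L' \<le> \<bar>f' x\<bar>}"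
  have "closed S"
  proof -
    have "closed ({A..B} \<inter> (\<lambda>x. (f x, f' x)) -` ({-L..L} \<times> ({..-L'} \<union> {L'..})))"
      by (intro continuous_closed_preimage continuous_intros cf cf' closed_Times closed_Un)
    also have "{A..B} \<inter> (\<lambda>x. (f x, f' x)) -` ({-L..L} \<times> ({..-L'} \<union> {L'..})) = S"
      by (auto simp: S_def)
    finally show ?thesis .
  qed
  define g where "g = (\<lambda>x. (f' x)\<^sup>2 * L\<^sup>2 / ((f x)\<^sup>2 + L\<^sup>2))"
  define k where "k = (\<lambda>x. f'' x * (L * arctan (f x / L)))"
  have pos: "(f x)\<^sup>2 + L\<^sup>2 > 0" for x using L by (simp add: add_nonneg_pos)
  have cg: "continuous_on {A..B} g" unfolding g_def
    using pos by (intro continuous_intros cf cf') (auto simp: less_imp_neq[symmetric])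
  have ck: "continuous_on {A..B} k" unfolding k_def using L
    by (intro continuous_intros cf cf'') auto
  have ig: "g integrable_on {A..B}" and ik: "k integrable_on {A..B}"
    using cg ck by (auto intro: integrable_continuous_real)
  have at: "\<bar>L * arctan y\<bar> \<le> 2 * L" for y
  proof -
    have "\<bar>arctan y\<bar> \<le> 2" using arctan_bounded[of y] pi_half_less_two by linarith
    then show ?thesis using L by (simp add: abs_mult)
  qed
  let ?F = "\<lambda>x. f' x * (L * arctan (f x / L))"
  have "((\<lambda>x. g x + k x) has_integral ?F B - ?F A) {A..B}"
  proof (rule fundamental_theorem_of_calculus[OF AB])
    fix x assume x: "x \<in> {A..B}"
    have "(?F has_real_derivative f'' x * (L * arctan (f x / L))
        + f' x * (L * (inverse (1 + (f x / L)\<^sup>2) * (f' x / L)))) (at x within {A..B})"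
      by (rule derivative_eq_intros f[OF x] f'[OF x] refl | use L in simp)+
    also have "f'' x * (L * arctan (f x / L))
        + f' x * (L * (inverse (1 + (f x / L)\<^sup>2) * (f' x / L))) = g x + k x"
      using L pos[of x] by (simp add: g_def k_def field_simps power2_eq_square)
    finally show "(?F has_vector_derivative g x + k x) (at x within {A..B})"
      by (simp add: has_real_derivative_iff_has_vector_derivative)
  qed
  then have "integral {A..B} g + integral {A..B} k = ?F B - ?F A"
    using integral_add[OF ig ik] integral_unique by metis
  moreover have "\<bar>integral {A..B} k\<bar> \<le> (2 * D * L) * (B - A)"
  proof -
    have "norm (integral {A..B} k) \<le> (2 * D * L) * (B - A)"
    proof (rule integral_bound[OF AB ck])
      fix x assume x: "x \<in> {A..B}"
      have "\<bar>f'' x\<bar> * \<bar>L * arctan (f x / L)\<bar> \<le> D * (2 * L)"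
        using D(2)[OF x] at D0 by (intro mult_mono) auto
      then show "norm (k x) \<le> 2 * D * L" by (simp add: k_def abs_mult)
    qed
    then show ?thesis by simp
  qed
  moreover have "\<bar>?F x\<bar> \<le> 2 * D * L" if "x \<in> {A..B}" for x
  proof -
    have "\<bar>f' x\<bar> * \<bar>L * arctan (f x / L)\<bar> \<le> D * (2 * L)"
        using D(1)[OF that] at D0 by (intro mult_mono) auto
    then show ?thesis by (simp add: abs_mult)
  qed
  from this[of A] this[of B] have "\<bar>?F B - ?F A\<bar> \<le> 4 * D * L" using AB by auto
  ultimately have G: "integral {A..B} g \<le> 4 * D * L + 2 * D * L * (B - A)" by linarith
  have "measure lborel S \<le> integral {A..B} (\<lambda>x. (2 / L'\<^sup>2) * g x)"
  proof (rule measure_le_integral)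
    show "S \<in> sets borel" using \<open>closed S\<close> by auto
    show "S \<subseteq> {A..B}" by (auto simp: S_def)
    show "(\<lambda>x. (2 / L'\<^sup>2) * g x) integrable_on {A..B}" using ig by (rule integrable_on_mult_right)
    show "0 \<le> (2 / L'\<^sup>2) * g x" if "x \<in> {A..B}" for x
      using pos[of x] by (simp add: g_def)
    show "1 \<le> (2 / L'\<^sup>2) * g x" if "x \<in> S" for x
    proof -
      have "(f x)\<^sup>2 \<le> L\<^sup>2" "L'\<^sup>2 \<le> (f' x)\<^sup>2" using that L
        by (auto simp: S_def abs_le_square_iff[symmetric])
      then have "L'\<^sup>2 * ((f x)\<^sup>2 + L\<^sup>2) \<le> (f' x)\<^sup>2 * (2 * L\<^sup>2)" using L
        by (intro mult_mono) auto
      moreover have "(2 / L'\<^sup>2) * g x = ((f' x)\<^sup>2 * (2 * L\<^sup>2)) / (L'\<^sup>2 * ((f x)\<^sup>2 + L\<^sup>2))"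
        by (simp add: g_def)
      moreover have "0 < L'\<^sup>2 * ((f x)\<^sup>2 + L\<^sup>2)" using L pos[of x] by (intro mult_pos_pos) auto
      ultimately show ?thesis by (simp only: le_divide_eq_1_pos)
    qed
  qed
  also have "\<dots> = (2 / L'\<^sup>2) * integral {A..B} g" by simp
  also have "\<dots> \<le> (2 / L'\<^sup>2) * (4 * D * L + 2 * D * L * (B - A))"
    using G by (intro mult_left_mono) auto
  also have "\<dots> \<le> 8 * (1 + (B - A)) * D * L / L'\<^sup>2"
  proof -
    have "0 \<le> D * L * (B - A)" using AB D0 L by simp
    then have "2 * (4 * D * L + 2 * D * L * (B - A)) \<le> 8 * (1 + (B - A)) * D * L"
      by (simp add: algebra_simps)
    then show ?thesis by (simp add: divide_right_mono)
  qed
  finally show ?thesis by (simp add: S_def)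
qed

text \<open>A van der Corput estimate that asks for no monotonicity of \<open>q = Q'\<close>. The integrand is split by
\<open>1 = M\<^sup>2 / (q\<^sup>2 + M\<^sup>2) + q\<^sup>2 / (q\<^sup>2 + M\<^sup>2)\<close>. The first weight is small unless \<open>\<bar>q\<bar> \<le> L\<close>. The second one
contains a factor \<open>q\<close>, so \<open>exp (i Q)\<close> can be integrated, and what is then differentiated is \<open>\<zeta>\<close> times
\<open>q / (q\<^sup>2 + M\<^sup>2)\<close>, whose derivative is at most \<open>\<bar>q'\<bar> / M\<^sup>2\<close>.\<close>

lemma oscillatory_integral_bound:
  fixes Q q q' :: "real \<Rightarrow> real" and \<zeta> \<zeta>' :: "real \<Rightarrow> complex"
  assumes AB: "A \<le> B" and M: "0 < M" and L: "0 < L"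
    and Q: "\<And>x. x \<in> {A..B} \<Longrightarrow> (Q has_real_derivative q x) (at x within {A..B})"
    and q: "\<And>x. x \<in> {A..B} \<Longrightarrow> (q has_real_derivative q' x) (at x within {A..B})"
    and z: "\<And>x. x \<in> {A..B} \<Longrightarrow> (\<zeta> has_vector_derivative \<zeta>' x) (at x within {A..B})"
    and cq': "continuous_on {A..B} q'" and cz': "continuous_on {A..B} \<zeta>'"
    and D: "\<And>x. x \<in> {A..B} \<Longrightarrow> \<bar>q' x\<bar> \<le> D"
    and Z: "\<And>x. x \<in> {A..B} \<Longrightarrow> norm (\<zeta> x) \<le> Z" "\<And>x. x \<in> {A..B} \<Longrightarrow> norm (\<zeta>' x) \<le> Z"
    and z0: "\<zeta> A = 0" "\<zeta> B = 0"
  shows "norm (integral {A..B} (\<lambda>x. exp (\<i> * of_real (Q x)) * \<zeta> x))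
     \<le> Z * ((B - A) * (1 / M + D / M\<^sup>2 + M\<^sup>2 / L\<^sup>2) + measure lborel {x \<in> {A..B}. \<bar>q x\<bar> \<le> L})"
proof -
  have cQ: "continuous_on {A..B} Q" and cq: "continuous_on {A..B} q" and cz: "continuous_on {A..B} \<zeta>"
    using Q q z by (meson DERIV_continuous has_vector_derivative_continuous
        continuous_on_eq_continuous_within)+
  have D0: "0 \<le> D" using D[of A] AB by auto
  have Z0: "0 \<le> Z" using order_trans[OF norm_ge_zero Z(1)[of A]] AB by auto
  have pos: "(q x)\<^sup>2 + M\<^sup>2 > 0" for x using M by (simp add: add_nonneg_pos)
  have nz: "(q x)\<^sup>2 + M\<^sup>2 \<noteq> 0" for x using pos[of x] by (metis less_irrefl)
  define m where "m = (\<lambda>x. q x / ((q x)\<^sup>2 + M\<^sup>2))"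
  define m' where "m' = (\<lambda>x. q' x * (M\<^sup>2 - (q x)\<^sup>2) / ((q x)\<^sup>2 + M\<^sup>2)\<^sup>2)"
  have m: "(m has_real_derivative m' x) (at x within {A..B})" if "x \<in> {A..B}" for x
  proof -
    have "(m has_real_derivative (q' x * ((q x)\<^sup>2 + M\<^sup>2) - q x * (2 * q x * q' x)) /
         (((q x)\<^sup>2 + M\<^sup>2) * ((q x)\<^sup>2 + M\<^sup>2))) (at x within {A..B})" unfolding m_def
      by (rule derivative_eq_intros q[OF that] refl nz | simp)+
    also have "(q' x * ((q x)\<^sup>2 + M\<^sup>2) - q x * (2 * q x * q' x)) /
         (((q x)\<^sup>2 + M\<^sup>2) * ((q x)\<^sup>2 + M\<^sup>2)) = m' x"
      by (simp add: m'_def power2_eq_square algebra_simps)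
    finally show ?thesis .
  qed
  have mb: "\<bar>m x\<bar> \<le> 1 / M" for x
  proof -
    have "2 * (\<bar>q x\<bar> * M) \<le> \<bar>q x\<bar>\<^sup>2 + M\<^sup>2" using sum_squares_bound[of "\<bar>q x\<bar>" M] by simp
    moreover have "0 \<le> \<bar>q x\<bar> * M" using M by simp
    ultimately have "\<bar>q x\<bar> * M \<le> (q x)\<^sup>2 + M\<^sup>2" unfolding power2_abs by linarith
    then show ?thesis using pos[of x] M by (simp add: m_def field_simps abs_mult)
  qed
  have m'b: "\<bar>m' x\<bar> \<le> D / M\<^sup>2" if "x \<in> {A..B}" for x
  proof -
    have "\<bar>m' x\<bar> = \<bar>q' x\<bar> * (\<bar>M\<^sup>2 - (q x)\<^sup>2\<bar> / ((q x)\<^sup>2 + M\<^sup>2)) * (1 / ((q x)\<^sup>2 + M\<^sup>2))"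
      using pos[of x] by (simp add: m'_def abs_mult power2_eq_square)
    also have "\<dots> \<le> D * 1 * (1 / M\<^sup>2)"
    proof (intro mult_mono D that)
      show "\<bar>M\<^sup>2 - (q x)\<^sup>2\<bar> / ((q x)\<^sup>2 + M\<^sup>2) \<le> 1" using pos[of x] by (simp add: abs_if)
      show "1 / ((q x)\<^sup>2 + M\<^sup>2) \<le> 1 / M\<^sup>2" using M pos[of x]
          by (intro divide_left_mono mult_pos_pos) auto
    qed (use D0 pos[of x] in auto)
    finally show ?thesis by simp
  qed
  let ?e = "\<lambda>x. exp (\<i> * of_real (Q x))"
  define G where "G = (\<lambda>x. ?e x * (\<zeta> x * of_real (M\<^sup>2 / ((q x)\<^sup>2 + M\<^sup>2))
      + \<i> * (\<zeta>' x * of_real (m x) + \<zeta> x * of_real (m' x))))"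
  have "((\<lambda>x. ?e x * \<zeta> x - G x) has_integral
      (-\<i>) * ?e B * (\<zeta> B * of_real (m B)) - (-\<i>) * ?e A * (\<zeta> A * of_real (m A))) {A..B}"
  proof (rule fundamental_theorem_of_calculus[OF AB])
    fix x assume x: "x \<in> {A..B}"
    have eD: "(?e has_vector_derivative \<i> * of_real (q x) * ?e x) (at x within {A..B})"
    proof -
      have "((\<lambda>x. \<i> * of_real (Q x)) has_vector_derivative \<i> * of_real (q x)) (at x within {A..B})"
        using Q[OF x] by (intro has_vector_derivative_mult_right has_vector_derivative_of_real)
          (simp add: has_real_derivative_iff_has_vector_derivative)
      then have "((exp \<circ> (\<lambda>x. \<i> * of_real (Q x))) has_vector_derivative
          (\<i> * of_real (q x)) * ?e x) (at x within {A..B})"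
        by (rule field_vector_diff_chain_within) (auto intro: DERIV_exp has_field_derivative_at_within)
      then show ?thesis by (simp add: o_def)
    qed
    have mD: "((\<lambda>x. complex_of_real (m x)) has_vector_derivative of_real (m' x)) (at x within {A..B})"
      using m[OF x] by (intro has_vector_derivative_of_real)
        (simp add: has_real_derivative_iff_has_vector_derivative)
    have "((\<lambda>x. (-\<i>) * ?e x * (\<zeta> x * of_real (m x))) has_vector_derivative
       (-\<i>) * ?e x * (\<zeta> x * of_real (m' x) + \<zeta>' x * of_real (m x))
       + (-\<i>) * (\<i> * of_real (q x) * ?e x) * (\<zeta> x * of_real (m x))) (at x within {A..B})"
      by (rule has_vector_derivative_mult has_vector_derivative_mult_right eD mD z x)+
    moreover have "(-\<i>) * ?e x * (\<zeta> x * of_real (m' x) + \<zeta>' x * of_real (m x))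
       + (-\<i>) * (\<i> * of_real (q x) * ?e x) * (\<zeta> x * of_real (m x)) = ?e x * \<zeta> x - G x"
    proof -
      have "complex_of_real (q x) * of_real (m x) = 1 - of_real (M\<^sup>2 / ((q x)\<^sup>2 + M\<^sup>2))"
      proof -
        have "q x * m x = 1 - M\<^sup>2 / ((q x)\<^sup>2 + M\<^sup>2)"
          using nz[of x] by (simp add: m_def field_simps power2_eq_square)
        then show ?thesis by (metis of_real_1 of_real_diff of_real_mult)
      qed
      then have *: "(-\<i>) * (\<i> * of_real (q x) * ?e x) * (\<zeta> x * of_real (m x))
          = ?e x * \<zeta> x * (1 - of_real (M\<^sup>2 / ((q x)\<^sup>2 + M\<^sup>2)))"
        by (simp add: mult_ac)
      show ?thesis unfolding * G_def by (simp add: algebra_simps)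
    qed
    ultimately show "((\<lambda>x. (-\<i>) * ?e x * (\<zeta> x * of_real (m x))) has_vector_derivative
        ?e x * \<zeta> x - G x) (at x within {A..B})" by simp
  qed
  then have int0: "((\<lambda>x. ?e x * \<zeta> x - G x) has_integral 0) {A..B}" using z0 by simp
  have cG: "continuous_on {A..B} G" unfolding G_def m_def m'_def using nz
    by (intro continuous_intros cQ cq cq' cz cz') auto
  have ie: "(\<lambda>x. ?e x * \<zeta> x) integrable_on {A..B}"
    by (intro integrable_continuous_real continuous_intros cQ cz)
  have eq: "integral {A..B} (\<lambda>x. ?e x * \<zeta> x) = integral {A..B} G"
    using integral_diff[OF ie integrable_continuous_real[OF cG]] integral_unique[OF int0] by simp
  let ?T = "{x \<in> {A..B}. \<bar>q x\<bar> \<le> L}"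
  have "closed ({A..B} \<inter> q -` {-L..L})"
    by (intro continuous_closed_preimage cq) auto
  also have "{A..B} \<inter> q -` {-L..L} = ?T" by auto
  finally have T: "?T \<in> sets borel" by auto
  have hb: "((\<lambda>x. Z * ((1 / M + D / M\<^sup>2 + M\<^sup>2 / L\<^sup>2) + (if x \<in> ?T then 1 else 0))) has_integral
     Z * ((B - A) * (1 / M + D / M\<^sup>2 + M\<^sup>2 / L\<^sup>2) + measure lborel ?T)) {A..B}"
    using has_integral_const_real[of "1 / M + D / M\<^sup>2 + M\<^sup>2 / L\<^sup>2" A B] AB
    by (intro has_integral_mult_right has_integral_add measure_has_integral_restrict T) auto
  have "norm (integral {A..B} G) \<le> Z * ((B - A) * (1 / M + D / M\<^sup>2 + M\<^sup>2 / L\<^sup>2) + measure lborel ?T)"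
  proof -
    have "norm (integral {A..B} G) \<le> integral {A..B}
        (\<lambda>x. Z * ((1 / M + D / M\<^sup>2 + M\<^sup>2 / L\<^sup>2) + (if x \<in> ?T then 1 else 0)))"
    proof (rule integral_norm_bound_integral)
      show "G integrable_on {A..B}" using cG by (rule integrable_continuous_real)
      show "(\<lambda>x. Z * ((1 / M + D / M\<^sup>2 + M\<^sup>2 / L\<^sup>2) + (if x \<in> ?T then 1 else 0))) integrable_on {A..B}"
        using hb by blast
      fix x assume x: "x \<in> {A..B}"
      have t1: "norm (\<zeta> x * of_real (M\<^sup>2 / ((q x)\<^sup>2 + M\<^sup>2))) \<le> Z * (M\<^sup>2 / L\<^sup>2 + (if x \<in> ?T then 1 else 0))"
        unfolding norm_mult
      proof (intro mult_mono Z x)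
        have *: "norm (complex_of_real (M\<^sup>2 / ((q x)\<^sup>2 + M\<^sup>2))) = M\<^sup>2 / ((q x)\<^sup>2 + M\<^sup>2)"
          using pos[of x] by (simp del: of_real_divide of_real_add of_real_power)
        show "norm (complex_of_real (M\<^sup>2 / ((q x)\<^sup>2 + M\<^sup>2))) \<le> M\<^sup>2 / L\<^sup>2 + (if x \<in> ?T then 1 else 0)"
        proof (cases "\<bar>q x\<bar> \<le> L")
          case True
          have "M\<^sup>2 / ((q x)\<^sup>2 + M\<^sup>2) \<le> 1" using pos[of x] by simp
          then show ?thesis using True x unfolding * by (simp add: add_increasing)
        next
          case False
          then have "L\<^sup>2 \<le> (q x)\<^sup>2" using L by (auto simp: abs_le_square_iff[symmetric])
          then have "M\<^sup>2 / ((q x)\<^sup>2 + M\<^sup>2) \<le> M\<^sup>2 / L\<^sup>2" using L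
            by (intro divide_left_mono) (auto intro!: mult_pos_pos simp: pos add_increasing2)
          then show ?thesis using False unfolding * by simp
        qed
      qed (use Z0 in auto)
      have t2: "norm (\<zeta>' x * of_real (m x)) \<le> Z * (1 / M)"
        unfolding norm_mult by (intro mult_mono Z x) (use mb Z0 in auto)
      have t3: "norm (\<zeta> x * of_real (m' x)) \<le> Z * (D / M\<^sup>2)"
        unfolding norm_mult by (intro mult_mono Z x) (use m'b x Z0 in auto)
      have "norm (G x) \<le> norm (\<zeta> x * of_real (M\<^sup>2 / ((q x)\<^sup>2 + M\<^sup>2)))
         + (norm (\<zeta>' x * of_real (m x)) + norm (\<zeta> x * of_real (m' x)))"
      proof -
        have "norm (G x) = norm (\<zeta> x * of_real (M\<^sup>2 / ((q x)\<^sup>2 + M\<^sup>2))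
            + \<i> * (\<zeta>' x * of_real (m x) + \<zeta> x * of_real (m' x)))"
          unfolding G_def norm_mult norm_exp_i_times by simp
        also have "\<dots> \<le> norm (\<zeta> x * of_real (M\<^sup>2 / ((q x)\<^sup>2 + M\<^sup>2)))
            + norm (\<i> * (\<zeta>' x * of_real (m x) + \<zeta> x * of_real (m' x)))"
          by (rule norm_triangle_ineq)
        also have "norm (\<i> * (\<zeta>' x * of_real (m x) + \<zeta> x * of_real (m' x)))
           \<le> norm (\<zeta>' x * of_real (m x)) + norm (\<zeta> x * of_real (m' x))"
          unfolding norm_mult[of "\<i>"] norm_ii mult_1 by (rule norm_triangle_ineq)
        finally show ?thesis by simp
      qed
      also have "\<dots> \<le> Z * (M\<^sup>2 / L\<^sup>2 + (if x \<in> ?T then 1 else 0)) + (Z * (1 / M) + Z * (D / M\<^sup>2))"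
        by (intro add_mono t1 t2 t3)
      finally show "norm (G x) \<le> Z * ((1 / M + D / M\<^sup>2 + M\<^sup>2 / L\<^sup>2) + (if x \<in> ?T then 1 else 0))"
        by (simp add: algebra_simps split: if_splits)
    qed
    then show ?thesis by (simp only: integral_unique[OF hb])
  qed
  then show ?thesis by (simp only: eq)
qed

lemma emeasure_eq_measure_bounded:
  fixes S :: "real set"
  assumes "S \<in> sets borel" "S \<subseteq> {A..B}"
  shows "emeasure lborel S = ennreal (measure lborel S)"
proof -
  have "emeasure lborel S \<le> emeasure lborel {A..B}"
    using assms by (intro emeasure_mono) auto
  also have "\<dots> < \<infinity>" by (cases "A \<le> B") auto
  finally show ?thesis by (intro emeasure_eq_ennreal_measure) auto
qed

lemma measure_mono_bounded:
  fixes S T :: "real set"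
  assumes "S \<subseteq> T" "T \<subseteq> {A..B}" "S \<in> sets borel" "T \<in> sets borel"
  shows "measure lborel S \<le> measure lborel T"
proof (rule measure_mono_fmeasurable[OF assms(1)])
  show "T \<in> fmeasurable lborel"
    using assms emeasure_eq_measure_bounded[OF assms(4,2)] by (intro fmeasurableI) auto
qed (use assms in simp)

lemma measure_le_length:
  fixes S :: "real set"
  assumes "S \<in> sets borel" "S \<subseteq> {A..B}" "A \<le> B"
  shows "measure lborel S \<le> B - A"
proof -
  have "{A..B} \<in> fmeasurable lborel" using assms(3) by (intro fmeasurableI) auto
  then have "measure lborel S \<le> measure lborel {A..B}"
    using assms by (intro measure_mono_fmeasurable) auto
  then show ?thesis using assms(3) by simp
qed

lemma measure_le_diameter:
  fixes S :: "real set"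
  assumes "S \<in> sets borel" "0 \<le> D" "\<And>x y. x \<in> S \<Longrightarrow> y \<in> S \<Longrightarrow> \<bar>x - y\<bar> \<le> D"
  shows "measure lborel S \<le> 2 * D"
proof (cases "S = {}")
  case False
  then obtain x where "x \<in> S" by auto
  with assms(3) have "S \<subseteq> {x - D..x + D}" by (force simp: abs_le_iff)
  then show ?thesis using measure_le_length[OF assms(1), of "x - D" "x + D"] assms(2) by simp
qed (use assms in simp)

lemma measure_affine_sublevel:
  fixes x y :: real
  assumes "x \<noteq> 0 \<or> y \<noteq> 0"
  obtains C where "0 < C" "\<And>\<delta>. 0 < \<delta> \<Longrightarrow> measure lborel {s \<in> {-1..2}. \<bar>x + s * y\<bar> < \<delta>} \<le> C * \<delta>"
proof (cases "y = 0")
  case False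
  show ?thesis
  proof
    show "0 < 4 / \<bar>y\<bar>" using False by simp
    fix \<delta> :: real assume d: "0 < \<delta>"
    have "measure lborel {s \<in> {-1..2}. \<bar>x + s * y\<bar> < \<delta>} \<le> 2 * (2 * \<delta> / \<bar>y\<bar>)"
    proof (rule measure_le_diameter)
      show "{s \<in> {-1..2}. \<bar>x + s * y\<bar> < \<delta>} \<in> sets borel" by measurable
      fix s t assume "s \<in> {s \<in> {-1..2}. \<bar>x + s * y\<bar> < \<delta>}" "t \<in> {s \<in> {-1..2}. \<bar>x + s * y\<bar> < \<delta>}"
      then have "\<bar>(x + s * y) - (x + t * y)\<bar> \<le> 2 * \<delta>" by auto
      then have "\<bar>(s - t) * y\<bar> \<le> 2 * \<delta>" by (simp add: algebra_simps)
      then show "\<bar>s - t\<bar> \<le> 2 * \<delta> / \<bar>y\<bar>" using False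
        by (simp only: abs_mult pos_le_divide_eq zero_less_abs_iff not_False_eq_True)
    qed (use d in auto)
    then show "measure lborel {s \<in> {-1..2}. \<bar>x + s * y\<bar> < \<delta>} \<le> 4 / \<bar>y\<bar> * \<delta>" by simp
  qed
next
  case True
  then have x: "x \<noteq> 0" using assms by simp
  show ?thesis
  proof
    show "0 < 3 / \<bar>x\<bar>" using x by simp
    fix \<delta> :: real assume d: "0 < \<delta>"
    show "measure lborel {s \<in> {-1..2}. \<bar>x + s * y\<bar> < \<delta>} \<le> 3 / \<bar>x\<bar> * \<delta>"
    proof (cases "\<bar>x\<bar> < \<delta>")
      case True
      have "measure lborel {s \<in> {-1..2}. \<bar>x + s * y\<bar> < \<delta>} \<le> 2 - (-1)"
        by (intro measure_le_length) auto
      also have "\<dots> \<le> 3 / \<bar>x\<bar> * \<delta>" using True x by (simp add: field_simps)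
      finally show ?thesis .
    qed (use \<open>y = 0\<close> d in auto)
  qed
qed

section \<open>Sums of two powers\<close>

definition two_powers :: "real \<Rightarrow> real \<Rightarrow> real \<Rightarrow> real \<Rightarrow> real \<Rightarrow> real" where
  "two_powers a b c d t = c * t powr a + d * t powr b"

abbreviation (input) two_powers' where
  "two_powers' a b c d \<equiv> two_powers (a - 1) (b - 1) (c * a) (d * b)"

abbreviation (input) two_powers'' where
  "two_powers'' a b c d \<equiv> two_powers (a - 1 - 1) (b - 1 - 1) (c * a * (a - 1)) (d * b * (b - 1))"

abbreviation (input) power_set :: "real \<Rightarrow> real \<Rightarrow> real \<Rightarrow> real \<Rightarrow> real \<Rightarrow> real set" where
  "power_set a b c d e \<equiv> {t \<in> {1/2..2}. \<bar>two_powers a b c d t\<bar> \<le> e}"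

lemma two_powers_measurable [measurable]:
  assumes [measurable]: "f \<in> borel_measurable M"
  shows "(\<lambda>x. two_powers a b c d (f x)) \<in> borel_measurable M"
  unfolding two_powers_def by measurable

lemma two_powers_derivative [derivative_intros]:
  assumes "(f has_real_derivative f') (at x within S)" "0 < f x"
  shows "((\<lambda>x. two_powers a b c d (f x)) has_real_derivative
     two_powers' a b c d (f x) * f') (at x within S)"
  unfolding two_powers_def
  by (rule derivative_eq_intros assms refl | use assms(2) in \<open>simp add: algebra_simps\<close>)+

lemma continuous_on_two_powers [continuous_intros]:
  "continuous_on S f \<Longrightarrow> (\<And>x. x \<in> S \<Longrightarrow> 0 < f x) \<Longrightarrow> continuous_on S (\<lambda>x. two_powers a b c d (f x))"
  unfolding two_powers_def by (intro continuous_intros) force+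

lemma powr_bounds:
  fixes t a :: real
  assumes "t \<in> {1/2..2}"
  shows "t powr a \<le> 2 powr \<bar>a\<bar>" "2 powr (-\<bar>a\<bar>) \<le> t powr a"
proof -
  have l: "\<bar>ln t\<bar> \<le> ln 2"
  proof -
    have "ln t \<le> ln 2" "ln (1/2) \<le> ln t" using assms by (intro ln_mono; simp)+
    then show ?thesis by (simp add: ln_div)
  qed
  have "\<bar>a * ln t\<bar> \<le> \<bar>a\<bar> * ln 2" unfolding abs_mult using l by (intro mult_left_mono) auto
  then have "a * ln t \<le> \<bar>a\<bar> * ln 2" "- \<bar>a\<bar> * ln 2 \<le> a * ln t" by auto
  then show "t powr a \<le> 2 powr \<bar>a\<bar>" "2 powr (-\<bar>a\<bar>) \<le> t powr a"
    using assms by (auto simp: powr_def)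
qed

lemma two_powers_bound:
  assumes "t \<in> {1/2..2}"
  shows "\<bar>two_powers a b c d t\<bar> \<le> (2 powr \<bar>a\<bar> + 2 powr \<bar>b\<bar>) * l1 c d"
proof -
  have "\<bar>two_powers a b c d t\<bar> \<le> \<bar>c\<bar> * t powr a + \<bar>d\<bar> * t powr b"
    unfolding two_powers_def by (rule order_trans[OF abs_triangle_ineq]) (simp add: abs_mult)
  also have "\<dots> \<le> \<bar>c\<bar> * 2 powr \<bar>a\<bar> + \<bar>d\<bar> * 2 powr \<bar>b\<bar>"
    using powr_bounds[OF assms] by (intro add_mono mult_left_mono) auto
  also have "\<dots> \<le> (2 powr \<bar>a\<bar> + 2 powr \<bar>b\<bar>) * l1 c d" by (simp add: algebra_simps)
  finally show ?thesis .
qed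

text \<open>Up to the harmless factor \<open>t powr a\<close> the function is \<open>c + d t powr (b - a)\<close>. If \<open>d\<close> is much smaller
than \<open>c\<close>, this stays away from zero. Otherwise its derivative has size at least about \<open>\<bar>d\<bar>\<close>, so any
two points of the set are close to each other.\<close>

lemma two_powers_sublevel:
  fixes a b :: real
  assumes "a \<noteq> b"
  obtains C where "0 < C" "\<And>c d \<epsilon>. 0 < l1 c d \<Longrightarrow> 0 < \<epsilon> \<Longrightarrow>
    measure lborel (power_set a b c d (\<epsilon> * l1 c d)) \<le> C * \<epsilon>"
proof -
  define e where "e = b - a"
  define A where "A = 2 powr \<bar>a\<bar>"
  define B where "B = 2 powr \<bar>e\<bar>"
  define E where "E = 2 powr (-\<bar>e - 1\<bar>)"
  define K where "K = 8 * A * B / (E * \<bar>e\<bar>)"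
  have e: "e \<noteq> 0" using assms by (simp add: e_def)
  have A: "1 \<le> A" and B: "1 \<le> B" by (auto simp: A_def B_def ge_one_powr_ge_zero)
  have E: "0 < E" by (simp add: E_def)
  have K: "0 < K" using A B E e by (auto simp: K_def)
  show ?thesis
  proof
    show "0 < 3 * A + 2 * K" using A K by simp
    fix c d \<epsilon> :: real assume s0: "0 < l1 c d" and eps: "0 < \<epsilon>"
    define s where "s = \<bar>c\<bar> + \<bar>d\<bar>"
    have s: "0 < s" using s0 by (simp add: s_def)
    define S where "S = power_set a b c d (\<epsilon> * s)"
    have Sb: "S \<in> sets borel" unfolding S_def by measurable
    have fac: "\<bar>c + d * t powr e\<bar> \<le> A * \<epsilon> * s" if "t \<in> S" for t
    proof -
      have t: "t \<in> {1/2..2}" "\<bar>two_powers a b c d t\<bar> \<le> \<epsilon> * s" using that by (auto simp: S_def)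
      have "two_powers a b c d t = t powr a * (c + d * t powr e)"
        by (simp add: two_powers_def e_def algebra_simps powr_diff)
      then have 1: "t powr a * \<bar>c + d * t powr e\<bar> \<le> \<epsilon> * s" using t(2) by (simp add: abs_mult)
      have "1 = A * 2 powr (-\<bar>a\<bar>)" by (simp add: A_def powr_add[symmetric])
      also have "\<dots> \<le> A * t powr a" using powr_bounds[OF t(1)] A by (intro mult_left_mono) auto
      finally have "\<bar>c + d * t powr e\<bar> \<le> (A * t powr a) * \<bar>c + d * t powr e\<bar>"
        using mult_right_mono[of 1 "A * t powr a" "\<bar>c + d * t powr e\<bar>"] by simp
      also have "\<dots> \<le> A * (\<epsilon> * s)" using 1 A by (simp add: mult.assoc)
      finally show ?thesis by (simp add: mult.assoc)
    qed
    have "measure lborel S \<le> (3 * A + 2 * K) * \<epsilon>"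
    proof (cases "\<bar>d\<bar> * (4 * B) < s")
      case True
      show ?thesis
      proof (cases "S = {}")
        case False
        then obtain t where tS: "t \<in> S" by auto
        then have t: "t \<in> {1/2..2}" by (auto simp: S_def)
        have "\<bar>d * t powr e\<bar> \<le> \<bar>d\<bar> * B" unfolding abs_mult B_def
          using powr_bounds[OF t] by (intro mult_left_mono) auto
        moreover have "\<bar>d\<bar> \<le> \<bar>d\<bar> * B" using B by (simp add: mult_le_cancel_left1)
        moreover have "\<bar>c\<bar> \<le> \<bar>c + d * t powr e\<bar> + \<bar>d * t powr e\<bar>" by linarith
        ultimately have "s / 2 \<le> A * \<epsilon> * s" using fac[OF tS] True by (simp add: s_def)
        then have "1 \<le> 2 * A * \<epsilon>" using s by (simp add: field_simps)
        moreover have "measure lborel S \<le> 2 - 1/2"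
          using Sb by (intro measure_le_length) (auto simp: S_def)
        moreover have "0 \<le> K * \<epsilon>" using K eps by simp
        ultimately show ?thesis by (simp add: algebra_simps)
      qed (use A K eps in simp)
    next
      case False
      have "measure lborel S \<le> 2 * (K * \<epsilon>)"
      proof (rule measure_le_diameter[OF Sb])
        have less: "y - x \<le> K * \<epsilon>" if xy: "x \<in> S" "y \<in> S" "x < y" for x y
        proof -
          have xy': "1/2 \<le> x" "y \<le> 2" using xy by (auto simp: S_def)
          have "\<exists>z. x < z \<and> z < y \<and> y powr e - x powr e = (y - x) * (e * z powr (e - 1))"
            using xy' xy by (intro MVT2) (auto intro!: derivative_eq_intros simp: powr_diff)
          then obtain z where z: "x < z" "z < y" "y powr e - x powr e = (y - x) * (e * z powr (e - 1))"
            by auto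
          have "E \<le> z powr (e - 1)" unfolding E_def using z xy' by (intro powr_bounds) auto
          then have "(y - x) * (\<bar>e\<bar> * E) \<le> (y - x) * (\<bar>e\<bar> * z powr (e - 1))"
            using xy by (intro mult_left_mono) auto
          also have "\<dots> = \<bar>y powr e - x powr e\<bar>" using z(3) xy(3) by (simp add: abs_mult)
          finally have "\<bar>d\<bar> * ((y - x) * (\<bar>e\<bar> * E)) \<le> \<bar>d\<bar> * \<bar>y powr e - x powr e\<bar>"
            by (intro mult_left_mono) auto
          also have "\<dots> = \<bar>(c + d * y powr e) - (c + d * x powr e)\<bar>"
            by (simp add: abs_mult[symmetric] algebra_simps)
          also have "\<dots> \<le> 2 * (A * \<epsilon> * s)" using fac[OF xy(1)] fac[OF xy(2)] by linarith
          also have "\<dots> \<le> 2 * (A * \<epsilon> * (\<bar>d\<bar> * (4 * B)))"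
            using False A eps by (intro mult_left_mono) auto
          finally have "\<bar>d\<bar> * ((y - x) * (\<bar>e\<bar> * E)) \<le> \<bar>d\<bar> * (8 * A * B * \<epsilon>)" by (simp add: algebra_simps)
          moreover have "0 < \<bar>d\<bar>" using False s by auto
          ultimately have "(y - x) * (\<bar>e\<bar> * E) \<le> 8 * A * B * \<epsilon>" by (simp only: mult_le_cancel_left_pos)
          then show ?thesis using E e by (simp add: K_def field_simps)
        qed
        fix x y assume "x \<in> S" "y \<in> S"
        then show "\<bar>x - y\<bar> \<le> K * \<epsilon>" using less[of x y] less[of y x] K eps
          by (cases x y rule: linorder_cases) auto
      qed (use K eps in auto)
      moreover have "0 \<le> A * \<epsilon>" using A eps by simp
      ultimately show ?thesis by (simp add: algebra_simps)
    qed
    then show "measure lborel (power_set a b c d (\<epsilon> * l1 c d)) \<le> (3 * A + 2 * K) * \<epsilon>"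
      by (simp add: S_def s_def)
  qed
qed

text \<open>With \<open>p = two_powers a b c d\<close> and \<open>\<theta> = (t - w) (d/dt)\<close>, this is \<open>(\<theta> - a) (\<theta> - b) p\<close> at \<open>t\<close>. The
substitution \<open>t = w + h u\<close> turns \<open>\<theta>\<close> into \<open>u (d/du)\<close>.\<close>

definition resid :: "real \<Rightarrow> real \<Rightarrow> real \<Rightarrow> real \<Rightarrow> real \<Rightarrow> real \<Rightarrow> real" where
  "resid a b c d w t =
     (t - w)\<^sup>2 * two_powers'' a b c d t
     + (1 - a - b) * ((t - w) * two_powers' a b c d t)
     + a * b * two_powers a b c d t"

abbreviation (input) resid_set :: "real \<Rightarrow> real \<Rightarrow> real \<Rightarrow> real \<Rightarrow> real \<Rightarrow> real \<Rightarrow> real set" where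
  "resid_set a b c d w e \<equiv> {t \<in> {1..2}. \<bar>resid a b c d w t\<bar> \<le> e}"

lemma resid_measurable [measurable]:
  assumes [measurable]: "f \<in> borel_measurable M" "g \<in> borel_measurable M"
  shows "(\<lambda>x. resid a b c d (f x) (g x)) \<in> borel_measurable M"
  unfolding resid_def by measurable

lemma resid_homogeneous:
  assumes "0 < t"
  shows "resid a b c d (s * t) t =
    two_powers a b (s * a * ((b + 1 - a) + s * (a - 1)) * c) (s * b * ((a + 1 - b) + s * (b - 1)) * d) t"
proof -
  have 1: "t powr (x - 1) = t powr x / t" for x using assms by (simp add: powr_diff)
  have 2: "(t - s * t)\<^sup>2 = (1 - s)\<^sup>2 * (t * t)" "t - s * t = (1 - s) * t"
    by (simp_all add: power2_eq_square algebra_simps)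
  show ?thesis unfolding resid_def two_powers_def 1 2 using assms
    by (simp add: field_simps power2_eq_square)
qed

text \<open>The substitution \<open>w = s t\<close> makes the residual a sum of two powers for each fixed \<open>s\<close>, with
coefficients \<open>s a ((b + 1 - a) + s (a - 1)) c\<close> and \<open>s b ((a + 1 - b) + s (b - 1)) d\<close>. The three affine
factors in \<open>s\<close> are not identically zero, so they are all at least \<open>\<delta>\<close> in absolute value off a set of measure
\<open>O (\<delta>)\<close>. For such \<open>s\<close> the coefficients are at least about \<open>\<delta>\<^sup>2\<close> times \<open>c\<close> and \<open>d\<close>, and the
threshold \<open>\<delta>\<^sup>3\<close> leaves a factor \<open>\<delta>\<close> for the sublevel estimate in \<open>t\<close>.\<close>

lemma resid_sublevel_area:
  fixes a b :: real
  assumes ab: "a \<noteq> b" "a \<noteq> 0" "b \<noteq> 0"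
  obtains C where "0 < C" "\<And>c d \<delta>. 0 < l1 c d \<Longrightarrow> 0 < \<delta> \<Longrightarrow>
    (\<integral>\<^sup>+w. indicator {-1..2} w *
       emeasure lborel (resid_set a b c d w (\<delta> ^ 3 * l1 c d)) \<partial>lborel) \<le> ennreal (C * \<delta>)"
proof -
  obtain C0 where C0: "0 < C0" "\<And>c d \<epsilon>. 0 < l1 c d \<Longrightarrow> 0 < \<epsilon> \<Longrightarrow>
    measure lborel (power_set a b c d (\<epsilon> * l1 c d)) \<le> C0 * \<epsilon>"
    using two_powers_sublevel[OF ab(1)] by blast
  have l: "b + 1 - a \<noteq> 0 \<or> a - 1 \<noteq> 0" "a + 1 - b \<noteq> 0 \<or> b - 1 \<noteq> 0" "(0::real) \<noteq> 0 \<or> (1::real) \<noteq> 0"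
    using ab by auto
  obtain C1 where C1: "0 < C1"
    "\<And>\<delta>. 0 < \<delta> \<Longrightarrow> measure lborel {s \<in> {-1..2}. \<bar>(b + 1 - a) + s * (a - 1)\<bar> < \<delta>} \<le> C1 * \<delta>"
    using measure_affine_sublevel[OF l(1)] by blast
  obtain C2 where C2: "0 < C2"
    "\<And>\<delta>. 0 < \<delta> \<Longrightarrow> measure lborel {s \<in> {-1..2}. \<bar>(a + 1 - b) + s * (b - 1)\<bar> < \<delta>} \<le> C2 * \<delta>"
    using measure_affine_sublevel[OF l(2)] by blast
  obtain C3 where C3: "0 < C3" "\<And>\<delta>. 0 < \<delta> \<Longrightarrow> measure lborel {s \<in> {-1..2}. \<bar>0 + s * 1\<bar> < \<delta>} \<le> C3 * \<delta>"
    using measure_affine_sublevel[OF l(3)] by blast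
  define m where "m = min \<bar>a\<bar> \<bar>b\<bar>"
  have m: "0 < m" using ab by (simp add: m_def)
  show ?thesis
  proof
    show "0 < 2 * (C1 + C2 + C3 + 3 * C0 / m)" using C0(1) C1(1) C2(1) C3(1) m
      by (auto intro!: add_pos_pos)
    fix c d \<delta> :: real assume n0: "0 < l1 c d" and \<delta>: "0 < \<delta>"
    define n where "n = \<bar>c\<bar> + \<bar>d\<bar>"
    have n: "0 < n" using n0 by (simp add: n_def)
    define u where "u = (\<lambda>w t. if w \<in> {-1..2} \<and> t \<in> {1..2} \<and> \<bar>resid a b c d w t\<bar> \<le> \<delta> ^ 3 * n then 1 else 0 :: ennreal)"
    define v where "v = (\<lambda>s t. if s \<in> {-1..2} \<and> t \<in> {1..2} \<and> \<bar>resid a b c d (s * t) t\<bar> \<le> \<delta> ^ 3 * n then 1 else 0 :: ennreal)"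
    have um: "(\<lambda>(w, t). u w t) \<in> borel_measurable (lborel \<Otimes>\<^sub>M lborel)"
      and vm: "(\<lambda>(w, t). v w t) \<in> borel_measurable (lborel \<Otimes>\<^sub>M lborel)"
      and vm2: "(\<lambda>(w, t). v t w) \<in> borel_measurable (lborel \<Otimes>\<^sub>M lborel)"
      unfolding u_def v_def case_prod_beta atLeastAtMost_iff by measurable
    \<comment> \<open>A factor of one of the two coefficients is small.\<close>
    define Bad where "Bad = (\<lambda>s. \<bar>(b + 1 - a) + s * (a - 1)\<bar> < \<delta> \<or> \<bar>(a + 1 - b) + s * (b - 1)\<bar> < \<delta> \<or> \<bar>0 + s * 1\<bar> < \<delta>)"
    have "(\<integral>\<^sup>+w. indicator {-1..2} w *
       emeasure lborel (resid_set a b c d w (\<delta> ^ 3 * n)) \<partial>lborel) = (\<integral>\<^sup>+w. \<integral>\<^sup>+t. u w t \<partial>lborel \<partial>lborel)"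
    proof (intro nn_integral_cong)
      fix w :: real
      have "(\<integral>\<^sup>+t. u w t \<partial>lborel) = (\<integral>\<^sup>+t. indicator {-1..2} w *
          indicator (resid_set a b c d w (\<delta> ^ 3 * n)) t \<partial>lborel)"
        by (intro nn_integral_cong) (auto simp: u_def indicator_def)
      also have "\<dots> = indicator {-1..2} w * (\<integral>\<^sup>+t.
          indicator (resid_set a b c d w (\<delta> ^ 3 * n)) t \<partial>lborel)"
        by (intro nn_integral_cmult) measurable
      also have "(\<integral>\<^sup>+t. indicator (resid_set a b c d w (\<delta> ^ 3 * n)) t \<partial>lborel)
         = emeasure lborel (resid_set a b c d w (\<delta> ^ 3 * n))"
        by (intro nn_integral_indicator) measurable
      finally show "indicator {-1..2} w *
        emeasure lborel (resid_set a b c d w (\<delta> ^ 3 * n)) = (\<integral>\<^sup>+t. u w t \<partial>lborel)" by simp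
    qed
    also have "\<dots> = (\<integral>\<^sup>+t. \<integral>\<^sup>+w. u w t \<partial>lborel \<partial>lborel)"
      using lborel_pair.Fubini'[OF um] by simp
    also have "\<dots> \<le> (\<integral>\<^sup>+t. 2 * \<integral>\<^sup>+s. v s t \<partial>lborel \<partial>lborel)"
    proof (intro nn_integral_mono)
      fix t :: real
      show "(\<integral>\<^sup>+w. u w t \<partial>lborel) \<le> 2 * \<integral>\<^sup>+s. v s t \<partial>lborel"
      proof (cases "t \<in> {1..2}")
        case True
        have [measurable]: "(\<lambda>w. u w t) \<in> borel_measurable borel" unfolding u_def by measurable
        have "(\<integral>\<^sup>+w. u w t \<partial>lborel) = ennreal \<bar>t\<bar> * (\<integral>\<^sup>+s. u (0 + t * s) t \<partial>lborel)"
          using True by (intro nn_integral_real_affine) auto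
        also have "\<dots> \<le> 2 * (\<integral>\<^sup>+s. v s t \<partial>lborel)"
        proof (intro mult_mono nn_integral_mono)
          have "ennreal \<bar>t\<bar> \<le> ennreal 2" using True by (intro ennreal_leI) auto
          then show "ennreal \<bar>t\<bar> \<le> 2" by simp
          fix s :: real
          have "-1 \<le> s" "s \<le> 2" if "-1 \<le> t * s" "t * s \<le> 2"
          proof -
            show "-1 \<le> s"
            proof (rule ccontr)
              assume "\<not> -1 \<le> s"
              then have "t * s \<le> 1 * s" using True by (intro mult_right_mono_neg) auto
              then show False using that \<open>\<not> -1 \<le> s\<close> by linarith
            qed
            show "s \<le> 2"
            proof (rule ccontr)
              assume "\<not> s \<le> 2"
              then have "1 * s \<le> t * s" using True by (intro mult_right_mono) auto
              then show False using that \<open>\<not> s \<le> 2\<close> by linarith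
            qed
          qed
          then show "u (0 + t * s) t \<le> v s t" by (auto simp: u_def v_def mult.commute)
        qed auto
        finally show ?thesis .
      next
        case False
        then have "u w t = 0" for w by (auto simp: u_def)
        then show ?thesis by simp
      qed
    qed
    also have "\<dots> = 2 * (\<integral>\<^sup>+t. \<integral>\<^sup>+s. v s t \<partial>lborel \<partial>lborel)"
      using vm2 by (intro nn_integral_cmult lborel.borel_measurable_nn_integral) simp
    finally have main: "(\<integral>\<^sup>+w. indicator {-1..2} w *
       emeasure lborel (resid_set a b c d w (\<delta> ^ 3 * n)) \<partial>lborel)
       \<le> 2 * (\<integral>\<^sup>+t. \<integral>\<^sup>+s. v s t \<partial>lborel \<partial>lborel)" .
    have "(\<integral>\<^sup>+t. \<integral>\<^sup>+s. v s t \<partial>lborel \<partial>lborel) = (\<integral>\<^sup>+s. \<integral>\<^sup>+t. v s t \<partial>lborel \<partial>lborel)"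
      using lborel_pair.Fubini'[OF vm] by simp
    also have "\<dots> \<le> (\<integral>\<^sup>+s. indicator {s \<in> {-1..2}. Bad s} s + ennreal (C0 * \<delta> / m) * indicator {-1..2} s \<partial>lborel)"
    proof (intro nn_integral_mono)
      fix s :: real
      let ?T = "{t \<in> {1..2}. \<bar>resid a b c d (s * t) t\<bar> \<le> \<delta> ^ 3 * n}"
      show "(\<integral>\<^sup>+t. v s t \<partial>lborel) \<le> indicator {s \<in> {-1..2}. Bad s} s + ennreal (C0 * \<delta> / m) * indicator {-1..2} s"
      proof (cases "s \<in> {-1..2}")
        case True
        have Tm: "?T \<in> sets borel" by measurable
        have "(\<integral>\<^sup>+t. v s t \<partial>lborel) = (\<integral>\<^sup>+t. indicator ?T t \<partial>lborel)" using True
          by (intro nn_integral_cong) (auto simp: v_def indicator_def)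
        also have "\<dots> = emeasure lborel ?T" by (intro nn_integral_indicator) measurable
        also have emT: "\<dots> = ennreal (measure lborel ?T)"
          by (rule emeasure_eq_measure_bounded[OF Tm, of 1 2]) auto
        finally have eq: "(\<integral>\<^sup>+t. v s t \<partial>lborel) = ennreal (measure lborel ?T)" .
        show ?thesis
        proof (cases "Bad s")
          case bad: True
          have "measure lborel ?T \<le> 2 - 1" using Tm by (intro measure_le_length) auto
          then have "ennreal (measure lborel ?T) \<le> 1" by simp
          then show ?thesis unfolding eq using bad True by (simp add: add_increasing2)
        next
          case good: False
          define c' where "c' = s * a * ((b + 1 - a) + s * (a - 1)) * c"
          define d' where "d' = s * b * ((a + 1 - b) + s * (b - 1)) * d"
          have 1: "\<delta> * m * \<delta> * \<bar>c\<bar> \<le> \<bar>c'\<bar>" unfolding c'_def abs_mult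
            using good \<delta> m by (intro mult_mono) (auto simp: Bad_def m_def)
          have 2: "\<delta> * m * \<delta> * \<bar>d\<bar> \<le> \<bar>d'\<bar>" unfolding d'_def abs_mult
            using good \<delta> m by (intro mult_mono) (auto simp: Bad_def m_def)
          have 3: "\<delta> * m * \<delta> * n \<le> \<bar>c'\<bar> + \<bar>d'\<bar>" using 1 2 by (simp add: n_def algebra_simps)
          have "0 < \<delta> * m * \<delta> * n" using \<delta> m n by simp
          with 3 have pos: "0 < l1 c' d'" by linarith
          have "\<delta> ^ 3 * n = (\<delta> / m) * (\<delta> * m * \<delta> * n)" using m by (simp add: power3_eq_cube)
          also have "\<dots> \<le> (\<delta> / m) * l1 c' d'" using 3 \<delta> m by (intro mult_left_mono) auto
          finally have 4: "\<delta> ^ 3 * n \<le> (\<delta> / m) * l1 c' d'" .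
          let ?U = "power_set a b c' d' ((\<delta> / m) * l1 c' d')"
          have Um: "?U \<in> sets borel" by measurable
          have "?T \<subseteq> ?U"
          proof
            fix t assume t: "t \<in> ?T"
            then have "resid a b c d (s * t) t = two_powers a b c' d' t"
              unfolding c'_def d'_def by (intro resid_homogeneous) auto
            then show "t \<in> ?U" using t 4 by auto
          qed
          then have "emeasure lborel ?T \<le> emeasure lborel ?U" using Um by (intro emeasure_mono) auto
          also have "\<dots> = ennreal (measure lborel ?U)"
            by (rule emeasure_eq_measure_bounded[OF Um, of "1/2" 2]) auto
          also have "\<dots> \<le> ennreal (C0 * (\<delta> / m))"
            using C0(2)[OF pos, of "\<delta> / m"] \<delta> m by (intro ennreal_leI) auto
          finally have "ennreal (measure lborel ?T) \<le> ennreal (C0 * \<delta> / m)"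
            unfolding emT by simp
          then show ?thesis unfolding eq using good True by simp
        qed
      next
        case False
        then have "v s t = 0" for t by (auto simp: v_def)
        then show ?thesis by simp
      qed
    qed
    also have "\<dots> = emeasure lborel {s \<in> {-1..2}. Bad s} + ennreal (C0 * \<delta> / m) * emeasure lborel {-1..2::real}"
    proof -
      have "{s \<in> {-1..2}. Bad s} \<in> sets borel" unfolding Bad_def by measurable
      then show ?thesis by (simp add: nn_integral_add nn_integral_cmult)
    qed
    also have "\<dots> \<le> ennreal ((C1 + C2 + C3) * \<delta>) + ennreal (C0 * \<delta> / m) * 3"
    proof (intro add_mono)
      let ?B1 = "{s \<in> {-1..2}. \<bar>(b + 1 - a) + s * (a - 1)\<bar> < \<delta>}"
      let ?B2 = "{s \<in> {-1..2}. \<bar>(a + 1 - b) + s * (b - 1)\<bar> < \<delta>}"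
      let ?B3 = "{s \<in> {-1..2::real}. \<bar>0 + s * 1\<bar> < \<delta>}"
      have B: "?B1 \<in> sets borel" "?B2 \<in> sets borel" "?B3 \<in> sets borel" by measurable
      have "{s \<in> {-1..2}. Bad s} = ?B1 \<union> (?B2 \<union> ?B3)" by (auto simp: Bad_def)
      then have "emeasure lborel {s \<in> {-1..2}. Bad s} \<le> emeasure lborel ?B1 + (emeasure lborel ?B2 + emeasure lborel ?B3)"
        using B by (auto intro!: order_trans[OF emeasure_subadditive] add_left_mono)
      also have "\<dots> = ennreal (measure lborel ?B1) + (ennreal (measure lborel ?B2) + ennreal (measure lborel ?B3))"
        by (intro arg_cong2[where f="(+)"] emeasure_eq_measure_bounded[where A="-1" and B=2] B) auto
      also have "\<dots> \<le> ennreal (C1 * \<delta>) + (ennreal (C2 * \<delta>) + ennreal (C3 * \<delta>))"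
        using C1(2)[OF \<delta>] C2(2)[OF \<delta>] C3(2)[OF \<delta>] by (intro add_mono ennreal_leI)
      also have "\<dots> = ennreal ((C1 + C2 + C3) * \<delta>)"
        using C1 C2 C3 \<delta> by (simp add: ennreal_plus[symmetric] algebra_simps del: ennreal_plus)
      finally show "emeasure lborel {s \<in> {-1..2}. Bad s} \<le> ennreal ((C1 + C2 + C3) * \<delta>)" .
    qed auto
    finally have inner: "(\<integral>\<^sup>+t. \<integral>\<^sup>+s. v s t \<partial>lborel \<partial>lborel)
       \<le> ennreal ((C1 + C2 + C3) * \<delta>) + ennreal (C0 * \<delta> / m) * 3" .
    note main
    also have "2 * (\<integral>\<^sup>+t. \<integral>\<^sup>+s. v s t \<partial>lborel \<partial>lborel)
       \<le> 2 * (ennreal ((C1 + C2 + C3) * \<delta>) + ennreal (C0 * \<delta> / m) * 3)"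
      by (rule mult_left_mono[OF inner]) simp
    also have "\<dots> = ennreal (2 * (C1 + C2 + C3 + 3 * C0 / m) * \<delta>)"
    proof -
      have E: "2 * (ennreal X + ennreal Y * 3) = ennreal (2 * (X + Y * 3))" if "0 \<le> X" "0 \<le> Y" for X Y
      proof -
        have "ennreal (2 * (X + Y * 3)) = ennreal 2 * ennreal (X + Y * 3)"
          using that by (intro ennreal_mult) auto
        also have "ennreal (X + Y * 3) = ennreal X + ennreal (Y * 3)"
          using that by (intro ennreal_plus) auto
        also have "ennreal (Y * 3) = ennreal Y * ennreal 3" using that by (intro ennreal_mult) auto
        finally show ?thesis by simp
      qed
      have "2 * (ennreal ((C1 + C2 + C3) * \<delta>) + ennreal (C0 * \<delta> / m) * 3)
         = ennreal (2 * ((C1 + C2 + C3) * \<delta> + C0 * \<delta> / m * 3))"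
        using C0 C1 C2 C3 m \<delta> by (intro E) auto
      also have "2 * ((C1 + C2 + C3) * \<delta> + C0 * \<delta> / m * 3) = 2 * (C1 + C2 + C3 + 3 * C0 / m) * \<delta>"
        by (simp add: algebra_simps)
      finally show ?thesis .
    qed
    finally show "(\<integral>\<^sup>+w. indicator {-1..2} w *
       emeasure lborel (resid_set a b c d w (\<delta> ^ 3 * l1 c d)) \<partial>lborel)
       \<le> ennreal (2 * (C1 + C2 + C3 + 3 * C0 / m) * \<delta>)" by (simp add: n_def)
  qed
qed

section \<open>The phase of the correlation integral\<close>

lemma two_powers_scaled_bound:
  assumes "t \<in> {1/2..2}"
  shows "\<bar>two_powers x y (c * p) (d * q) t\<bar> \<le> (2 powr \<bar>x\<bar> + 2 powr \<bar>y\<bar>) * l1 p q * l1 c d"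
proof -
  have "\<bar>two_powers x y (c * p) (d * q) t\<bar> \<le> (2 powr \<bar>x\<bar> + 2 powr \<bar>y\<bar>) * l1 (c * p) (d * q)"
    by (rule two_powers_bound[OF assms])
  also have "\<dots> \<le> (2 powr \<bar>x\<bar> + 2 powr \<bar>y\<bar>) * (l1 p q * l1 c d)"
    by (intro mult_left_mono) (auto simp: abs_mult algebra_simps)
  finally show ?thesis by (simp add: mult.assoc)
qed

lemma measure_affine_preimage_le:
  fixes T :: "real set" and h w :: real
  assumes "0 < h" and T: "T \<in> sets borel" "T \<subseteq> {A..B}"
    and S: "S \<in> sets borel" "S \<subseteq> {A'..B'}" and sub: "\<And>u. u \<in> S \<Longrightarrow> w + h * u \<in> T"
  shows "measure lborel S \<le> measure lborel T / h"
proof -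
  have "ennreal (h * measure lborel S) = ennreal h * emeasure lborel S"
    using assms by (simp add: emeasure_eq_measure_bounded[OF S] ennreal_mult)
  also have "\<dots> = ennreal h * (\<integral>\<^sup>+u. indicator S u \<partial>lborel)" using S by simp
  also have "\<dots> \<le> ennreal \<bar>h\<bar> * (\<integral>\<^sup>+u. indicator T (w + h * u) \<partial>lborel)"
    using assms by (intro mult_mono nn_integral_mono) (auto simp: indicator_def)
  also have "\<dots> = (\<integral>\<^sup>+t. indicator T t \<partial>lborel)"
    using assms by (intro nn_integral_real_affine[symmetric]) auto
  also have "\<dots> = ennreal (measure lborel T)"
    using T emeasure_eq_measure_bounded[OF T] by simp
  finally have "h * measure lborel S \<le> measure lborel T" by simp
  then show ?thesis using assms(1) by (simp add: field_simps)
qed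

lemma measure_subset_union3:
  fixes S :: "real set"
  assumes "S \<subseteq> S1 \<union> S2 \<union> S3" "S1 \<subseteq> {A..B}" "S2 \<subseteq> {A..B}" "S3 \<subseteq> {A..B}" "A \<le> B"
    "S1 \<in> sets borel" "S2 \<in> sets borel" "S3 \<in> sets borel" "S \<in> sets borel"
  shows "measure lborel S \<le> measure lborel S1 + measure lborel S2 + measure lborel S3"
proof -
  have fm: "X \<in> fmeasurable lborel" if "X \<in> sets borel" "X \<subseteq> {A..B}" for X
    using that emeasure_eq_measure_bounded[OF that] by (intro fmeasurableI) auto
  have "measure lborel S \<le> measure lborel (S1 \<union> S2 \<union> S3)"
    using assms by (intro measure_mono_fmeasurable fm) auto
  also have "\<dots> \<le> measure lborel (S1 \<union> S2) + measure lborel S3"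
    using assms by (intro measure_Un_le) auto
  also have "measure lborel (S1 \<union> S2) \<le> measure lborel S1 + measure lborel S2"
    using assms by (intro measure_Un_le) auto
  finally show ?thesis by simp
qed

text \<open>The derivative \<open>Q'\<close> of the phase \<open>Q u = P\<^sub>\<nu> (w + h u) - P\<^sub>\<mu> u\<close>, where \<open>c1\<close>, \<open>c2\<close> and \<open>d1\<close>, \<open>d2\<close> are the
coefficients in the derivatives of \<open>P\<^sub>\<nu>\<close> and \<open>P\<^sub>\<mu>\<close>. Differentiation only changes the parameters, so the
derivatives of \<open>Q\<close> of order two to four, for which abbreviations are introduced, are instances of the same
function.\<close>

definition phase1 where
  "phase1 a b c1 c2 d1 d2 h w u = h * two_powers a b c1 c2 (w + h * u) - two_powers a b d1 d2 u"

abbreviation (input) phase2 where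
  "phase2 a b c1 c2 d1 d2 h w \<equiv>
     phase1 (a - 1) (b - 1) (h * (c1 * a)) (h * (c2 * b)) (d1 * a) (d2 * b) h w"

abbreviation (input) phase3 where
  "phase3 a b c1 c2 d1 d2 h w \<equiv>
     phase1 (a - 1 - 1) (b - 1 - 1) (h * (h * (c1 * a) * (a - 1))) (h * (h * (c2 * b) * (b - 1)))
       (d1 * a * (a - 1)) (d2 * b * (b - 1)) h w"

abbreviation (input) phase4 where
  "phase4 a b c1 c2 d1 d2 h w \<equiv> phase1 (a - 1 - 1 - 1) (b - 1 - 1 - 1)
     (h * (h * (h * (c1 * a) * (a - 1)) * (a - 1 - 1))) (h * (h * (h * (c2 * b) * (b - 1)) * (b - 1 - 1)))
     (d1 * a * (a - 1) * (a - 1 - 1)) (d2 * b * (b - 1) * (b - 1 - 1)) h w"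

lemma phase1_measurable [measurable]:
  "(\<lambda>u. phase1 a b c1 c2 d1 d2 h w u) \<in> borel_measurable borel"
  unfolding phase1_def by measurable

lemma phase1_derivative:
  assumes "0 < u" "0 < w + h * u"
  shows "(phase1 a b c1 c2 d1 d2 h w has_real_derivative
     phase2 a b c1 c2 d1 d2 h w u) (at u within S)"
proof -
  have "((\<lambda>u. w + h * u) has_real_derivative h) (at u within S)"
    by (auto intro!: derivative_eq_intros)
  from two_powers_derivative[OF this assms(2)] two_powers_derivative[OF DERIV_ident assms(1)]
  have "((\<lambda>u. h * two_powers a b c1 c2 (w + h * u) - two_powers a b d1 d2 u) has_real_derivative
     h * (two_powers' a b c1 c2 (w + h * u) * h)
     - two_powers' a b d1 d2 u * 1) (at u within S)"
    by (intro DERIV_diff DERIV_cmult)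
  then show ?thesis unfolding phase1_def [abs_def]
    by (rule DERIV_cong) (simp add: two_powers_def algebra_simps)
qed

lemma phase1_bound:
  assumes "u \<in> {1/2..2}" "w + h * u \<in> {1/2..2}" "0 \<le> h" "h \<le> 1" "0 \<le> g" "g \<le> 1"
  shows "\<bar>phase1 x y (g * (c1 * p)) (g * (c2 * q)) (d1 * p) (d2 * q) h w u\<bar>
     \<le> (2 powr \<bar>x\<bar> + 2 powr \<bar>y\<bar>) * l1 p q * (h * l1 c1 c2 + l1 d1 d2)"
proof -
  let ?K = "(2 powr \<bar>x\<bar> + 2 powr \<bar>y\<bar>) * l1 p q"
  have K: "0 \<le> ?K" by simp
  have "two_powers x y (g * (c1 * p)) (g * (c2 * q)) (w + h * u) = g * two_powers x y (c1 * p) (c2 * q) (w + h * u)"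
    by (simp add: two_powers_def algebra_simps)
  then have "\<bar>h * two_powers x y (g * (c1 * p)) (g * (c2 * q)) (w + h * u)\<bar>
    = (h * g) * \<bar>two_powers x y (c1 * p) (c2 * q) (w + h * u)\<bar>" using assms by (simp add: abs_mult)
  also have "\<dots> \<le> (h * 1) * (?K * l1 c1 c2)"
    using assms two_powers_scaled_bound[OF assms(2)] by (intro mult_mono) auto
  finally have 1: "\<bar>h * two_powers x y (g * (c1 * p)) (g * (c2 * q)) (w + h * u)\<bar> \<le> h * (?K * l1 c1 c2)" by simp
  have 2: "\<bar>two_powers x y (d1 * p) (d2 * q) u\<bar> \<le> ?K * l1 d1 d2"
    by (rule two_powers_scaled_bound[OF assms(1)])
  have "\<bar>phase1 x y (g * (c1 * p)) (g * (c2 * q)) (d1 * p) (d2 * q) h w u\<bar>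
    \<le> h * (?K * l1 c1 c2) + ?K * l1 d1 d2"
    unfolding phase1_def by (rule order_trans[OF abs_triangle_ineq4 add_mono[OF 1 2]])
  also have "\<dots> = ?K * (h * l1 c1 c2 + l1 d1 d2)" by (simp add: algebra_simps)
  finally show ?thesis .
qed

text \<open>The left-hand side is \<open>(\<theta> - a) (\<theta> - b)\<close> applied to \<open>Q'\<close>, with \<open>\<theta> = u (d/du)\<close>. The terms with \<open>d1\<close>
and \<open>d2\<close> disappear, because each power of \<open>u\<close> is an eigenfunction of \<open>\<theta>\<close>.\<close>

lemma phase1_annihilate:
  assumes "0 < u"
  shows "u\<^sup>2 * phase3 a b c1 c2 d1 d2 h w u
     + (1 - a - b) * (u * phase2 a b c1 c2 d1 d2 h w u)
     + a * b * phase1 a b c1 c2 d1 d2 h w u = h * resid a b c1 c2 w (w + h * u)"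
proof -
  have 0: "resid a b d1 d2 0 u = 0"
    using resid_homogeneous[OF assms, of a b d1 d2 0] by (simp add: two_powers_def)
  have 1: "two_powers x y (h * c) (h * d) t = h * two_powers x y c d t" for x y c d t
    by (simp add: two_powers_def algebra_simps)
  have 2: "two_powers x y (h * c * e) (h * d * f) t = h * two_powers x y (c * e) (d * f) t" for x y c d e f t
    by (simp add: two_powers_def algebra_simps)
  define X0 X1 X2 Y0 Y1 Y2 where
    "X0 = two_powers a b c1 c2 (w + h * u)" and
    "X1 = two_powers' a b c1 c2 (w + h * u)" and
    "X2 = two_powers'' a b c1 c2 (w + h * u)" and
    "Y0 = two_powers a b d1 d2 u" and
    "Y1 = two_powers' a b d1 d2 u" and
    "Y2 = two_powers'' a b d1 d2 u"
  note XY = this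
  have R: "h * resid a b c1 c2 w (w + h * u) - resid a b d1 d2 0 u =
    h * ((h * u)\<^sup>2 * X2 + (1 - a - b) * ((h * u) * X1) + a * b * X0)
    - (u\<^sup>2 * Y2 + (1 - a - b) * (u * Y1) + a * b * Y0)"
    unfolding resid_def XY by simp
  have P: "phase1 a b c1 c2 d1 d2 h w u = h * X0 - Y0"
    "phase2 a b c1 c2 d1 d2 h w u = h * (h * X1) - Y1"
    "phase3 a b c1 c2 d1 d2 h w u = h * (h * (h * X2)) - Y2"
    unfolding phase1_def 1 2 XY by simp_all
  have "h * resid a b c1 c2 w (w + h * u) - resid a b d1 d2 0 u
    = u\<^sup>2 * (h * (h * (h * X2)) - Y2) + (1 - a - b) * (u * (h * (h * X1) - Y1)) + a * b * (h * X0 - Y0)"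
    unfolding R by algebra
  then show ?thesis by (simp only: 0 P diff_0_right)
qed

text \<open>If \<open>f\<close> is small at a point, then either \<open>f'\<close> is not, or \<open>f''\<close> is not although \<open>f'\<close> is, or all three
are small. The first two alternatives hold on small sets by \<open>sublevel_derivative\<close>.\<close>

lemma sublevel_second_order:
  fixes f f1 f2 f3 :: "real \<Rightarrow> real"
  assumes AB: "A \<le> B" "B - A \<le> 1" and N: "0 < N" and rho: "0 < \<rho>0" "0 < \<rho>1" "0 < \<rho>2"
    and f: "\<And>x. x \<in> {A..B} \<Longrightarrow> (f has_real_derivative f1 x) (at x within {A..B})"
    and f1: "\<And>x. x \<in> {A..B} \<Longrightarrow> (f1 has_real_derivative f2 x) (at x within {A..B})"
    and f2: "\<And>x. x \<in> {A..B} \<Longrightarrow> (f2 has_real_derivative f3 x) (at x within {A..B})"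
    and cf3: "continuous_on {A..B} f3"
    and D: "\<And>x. x \<in> {A..B} \<Longrightarrow> \<bar>f1 x\<bar> \<le> D * N" "\<And>x. x \<in> {A..B} \<Longrightarrow> \<bar>f2 x\<bar> \<le> D * N"
       "\<And>x. x \<in> {A..B} \<Longrightarrow> \<bar>f3 x\<bar> \<le> D * N"
    and S: "S \<in> sets borel" "S \<subseteq> {A..B}"
       "\<And>x. x \<in> {A..B} \<Longrightarrow> \<bar>f x\<bar> \<le> \<rho>0 * N \<Longrightarrow> \<bar>f1 x\<bar> \<le> \<rho>1 * N \<Longrightarrow> \<bar>f2 x\<bar> \<le> \<rho>2 * N \<Longrightarrow> x \<in> S"
  shows "measure lborel {x \<in> {A..B}. \<bar>f x\<bar> \<le> \<rho>0 * N}
     \<le> 16 * D * (\<rho>0 / \<rho>1\<^sup>2) + 16 * D * (\<rho>1 / \<rho>2\<^sup>2) + measure lborel S"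
proof -
  have cf: "continuous_on {A..B} f" "continuous_on {A..B} f1" "continuous_on {A..B} f2"
    by (rule DERIV_continuous_on, erule f f1 f2)+
  have D0: "0 \<le> D"
  proof -
    have "A \<in> {A..B}" using AB by simp
    then have "0 \<le> D * N" by (rule order_trans[OF abs_ge_zero D(1)])
    then show ?thesis using N by (simp add: zero_le_mult_iff)
  qed
  have b: "{x \<in> {A..B}. \<bar>g x\<bar> \<le> c} \<in> sets borel" if "continuous_on {A..B} g" for g :: "real \<Rightarrow> real" and c
  proof -
    have "closed ({A..B} \<inter> g -` {-c..c})" by (intro continuous_closed_preimage that; simp)
    also have "{A..B} \<inter> g -` {-c..c} = {x \<in> {A..B}. \<bar>g x\<bar> \<le> c}" by auto
    finally show ?thesis by auto
  qed
  have b2: "{x \<in> {A..B}. \<bar>g x\<bar> \<le> c \<and> e \<le> \<bar>k x\<bar>} \<in> sets borel"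
    if "continuous_on {A..B} g" "continuous_on {A..B} k" for g k :: "real \<Rightarrow> real" and c e
  proof -
    have "closed ({A..B} \<inter> (\<lambda>x. \<bar>k x\<bar>) -` {e..})" by (intro continuous_closed_preimage continuous_intros that; simp)
    then have "({A..B} \<inter> (\<lambda>x. \<bar>k x\<bar>) -` {e..}) \<in> sets borel" by auto
    from sets.Int[OF b[OF that(1), of c] this]
    have "{x \<in> {A..B}. \<bar>g x\<bar> \<le> c} \<inter> ({A..B} \<inter> (\<lambda>x. \<bar>k x\<bar>) -` {e..}) \<in> sets borel" .
    moreover have "{x \<in> {A..B}. \<bar>g x\<bar> \<le> c} \<inter> ({A..B} \<inter> (\<lambda>x. \<bar>k x\<bar>) -` {e..})
        = {x \<in> {A..B}. \<bar>g x\<bar> \<le> c \<and> e \<le> \<bar>k x\<bar>}" by auto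
    ultimately show ?thesis by (simp only:)
  qed
  have scale: "8 * (1 + (B - A)) * (D * N) * (r * N) / (s * N)\<^sup>2 \<le> 16 * D * (r / s\<^sup>2)" if "0 < r" "0 < s" for r s
  proof -
    have "8 * (1 + (B - A)) * (D * N) * (r * N) / (s * N)\<^sup>2 = (8 * (1 + (B - A))) * (D * (r / s\<^sup>2))"
      using N that by (simp add: field_simps power2_eq_square)
    also have "\<dots> \<le> 16 * (D * (r / s\<^sup>2))" using AB D0 that by (intro mult_right_mono) auto
    finally show ?thesis by simp
  qed
  have "measure lborel {x \<in> {A..B}. \<bar>f x\<bar> \<le> \<rho>0 * N} \<le>
     measure lborel {x \<in> {A..B}. \<bar>f x\<bar> \<le> \<rho>0 * N \<and> \<rho>1 * N \<le> \<bar>f1 x\<bar>} +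
     measure lborel {x \<in> {A..B}. \<bar>f1 x\<bar> \<le> \<rho>1 * N \<and> \<rho>2 * N \<le> \<bar>f2 x\<bar>} + measure lborel S"
  proof (rule measure_subset_union3)
    show "{x \<in> {A..B}. \<bar>f x\<bar> \<le> \<rho>0 * N} \<subseteq> {x \<in> {A..B}. \<bar>f x\<bar> \<le> \<rho>0 * N \<and> \<rho>1 * N \<le> \<bar>f1 x\<bar>}
      \<union> {x \<in> {A..B}. \<bar>f1 x\<bar> \<le> \<rho>1 * N \<and> \<rho>2 * N \<le> \<bar>f2 x\<bar>} \<union> S"
    proof
      fix x assume x: "x \<in> {x \<in> {A..B}. \<bar>f x\<bar> \<le> \<rho>0 * N}"
      show "x \<in> {x \<in> {A..B}. \<bar>f x\<bar> \<le> \<rho>0 * N \<and> \<rho>1 * N \<le> \<bar>f1 x\<bar>}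
      \<union> {x \<in> {A..B}. \<bar>f1 x\<bar> \<le> \<rho>1 * N \<and> \<rho>2 * N \<le> \<bar>f2 x\<bar>} \<union> S"
      proof (cases "\<rho>1 * N \<le> \<bar>f1 x\<bar>")
        case False
        then show ?thesis using x S(3)[of x] by (cases "\<rho>2 * N \<le> \<bar>f2 x\<bar>") auto
      qed (use x in auto)
    qed
    show "A \<le> B" "S \<subseteq> {A..B}" "S \<in> sets borel" by fact+
    show "{x \<in> {A..B}. \<bar>f x\<bar> \<le> \<rho>0 * N} \<in> sets borel" by (rule b[OF cf(1)])
    show "{x \<in> {A..B}. \<bar>f x\<bar> \<le> \<rho>0 * N \<and> \<rho>1 * N \<le> \<bar>f1 x\<bar>} \<in> sets borel"
      by (rule b2[OF cf(1,2)])
    show "{x \<in> {A..B}. \<bar>f1 x\<bar> \<le> \<rho>1 * N \<and> \<rho>2 * N \<le> \<bar>f2 x\<bar>} \<in> sets borel"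
      by (rule b2[OF cf(2,3)])
  qed auto
  also have "measure lborel {x \<in> {A..B}. \<bar>f x\<bar> \<le> \<rho>0 * N \<and> \<rho>1 * N \<le> \<bar>f1 x\<bar>} \<le> 16 * D * (\<rho>0 / \<rho>1\<^sup>2)"
    by (rule order_trans[OF sublevel_derivative[OF AB(1) mult_pos_pos[OF rho(1) N] mult_pos_pos[OF rho(2) N]
          f f1 cf(3) D(1,2)] scale[OF rho(1,2)]])
  also have "measure lborel {x \<in> {A..B}. \<bar>f1 x\<bar> \<le> \<rho>1 * N \<and> \<rho>2 * N \<le> \<bar>f2 x\<bar>} \<le> 16 * D * (\<rho>1 / \<rho>2\<^sup>2)"
    by (rule order_trans[OF sublevel_derivative[OF AB(1) mult_pos_pos[OF rho(2) N] mult_pos_pos[OF rho(3) N]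
          f1 f2 cf3 D(2,3)] scale[OF rho(2,3)]])
  finally show ?thesis by simp
qed

text \<open>A common bound for the derivatives of all the sums of two powers that occur, relative to the size
of the coefficients. The four summands belong to the derivatives of order one to four of the phase.\<close>

definition growth :: "real \<Rightarrow> real \<Rightarrow> real" where
  "growth a b = (2 powr \<bar>a\<bar> + 2 powr \<bar>b\<bar>) * l1 1 1
     + (2 powr \<bar>a - 1\<bar> + 2 powr \<bar>b - 1\<bar>) * l1 a b
     + (2 powr \<bar>a - 1 - 1\<bar> + 2 powr \<bar>b - 1 - 1\<bar>) * l1 (a * (a - 1)) (b * (b - 1))
     + (2 powr \<bar>a - 1 - 1 - 1\<bar> + 2 powr \<bar>b - 1 - 1 - 1\<bar>) * l1 (a * (a - 1) * (a - 1 - 1)) (b * (b - 1) * (b - 1 - 1))"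

lemma growth_parts:
  "(2 powr \<bar>a\<bar> + 2 powr \<bar>b\<bar>) * l1 1 1 \<le> growth a b"
  "(2 powr \<bar>a - 1\<bar> + 2 powr \<bar>b - 1\<bar>) * l1 a b \<le> growth a b"
  "(2 powr \<bar>a - 1 - 1\<bar> + 2 powr \<bar>b - 1 - 1\<bar>) * l1 (a * (a - 1)) (b * (b - 1)) \<le> growth a b"
  "(2 powr \<bar>a - 1 - 1 - 1\<bar> + 2 powr \<bar>b - 1 - 1 - 1\<bar>) * l1 (a * (a - 1) * (a - 1 - 1)) (b * (b - 1) * (b - 1 - 1)) \<le> growth a b"
proof -
  have nn: "0 \<le> (2 powr x + 2 powr y) * l1 p q" for x y p q :: real by simp
  show "(2 powr \<bar>a\<bar> + 2 powr \<bar>b\<bar>) * l1 1 1 \<le> growth a b"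
    "(2 powr \<bar>a - 1\<bar> + 2 powr \<bar>b - 1\<bar>) * l1 a b \<le> growth a b"
    "(2 powr \<bar>a - 1 - 1\<bar> + 2 powr \<bar>b - 1 - 1\<bar>) * l1 (a * (a - 1)) (b * (b - 1)) \<le> growth a b"
    "(2 powr \<bar>a - 1 - 1 - 1\<bar> + 2 powr \<bar>b - 1 - 1 - 1\<bar>) * l1 (a * (a - 1) * (a - 1 - 1)) (b * (b - 1) * (b - 1 - 1)) \<le> growth a b"
    unfolding growth_def
    by (rule add_increasing2[OF nn add_increasing2[OF nn add_increasing2[OF nn order_refl]]]
        add_increasing2[OF nn add_increasing2[OF nn add_increasing[OF nn order_refl]]]
        add_increasing2[OF nn add_increasing[OF add_nonneg_nonneg[OF nn nn] order_refl]]
        add_increasing[OF add_nonneg_nonneg[OF add_nonneg_nonneg[OF nn nn] nn] order_refl])+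
qed

lemma growth_pos: "0 < growth a b"
proof -
  have "0 < (2 powr \<bar>a\<bar> + 2 powr \<bar>b\<bar>) * l1 1 1" by (simp add: add_pos_pos)
  with growth_parts(1)[of a b] show ?thesis by linarith
qed

lemma phase1_bounds:
  assumes "u \<in> {1/2..2}" "w + h * u \<in> {1/2..2}" "0 \<le> h" "h \<le> 1"
    and N: "N = h * l1 c1 c2 + l1 d1 d2"
  shows "\<bar>phase2 a b c1 c2 d1 d2 h w u\<bar> \<le> growth a b * N"
    "\<bar>phase3 a b c1 c2 d1 d2 h w u\<bar> \<le> growth a b * N"
    "\<bar>phase4 a b c1 c2 d1 d2 h w u\<bar> \<le> growth a b * N"
proof -
  have N0: "0 \<le> h * l1 c1 c2 + l1 d1 d2" using assms by simp
  note bd = phase1_bound[OF assms(1-4)]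
  show "\<bar>phase2 a b c1 c2 d1 d2 h w u\<bar> \<le> growth a b * N"
    unfolding N by (rule order_trans[OF bd[OF assms(3,4)] mult_right_mono[OF growth_parts(2) N0]])
  have hh: "0 \<le> h * h" "h * h \<le> 1" using assms by (auto intro: mult_le_one)
  have hhh: "0 \<le> h * h * h" "h * h * h \<le> 1" using assms hh by (auto intro: mult_le_one)
  have e2: "h * (h * (c * x) * y) = (h * h) * (c * (x * y))" for c x y by simp
  have e3: "h * (h * (h * (c * x) * y) * z) = (h * h * h) * (c * (x * y * z))" for c x y z by simp
  have f2: "d * x * y = d * (x * y)" "d * x * y * z = d * (x * y * z)" for d x y z :: real by simp_all
  have "\<bar>phase1 (a - 1 - 1) (b - 1 - 1) ((h * h) * (c1 * (a * (a - 1)))) ((h * h) * (c2 * (b * (b - 1))))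
       (d1 * (a * (a - 1))) (d2 * (b * (b - 1))) h w u\<bar> \<le> growth a b * N"
    unfolding N by (rule order_trans[OF bd[OF hh] mult_right_mono[OF growth_parts(3) N0]])
  then show "\<bar>phase3 a b c1 c2 d1 d2 h w u\<bar> \<le> growth a b * N"
    unfolding e2 f2(1)[of d1] f2(1)[of d2] .
  have "\<bar>phase1 (a - 1 - 1 - 1) (b - 1 - 1 - 1)
        ((h * h * h) * (c1 * (a * (a - 1) * (a - 1 - 1)))) ((h * h * h) * (c2 * (b * (b - 1) * (b - 1 - 1))))
       (d1 * (a * (a - 1) * (a - 1 - 1))) (d2 * (b * (b - 1) * (b - 1 - 1))) h w u\<bar> \<le> growth a b * N"
    unfolding N by (rule order_trans[OF bd[OF hhh] mult_right_mono[OF growth_parts(4) N0]])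
  then show "\<bar>phase4 a b c1 c2 d1 d2 h w u\<bar> \<le> growth a b * N"
    unfolding e3 f2(2)[of d1] f2(2)[of d2] .
qed

lemma phase1_continuous:
  assumes "\<And>u. u \<in> S \<Longrightarrow> 0 < u \<and> 0 < w + h * u"
  shows "continuous_on S (phase1 a b c1 c2 d1 d2 h w)"
  unfolding phase1_def [abs_def] using assms by (intro continuous_intros) auto

lemma two_powers_growth:
  assumes "t \<in> {1/2..2}"
  shows "\<bar>two_powers a b c d t\<bar> \<le> growth a b * l1 c d"
    "\<bar>two_powers' a b c d t\<bar> \<le> growth a b * l1 c d"
    "\<bar>two_powers'' a b c d t\<bar> \<le> growth a b * l1 c d"
proof -
  have n: "0 \<le> \<bar>c\<bar> + \<bar>d\<bar>" by simp
  have "\<bar>two_powers a b (c * 1) (d * 1) t\<bar> \<le> growth a b * l1 c d"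
    by (rule order_trans[OF two_powers_scaled_bound[OF assms] mult_right_mono[OF growth_parts(1) n]])
  then show "\<bar>two_powers a b c d t\<bar> \<le> growth a b * l1 c d" by simp
  show "\<bar>two_powers' a b c d t\<bar> \<le> growth a b * l1 c d"
    by (rule order_trans[OF two_powers_scaled_bound[OF assms] mult_right_mono[OF growth_parts(2) n]])
  show "\<bar>two_powers'' a b c d t\<bar> \<le> growth a b * l1 c d"
    using order_trans[OF two_powers_scaled_bound[OF assms] mult_right_mono[OF growth_parts(3) n]]
    by (simp only: mult.assoc)
qed

text \<open>At \<open>t = w\<close> the first two terms of the residual vanish, and the remaining one is \<open>a b\<close> times
\<open>two_powers a b c d w\<close>. For \<open>t\<close> at distance \<open>g\<close> from \<open>w\<close> the error is \<open>O (g)\<close>.\<close>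

lemma resid_near_diagonal:
  assumes t: "t \<in> {1..2}" and w: "w \<in> {1/2..t}" and tw: "t - w \<le> g" and ab: "a \<noteq> 0" "b \<noteq> 0"
    and small: "\<bar>resid a b c d w t\<bar> \<le> g * l1 c d"
  shows "\<bar>two_powers a b c d w\<bar> \<le>
     ((1 + (2 + \<bar>1 - a - b\<bar>) * growth a b) / \<bar>a * b\<bar> + growth a b) * g * l1 c d"
proof -
  define n where "n = \<bar>c\<bar> + \<bar>d\<bar>"
  define G where "G = growth a b"
  have G: "0 < G" by (simp add: G_def growth_pos)
  have n: "0 \<le> n" by (simp add: n_def)
  have g: "0 \<le> g" using tw w by auto
  have t': "t \<in> {1/2..2}" using t by auto
  define X1 where "X1 = two_powers' a b c d t"
  define X2 where "X2 = two_powers'' a b c d t"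
  have X: "\<bar>X1\<bar> \<le> G * n" "\<bar>X2\<bar> \<le> G * n"
    unfolding X1_def X2_def G_def n_def by (rule two_powers_growth[OF t'])+
  have i1: "\<bar>(t - w) * X1\<bar> \<le> g * (G * n)" unfolding abs_mult using tw w X(1) g by (intro mult_mono) auto
  have i2: "\<bar>(t - w)\<^sup>2 * X2\<bar> \<le> 2 * (g * (G * n))"
  proof -
    have "(t - w) * (t - w) \<le> 2 * g" using tw w t by (intro mult_mono) auto
    then have "\<bar>(t - w)\<^sup>2 * X2\<bar> \<le> (2 * g) * (G * n)" unfolding abs_mult using X(2) g
      by (intro mult_mono) (auto simp: power2_eq_square)
    then show ?thesis by simp
  qed
  have i3: "\<bar>(1 - a - b) * ((t - w) * X1)\<bar> \<le> \<bar>1 - a - b\<bar> * (g * (G * n))"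
    unfolding abs_mult[of "1 - a - b"] by (intro mult_left_mono i1) auto
  have "a * b * two_powers a b c d t = resid a b c d w t - (t - w)\<^sup>2 * X2 - (1 - a - b) * ((t - w) * X1)"
    unfolding resid_def X1_def X2_def by simp
  then have "\<bar>a * b * two_powers a b c d t\<bar> \<le> g * n + 2 * (g * (G * n)) + \<bar>1 - a - b\<bar> * (g * (G * n))"
    using small[folded n_def] i2 i3 by linarith
  then have "\<bar>a * b\<bar> * \<bar>two_powers a b c d t\<bar> \<le> (1 + (2 + \<bar>1 - a - b\<bar>) * G) * (g * n)"
    unfolding abs_mult[of "a * b"] by (simp add: algebra_simps)
  then have 1: "\<bar>two_powers a b c d t\<bar> \<le> (1 + (2 + \<bar>1 - a - b\<bar>) * G) / \<bar>a * b\<bar> * (g * n)"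
    using ab by (simp add: pos_le_divide_eq mult.commute)
  have 2: "\<bar>two_powers a b c d t - two_powers a b c d w\<bar> \<le> G * n * g"
  proof (cases "w = t")
    case False
    have "\<exists>z. w < z \<and> z < t \<and> two_powers a b c d t - two_powers a b c d w =
        (t - w) * (two_powers' a b c d z * 1)"
    proof (rule MVT2)
      show "w < t" using False w by auto
      fix x assume "w \<le> x" "x \<le> t"
      then have x: "0 < x" using w by auto
      show "(two_powers a b c d has_real_derivative two_powers' a b c d x * 1) (at x)"
        by (rule two_powers_derivative[OF DERIV_ident x])
    qed
    then obtain z where z: "w < z" "z < t" and eq: "two_powers a b c d t - two_powers a b c d w =
        (t - w) * (two_powers' a b c d z * 1)" by auto
    have z': "z \<in> {1/2..2}" using z w t by auto
    have "\<bar>(t - w) * two_powers' a b c d z\<bar> \<le> g * (G * n)"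
      unfolding abs_mult G_def n_def using tw w g by (intro mult_mono two_powers_growth[OF z']) auto
    then show ?thesis unfolding eq by (simp add: mult_ac)
  qed (use G n g in auto)
  have "\<bar>two_powers a b c d w\<bar> \<le> (1 + (2 + \<bar>1 - a - b\<bar>) * G) / \<bar>a * b\<bar> * (g * n) + G * n * g"
    using 1 2 by linarith
  also have "\<dots> = ((1 + (2 + \<bar>1 - a - b\<bar>) * G) / \<bar>a * b\<bar> + G) * g * n" by (simp add: algebra_simps)
  finally show ?thesis by (simp only: G_def n_def)
qed

text \<open>Only the last two terms of the bound depend on \<open>w\<close>, and they involve neither \<open>h\<close> nor \<open>d1\<close> and \<open>d2\<close>:
this is what makes a majorant of the correlation integral possible that is uniform in the smaller dilation and in
its frequency.\<close>

lemma phase1_sublevel: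
  fixes a b :: real
  assumes ab: "a \<noteq> b" "a \<noteq> 0" "b \<noteq> 0"
  obtains k C E where "0 < k" "k \<le> 1" "0 < C" "0 < E"
    "\<And>\<omega> c1 c2 d1 d2 h w A B. 0 < \<omega> \<Longrightarrow> \<omega> \<le> 1 \<Longrightarrow> 0 < l1 c1 c2 \<Longrightarrow> 0 < l1 d1 d2 \<Longrightarrow>
      0 < h \<Longrightarrow> h \<le> 1 \<Longrightarrow> A \<le> B \<Longrightarrow> {A..B} \<subseteq> {1..2} \<Longrightarrow> (\<And>u. u \<in> {A..B} \<Longrightarrow> w + h * u \<in> {1..2}) \<Longrightarrow>
      measure lborel {u \<in> {A..B}. \<bar>phase1 a b c1 c2 d1 d2 h w u\<bar>
          \<le> k ^ 4 * \<omega> ^ 67 * (h * l1 c1 c2 + l1 d1 d2)}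
      \<le> C * \<omega> + (4 / \<omega>) * measure lborel (resid_set a b c1 c2 w (\<omega> ^ 15 * l1 c1 c2))
        + indicator (power_set a b c1 c2 (E * \<omega> * l1 c1 c2)) w"
proof -
  obtain C0 where C0: "0 < C0" "\<And>c d \<epsilon>. 0 < l1 c d \<Longrightarrow> 0 < \<epsilon> \<Longrightarrow>
    measure lborel (power_set a b c d (\<epsilon> * l1 c d)) \<le> C0 * \<epsilon>"
    using two_powers_sublevel[OF ab(1)] by blast
  define G where "G = growth a b"
  have G: "0 < G" by (simp add: G_def growth_pos)
  define R where "R = 4 + 2 * \<bar>1 - a - b\<bar> + \<bar>a * b\<bar>"
  have R: "4 \<le> R" by (simp add: R_def)
  define k where "k = 1 / (2 * R)"
  have k: "0 < k" "k \<le> 1" "R * k = 1/2" using R by (auto simp: k_def)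
  define E where "E = (1 + (2 + \<bar>1 - a - b\<bar>) * G) / \<bar>a * b\<bar> + G"
  have E: "0 < E" unfolding E_def using G by (intro add_nonneg_pos divide_nonneg_nonneg add_nonneg_nonneg mult_nonneg_nonneg) auto
  define C where "C = 32 * G + C0 * (2 + G)"
  have C: "0 < C" using G C0 by (simp add: C_def add_pos_pos)
  show ?thesis
  proof (rule that[OF k(1,2) C E])
    fix \<omega> c1 c2 d1 d2 h w A B :: real
    assume om: "0 < \<omega>" "\<omega> \<le> 1" and n0: "0 < l1 c1 c2" and m0: "0 < l1 d1 d2"
      and h: "0 < h" "h \<le> 1" and AB: "A \<le> B" "{A..B} \<subseteq> {1..2}"
      and wu: "\<And>u. u \<in> {A..B} \<Longrightarrow> w + h * u \<in> {1..2}"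
    define n where "n = \<bar>c1\<bar> + \<bar>c2\<bar>"
    define m where "m = \<bar>d1\<bar> + \<bar>d2\<bar>"
    define N where "N = h * n + m"
    have nm: "0 < n" "0 < m" using n0 m0 by (auto simp: n_def m_def)
    have N: "0 < N" using h nm by (auto simp: N_def intro: add_pos_pos)
    define f where "f = phase1 a b c1 c2 d1 d2 h w"
    define T where "T = resid_set a b c1 c2 w (\<omega> ^ 15 * n)"
    define E2 where "E2 = power_set a b c1 c2 (E * \<omega> * n)"
    \<comment> \<open>Each threshold is \<open>\<omega>\<close> times the square of the next one, so that both quotients in
      \<open>sublevel_second_order\<close> equal \<open>\<omega>\<close>. The power 16 in the largest one exceeds by one the
      power 15 in the residual set: one factor \<open>\<omega>\<close> is lost when \<open>N\<close> is compared with \<open>h * n\<close>.\<close>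
    define \<rho>2 where "\<rho>2 = k * \<omega> ^ 16"
    define \<rho>1 where "\<rho>1 = k ^ 2 * \<omega> ^ 33"
    define \<rho>0 where "\<rho>0 = k ^ 4 * \<omega> ^ 67"
    have rho: "0 < \<rho>0" "0 < \<rho>1" "0 < \<rho>2" using k om by (auto simp: \<rho>0_def \<rho>1_def \<rho>2_def)
    have le: "k ^ i * \<omega> ^ j \<le> k ^ i' * \<omega> ^ j'" if "i' \<le> i" "j' \<le> j" for i j i' j'
      using that k om by (intro mult_mono power_decreasing) auto
    have rle: "\<rho>0 \<le> \<rho>2" "\<rho>1 \<le> \<rho>2" "\<rho>0 \<le> \<omega>"
      using le[of 1 4 16 67] le[of 1 2 16 33] le[of 0 4 1 67] by (auto simp: \<rho>0_def \<rho>1_def \<rho>2_def)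
    have q01: "\<rho>0 / \<rho>1\<^sup>2 = \<omega>"
    proof -
      have "\<rho>0 = \<omega> * \<rho>1\<^sup>2" unfolding \<rho>0_def \<rho>1_def by (simp add: power_mult_distrib power_mult[symmetric] power_Suc[symmetric] del: power_Suc)
      then show ?thesis using rho by simp
    qed
    have q12: "\<rho>1 / \<rho>2\<^sup>2 = \<omega>"
    proof -
      have "\<rho>1 = \<omega> * \<rho>2\<^sup>2" unfolding \<rho>1_def \<rho>2_def by (simp add: power_mult_distrib power_mult[symmetric] power_Suc[symmetric] del: power_Suc)
      then show ?thesis using rho by simp
    qed
    have AB12: "1 \<le> A" "B \<le> 2" using AB by auto
    have u12: "u \<in> {1/2..2}" "w + h * u \<in> {1/2..2}" "0 < u" "0 < w + h * u" if "u \<in> {A..B}" for u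
      using that AB12 wu[OF that] by auto
    have Tm: "T \<in> sets borel" unfolding T_def by measurable
    have fm: "{u \<in> {A..B}. \<bar>f u\<bar> \<le> \<rho>0 * N} \<in> sets borel" unfolding f_def by measurable
    have goal: "measure lborel {u \<in> {A..B}. \<bar>f u\<bar> \<le> \<rho>0 * N} \<le> C * \<omega> + (4 / \<omega>) * measure lborel T + indicator E2 w"
    proof (cases "h * n < \<omega> * m")
      case True
      \<comment> \<open>The \<open>d\<close>-part of the phase dominates.\<close>
      have "measure lborel {u \<in> {A..B}. \<bar>f u\<bar> \<le> \<rho>0 * N}
        \<le> measure lborel (power_set a b d1 d2 (((2 + G) * \<omega>) * l1 d1 d2))"
      proof (rule measure_mono_bounded)
        show "{u \<in> {A..B}. \<bar>f u\<bar> \<le> \<rho>0 * N} \<subseteq>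
          (power_set a b d1 d2 (((2 + G) * \<omega>) * l1 d1 d2))"
        proof
          fix u assume u: "u \<in> {u \<in> {A..B}. \<bar>f u\<bar> \<le> \<rho>0 * N}"
          then have uA: "u \<in> {A..B}" by simp
          have "\<omega> * m \<le> 1 * m" using om nm by (intro mult_right_mono) auto
          then have "N \<le> 2 * m" using True by (simp add: N_def)
          then have "\<rho>0 * N \<le> \<omega> * (2 * m)" using rle rho N om by (intro mult_mono) auto
          moreover have "h * \<bar>two_powers a b c1 c2 (w + h * u)\<bar> \<le> h * (G * n)"
            unfolding G_def n_def using h by (intro mult_left_mono two_powers_growth(1) u12 uA) auto
          moreover have "G * (h * n) \<le> G * (\<omega> * m)" using True G by (intro mult_left_mono) auto
          moreover have "h * (G * n) = G * (h * n)" by simp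
          moreover have "\<bar>two_powers a b d1 d2 u\<bar> \<le> \<bar>f u\<bar> + h * \<bar>two_powers a b c1 c2 (w + h * u)\<bar>"
          proof -
            have "two_powers a b d1 d2 u = h * two_powers a b c1 c2 (w + h * u) - f u"
              by (simp add: f_def phase1_def)
            then have "\<bar>two_powers a b d1 d2 u\<bar> \<le> \<bar>h * two_powers a b c1 c2 (w + h * u)\<bar> + \<bar>f u\<bar>"
              by (simp only: abs_triangle_ineq4)
            then show ?thesis using h by (simp add: abs_mult)
          qed
          moreover have "\<bar>f u\<bar> \<le> \<rho>0 * N" using u by simp
          ultimately have "\<bar>two_powers a b d1 d2 u\<bar> \<le> \<omega> * (2 * m) + G * (\<omega> * m)" by linarith
          also have "\<dots> = ((2 + G) * \<omega>) * l1 d1 d2" by (simp add: m_def algebra_simps)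
          finally show "u \<in> (power_set a b d1 d2 (((2 + G) * \<omega>) * l1 d1 d2))"
            using u12[OF uA] by simp
        qed
        show "(power_set a b d1 d2 (((2 + G) * \<omega>) * l1 d1 d2)) \<in> sets borel"
          by measurable
        show "(power_set a b d1 d2 (((2 + G) * \<omega>) * l1 d1 d2)) \<subseteq> {1/2..2}"
          by blast
      qed (use fm in simp)
      also have "\<dots> \<le> C0 * ((2 + G) * \<omega>)" using m0 G om by (intro C0(2)) auto
      also have "\<dots> \<le> C * \<omega>"
      proof -
        have "0 \<le> 32 * G * \<omega>" using G om by simp
        then show ?thesis by (simp add: C_def algebra_simps)
      qed
      also have "\<dots> \<le> C * \<omega> + ((4 / \<omega>) * measure lborel T + indicator E2 w)" using om by simp
      finally show ?thesis by simp
    next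
      case False
      define S where "S = {u \<in> {A..B}. \<bar>resid a b c1 c2 w (w + h * u)\<bar> \<le> \<omega> ^ 15 * n}"
      have Sm: "S \<in> sets borel" unfolding S_def by measurable
      have SAB: "S \<subseteq> {A..B}" by (auto simp: S_def)
      define f1 where "f1 = phase2 a b c1 c2 d1 d2 h w"
      define f2 where "f2 = phase3 a b c1 c2 d1 d2 h w"
      define f3 where "f3 = phase4 a b c1 c2 d1 d2 h w"
      have NN: "N = h * l1 c1 c2 + l1 d1 d2" by (simp add: N_def n_def m_def)
      have h0: "0 \<le> h" using h by simp
      have "measure lborel {u \<in> {A..B}. \<bar>f u\<bar> \<le> \<rho>0 * N}
        \<le> 16 * G * (\<rho>0 / \<rho>1\<^sup>2) + 16 * G * (\<rho>1 / \<rho>2\<^sup>2) + measure lborel S"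
      proof (rule sublevel_second_order[where ?f1.0 = f1 and ?f2.0 = f2 and ?f3.0 = f3])
        show "A \<le> B" by fact
        show "B - A \<le> 1" using AB12 by simp
        show "0 < N" by fact
        show "0 < \<rho>0" "0 < \<rho>1" "0 < \<rho>2" by fact+
        show "S \<in> sets borel" "S \<subseteq> {A..B}" by fact+
        show "continuous_on {A..B} f3" unfolding f3_def using u12 by (intro phase1_continuous) auto
        fix u assume u: "u \<in> {A..B}"
        show "(f has_real_derivative f1 u) (at u within {A..B})"
          unfolding f_def f1_def by (rule phase1_derivative[OF u12(3,4)[OF u]])
        show "(f1 has_real_derivative f2 u) (at u within {A..B})"
          unfolding f1_def f2_def by (rule phase1_derivative[OF u12(3,4)[OF u]])
        show "(f2 has_real_derivative f3 u) (at u within {A..B})"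
          unfolding f2_def f3_def by (rule phase1_derivative[OF u12(3,4)[OF u]])
        show "\<bar>f1 u\<bar> \<le> G * N" "\<bar>f2 u\<bar> \<le> G * N" "\<bar>f3 u\<bar> \<le> G * N"
          unfolding f1_def f2_def f3_def G_def by (rule phase1_bounds[OF u12(1,2)[OF u] h0 h(2) NN])+
        assume s: "\<bar>f u\<bar> \<le> \<rho>0 * N" "\<bar>f1 u\<bar> \<le> \<rho>1 * N" "\<bar>f2 u\<bar> \<le> \<rho>2 * N"
        have "\<rho>0 * N \<le> \<rho>2 * N" "\<rho>1 * N \<le> \<rho>2 * N" using rle N by (auto intro: mult_right_mono)
        with s have s': "\<bar>f u\<bar> \<le> \<rho>2 * N" "\<bar>f1 u\<bar> \<le> \<rho>2 * N" by linarith+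
        have u2: "u \<le> 2" "0 \<le> u" using u AB12 by auto
        have "h * \<bar>resid a b c1 c2 w (w + h * u)\<bar> = \<bar>u\<^sup>2 * f2 u + (1 - a - b) * (u * f1 u) + a * b * f u\<bar>"
          unfolding f_def f1_def f2_def phase1_annihilate[OF u12(3)[OF u]] using h by (simp add: abs_mult)
        also have "\<dots> \<le> \<bar>u\<^sup>2 * f2 u\<bar> + \<bar>(1 - a - b) * (u * f1 u)\<bar> + \<bar>a * b * f u\<bar>"
          by (intro order_trans[OF abs_triangle_ineq add_right_mono[OF abs_triangle_ineq]])
        also have "\<dots> \<le> 4 * (\<rho>2 * N) + \<bar>1 - a - b\<bar> * (2 * (\<rho>2 * N)) + \<bar>a * b\<bar> * (\<rho>2 * N)"
        proof (intro add_mono)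
          have "u * u \<le> 2 * 2" using u2 by (intro mult_mono) auto
          then show "\<bar>u\<^sup>2 * f2 u\<bar> \<le> 4 * (\<rho>2 * N)" unfolding abs_mult using s(3)
            by (intro mult_mono) (auto simp: power2_eq_square)
          have "\<bar>u\<bar> * \<bar>f1 u\<bar> \<le> 2 * (\<rho>2 * N)" using u2 s' by (intro mult_mono) auto
          then show "\<bar>(1 - a - b) * (u * f1 u)\<bar> \<le> \<bar>1 - a - b\<bar> * (2 * (\<rho>2 * N))"
            unfolding abs_mult by (intro mult_left_mono) auto
          show "\<bar>a * b * f u\<bar> \<le> \<bar>a * b\<bar> * (\<rho>2 * N)"
            unfolding abs_mult[of "a * b"] using s' by (intro mult_left_mono) auto
        qed
        also have "\<dots> = R * (\<rho>2 * N)" by (simp add: R_def algebra_simps)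
        also have "\<dots> = (R * k) * \<omega> ^ 15 * (\<omega> * N)" unfolding \<rho>2_def using power_add[of \<omega> 15 1] by simp
        also have "\<dots> = \<omega> ^ 15 * (\<omega> * N / 2)" by (simp add: k)
        also have "\<dots> \<le> \<omega> ^ 15 * (h * n)"
        proof (intro mult_left_mono)
          have "\<omega> * (h * n) \<le> 1 * (h * n)" using om h nm by (intro mult_right_mono) auto
          moreover have "\<omega> * N = \<omega> * (h * n) + \<omega> * m" by (simp add: N_def algebra_simps)
          ultimately show "\<omega> * N / 2 \<le> h * n" using False by linarith
        qed (use om in auto)
        finally have "h * \<bar>resid a b c1 c2 w (w + h * u)\<bar> \<le> h * (\<omega> ^ 15 * n)" by (simp add: mult_ac)
        then have "\<bar>resid a b c1 c2 w (w + h * u)\<bar> \<le> \<omega> ^ 15 * n"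
          by (rule mult_left_le_imp_le[OF _ h(1)])
        then show "u \<in> S" using u by (simp add: S_def)
      qed
      also have "\<dots> = 32 * G * \<omega> + measure lborel S" by (simp add: q01 q12)
      also have "\<dots> \<le> C * \<omega> + (4 / \<omega> * measure lborel T + indicator E2 w)"
      proof (rule add_mono)
        have "0 \<le> C0 * (2 + G) * \<omega>" using C0 G om by simp
        then show "32 * G * \<omega> \<le> C * \<omega>" by (simp add: C_def algebra_simps)
        show "measure lborel S \<le> 4 / \<omega> * measure lborel T + indicator E2 w"
        proof (cases "\<omega> / 4 \<le> h")
          \<comment> \<open>The map from \<open>u\<close> to \<open>t = w + h * u\<close> contracts by the factor \<open>h\<close>, which costs \<open>4 / \<omega>\<close>.\<close>
          case True
          have "measure lborel S \<le> measure lborel T / h"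
          proof (rule measure_affine_preimage_le[OF h(1) Tm _ Sm SAB])
            show "T \<subseteq> {1..2}" by (auto simp: T_def)
            show "w + h * u \<in> T" if "u \<in> S" for u using that wu by (auto simp: S_def T_def)
          qed
          also have "\<dots> \<le> measure lborel T / (\<omega> / 4)"
            using True om by (intro divide_left_mono) auto
          also have "\<dots> = 4 / \<omega> * measure lborel T" by simp
          also have "\<dots> \<le> 4 / \<omega> * measure lborel T + indicator E2 w" by simp
          finally show ?thesis .
        next
          case hs: False
          show ?thesis
          proof (cases "S = {}")
            case True
            then show ?thesis using om by simp
          next
            case False
            \<comment> \<open>One point of \<open>S\<close> forces \<open>w\<close> into \<open>E2\<close>; the measure of \<open>S\<close> is then bounded by 1.\<close>
            then obtain u where uS: "u \<in> S" by auto
            then have u: "u \<in> {A..B}" by (simp add: S_def)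
            let ?t = "w + h * u"
            have hu: "h * u \<le> \<omega>" "0 \<le> h * u"
            proof -
              have "h * u \<le> (\<omega> / 4) * 2" using hs u AB12 om h by (intro mult_mono) auto
              then show "h * u \<le> \<omega>" using om by simp
              show "0 \<le> h * u" using h u AB12 by simp
            qed
            have hu2: "h * u \<le> 1/2"
            proof -
              have "h * u \<le> (\<omega> / 4) * 2" using hs u AB12 om h by (intro mult_mono) auto
              then show "h * u \<le> 1/2" using om by simp
            qed
            have "\<bar>two_powers a b c1 c2 w\<bar> \<le>
              ((1 + (2 + \<bar>1 - a - b\<bar>) * growth a b) / \<bar>a * b\<bar> + growth a b) * \<omega> * l1 c1 c2"
            proof (rule resid_near_diagonal[OF wu[OF u] _ _ ab(2,3)])
              show "w \<in> {1/2..w + h * u}" using wu[OF u] hu hu2 by auto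
              show "w + h * u - w \<le> \<omega>" using hu by simp
              have "\<omega> ^ 15 \<le> \<omega> ^ 1" using om by (intro power_decreasing) auto
              then have "\<omega> ^ 15 * n \<le> \<omega> * n" using nm by (intro mult_right_mono) auto
              then show "\<bar>resid a b c1 c2 w (w + h * u)\<bar> \<le> \<omega> * l1 c1 c2"
                using uS by (simp add: S_def n_def)
            qed
            then have "w \<in> E2" using wu[OF u] hu hu2 by (simp add: E2_def E_def G_def n_def)
            moreover have "measure lborel S \<le> 2 - 1"
              using SAB AB by (intro measure_le_length[OF Sm]) auto
            ultimately show ?thesis using om by (simp add: add_increasing)
          qed
        qed
      qed
      finally show ?thesis by simp
    qed
    then show "measure lborel {u \<in> {A..B}. \<bar>phase1 a b c1 c2 d1 d2 h w u\<bar>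
          \<le> k ^ 4 * \<omega> ^ 67 * (h * l1 c1 c2 + l1 d1 d2)}
      \<le> C * \<omega> + (4 / \<omega>) * measure lborel (resid_set a b c1 c2 w (\<omega> ^ 15 * l1 c1 c2))
        + indicator (power_set a b c1 c2 (E * \<omega> * l1 c1 c2)) w"
      by (simp only: f_def T_def E2_def n_def m_def N_def \<rho>0_def)
  qed
qed

section \<open>A majorant for the correlation integral\<close>

text \<open>The amplitude vanishes at both ends of the interval of integration, which is where \<open>u\<close> or \<open>w + h u\<close>
leaves \<open>[1, 2]\<close>; so no boundary terms arise. The hypothesis on \<open>\<omega> ^ 137\<close> says that the size \<open>N\<close> of the
phase is at least about \<open>\<omega> powr (-137)\<close>.\<close>

lemma kernel_pointwise_bound:
  fixes \<alpha> \<beta> \<kappa> :: real and \<eta> \<eta>' :: "real \<Rightarrow> complex"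
  assumes ab: "0 < \<alpha>" "0 < \<beta>" "\<alpha> \<noteq> \<beta>" "\<alpha> \<noteq> 1" "\<beta> \<noteq> 1"
    and \<eta>: "\<And>t. 0 < t \<Longrightarrow> (\<eta> has_vector_derivative \<eta>' t) (at t)"
      "continuous_on {0<..} \<eta>'" "\<eta> 1 = 0" "\<eta> 2 = 0"
    and kap: "0 < \<kappa>"
  obtains C E where "0 < C" "0 < E"
    "\<And>\<omega> n1 n2 m1 m2 h w A B. 0 < \<omega> \<Longrightarrow> \<omega> \<le> 1 \<Longrightarrow> 0 < l1 (n1 * \<alpha>) (n2 * \<beta>) \<Longrightarrow>
      \<kappa> \<le> \<omega> ^ 137 * l1 (m1 * \<alpha>) (m2 * \<beta>) \<Longrightarrow>
      0 < h \<Longrightarrow> h \<le> 1 \<Longrightarrow> A = max 1 ((1 - w) / h) \<Longrightarrow> B = min 2 ((2 - w) / h) \<Longrightarrow> A \<le> B \<Longrightarrow>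
      norm (integral {A..B} (\<lambda>u. exp (\<i> * of_real (two_powers \<alpha> \<beta> n1 n2 (w + h * u) - two_powers \<alpha> \<beta> m1 m2 u))
         * (\<eta> (w + h * u) * cnj (\<eta> u))))
      \<le> C * (\<omega> + (4 / \<omega>) * measure lborel (resid_set (\<alpha> - 1) (\<beta> - 1) (n1 * \<alpha>) (n2 * \<beta>) w (\<omega> ^ 15 * l1 (n1 * \<alpha>) (n2 * \<beta>)))
        + indicator (power_set (\<alpha> - 1) (\<beta> - 1) (n1 * \<alpha>) (n2 * \<beta>) (E * \<omega> * l1 (n1 * \<alpha>) (n2 * \<beta>))) w)"
proof -
  define a where "a = \<alpha> - 1"
  define b where "b = \<beta> - 1"
  have abn: "a \<noteq> b" "a \<noteq> 0" "b \<noteq> 0" using ab by (auto simp: a_def b_def)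
  obtain k C0 E where kCE: "0 < k" "k \<le> 1" "0 < C0" "0 < E" and sub:
    "\<And>\<omega> c1 c2 d1 d2 h w A B. 0 < \<omega> \<Longrightarrow> \<omega> \<le> 1 \<Longrightarrow> 0 < l1 c1 c2 \<Longrightarrow> 0 < l1 d1 d2 \<Longrightarrow>
      0 < h \<Longrightarrow> h \<le> 1 \<Longrightarrow> A \<le> B \<Longrightarrow> {A..B} \<subseteq> {1..2} \<Longrightarrow> (\<And>u. u \<in> {A..B} \<Longrightarrow> w + h * u \<in> {1..2}) \<Longrightarrow>
      measure lborel {u \<in> {A..B}. \<bar>phase1 a b c1 c2 d1 d2 h w u\<bar>
          \<le> k ^ 4 * \<omega> ^ 67 * (h * l1 c1 c2 + l1 d1 d2)}
      \<le> C0 * \<omega> + (4 / \<omega>) * measure lborel (resid_set a b c1 c2 w (\<omega> ^ 15 * l1 c1 c2))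
        + indicator (power_set a b c1 c2 (E * \<omega> * l1 c1 c2)) w"
    by (rule phase1_sublevel[OF abn]) blast
  have c\<eta>: "continuous_on {0<..} \<eta>"
    by (rule continuous_on_vector_derivative, rule has_vector_derivative_at_within, rule \<eta>(1)) simp
  obtain Z where Z: "0 < Z" "\<And>t. t \<in> {1..2} \<Longrightarrow> norm (\<eta> t) \<le> Z" "\<And>t. t \<in> {1..2} \<Longrightarrow> norm (\<eta>' t) \<le> Z"
  proof -
    have "continuous_on {1..2} \<eta>" "continuous_on {1..2} \<eta>'"
      by (rule continuous_on_subset[OF c\<eta>] continuous_on_subset[OF \<eta>(2)]; force)+
    then have "bounded (\<eta> ` {1..2})" "bounded (\<eta>' ` {1..2})"
      by (auto intro!: compact_imp_bounded compact_continuous_image)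
    then obtain Z1 Z2 where "\<forall>x\<in>{1..2}. norm (\<eta> x) \<le> Z1" "\<forall>x\<in>{1..2}. norm (\<eta>' x) \<le> Z2"
      unfolding bounded_iff by (auto; blast)
    then show ?thesis by (intro that[of "\<bar>Z1\<bar> + \<bar>Z2\<bar> + 1"]) force+
  qed
  define G where "G = growth a b"
  have G: "0 < G" by (simp add: G_def growth_pos)
  define K where "K = 1 / (k ^ 4 * \<kappa>) + G / (k ^ 8 * \<kappa>) + 1"
  have K: "0 < K" unfolding K_def using kCE kap G by (intro add_pos_pos) auto
  define C where "C = 2 * Z\<^sup>2 * (K + C0 + 1)"
  have C: "0 < C" unfolding C_def using Z(1) K kCE by (intro mult_pos_pos add_pos_pos) auto
  show ?thesis
  proof (rule that[OF C kCE(4)])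
    fix \<omega> n1 n2 m1 m2 h w A B :: real
    assume om: "0 < \<omega>" "\<omega> \<le> 1" and n0: "0 < l1 (n1 * \<alpha>) (n2 * \<beta>)" and
      mk: "\<kappa> \<le> \<omega> ^ 137 * l1 (m1 * \<alpha>) (m2 * \<beta>)" and
      h: "0 < h" "h \<le> 1" and A: "A = max 1 ((1 - w) / h)" and B: "B = min 2 ((2 - w) / h)" and AB: "A \<le> B"
    define c1 c2 d1 d2 where "c1 = n1 * \<alpha>" and "c2 = n2 * \<beta>" and "d1 = m1 * \<alpha>" and "d2 = m2 * \<beta>"
    note cd = this
    define N where "N = h * l1 c1 c2 + l1 d1 d2"
    have m0: "0 < l1 d1 d2"
    proof (rule ccontr)
      assume "\<not> 0 < l1 d1 d2"
      then have z: "\<bar>m1 * \<alpha>\<bar> + \<bar>m2 * \<beta>\<bar> = 0" unfolding cd by linarith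
      show False using mk kap unfolding z by simp
    qed
    have N: "0 < N" unfolding N_def by (rule add_nonneg_pos[OF _ m0]) (use h in simp)
    have Nk: "\<kappa> \<le> \<omega> ^ 137 * N"
    proof -
      have "\<bar>d1\<bar> + \<bar>d2\<bar> \<le> N" using h by (simp add: N_def)
      then have "\<omega> ^ 137 * l1 d1 d2 \<le> \<omega> ^ 137 * N" using om by (intro mult_left_mono) auto
      then show ?thesis using mk by (simp add: cd)
    qed
    have sAB: "{A..B} \<subseteq> {1..2}" by (auto simp: A B)
    have wu: "w + h * u \<in> {1..2}" if "u \<in> {A..B}" for u
    proof -
      have "(1 - w) / h \<le> u" "u \<le> (2 - w) / h" using that by (auto simp: A B)
      then show ?thesis using h by (simp add: field_simps)
    qed
    have u12: "u \<in> {1..2}" "0 < u" "0 < w + h * u" "u \<in> {1/2..2}" "w + h * u \<in> {1/2..2}" if "u \<in> {A..B}" for u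
      using subsetD[OF sAB that] wu[OF that] by auto
    define q where "q = phase1 a b c1 c2 d1 d2 h w"
    define q' where "q' = phase2 a b c1 c2 d1 d2 h w"
    \<comment> \<open>\<open>L\<close> is the threshold of the sublevel estimate. One more factor \<open>\<omega>\<close> in \<open>M\<close> makes
      \<open>M\<^sup>2 / L\<^sup>2\<close> equal to \<open>\<omega>\<^sup>2\<close>, while \<open>N / M\<^sup>2\<close> is of size \<open>1 / (\<omega> ^ 136 * N)\<close>, hence \<open>O (\<omega>)\<close>.\<close>
    define M where "M = k ^ 4 * \<omega> ^ 68 * N"
    define L where "L = k ^ 4 * \<omega> ^ 67 * N"
    have posML: "0 < M" "0 < L" using kCE om N by (auto simp: M_def L_def)
    let ?z = "\<lambda>u. \<eta> (w + h * u) * cnj (\<eta> u)"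
    let ?zd = "\<lambda>u. \<eta> (w + h * u) * cnj (\<eta>' u) + (of_real h * \<eta>' (w + h * u)) * cnj (\<eta> u)"
    let ?T = "resid_set a b c1 c2 w (\<omega> ^ 15 * l1 c1 c2)"
    let ?I = "indicator (power_set a b c1 c2 (E * \<omega> * l1 c1 c2)) w :: real"
    have "norm (integral {A..B} (\<lambda>u. exp (\<i> * of_real (two_powers \<alpha> \<beta> n1 n2 (w + h * u) - two_powers \<alpha> \<beta> m1 m2 u)) * ?z u))
      \<le> 2 * Z\<^sup>2 * ((B - A) * (1 / M + G * N / M\<^sup>2 + M\<^sup>2 / L\<^sup>2) + measure lborel {u \<in> {A..B}. \<bar>q u\<bar> \<le> L})"
    proof (rule oscillatory_integral_bound[where q' = q' and \<zeta>' = ?zd])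
      show "A \<le> B" "0 < M" "0 < L" by fact+
      have hw: "continuous_on {A..B} (\<lambda>u. w + h * u)" by (intro continuous_intros)
      have i1: "(\<lambda>u. w + h * u) ` {A..B} \<subseteq> {0<..}" and i2: "{A..B} \<subseteq> {0<..}" using u12 by force+
      show "continuous_on {A..B} ?zd"
        by (intro continuous_intros continuous_on_compose2[OF c\<eta> hw i1] continuous_on_compose2[OF \<eta>(2) hw i1]
            continuous_on_subset[OF c\<eta> i2] continuous_on_subset[OF \<eta>(2) i2])
      show "continuous_on {A..B} q'" unfolding q'_def using u12 by (intro phase1_continuous) auto
      show "?z A = 0"
      proof (cases "A = 1")
        case False
        then have "w + h * A = 1" using h by (simp add: A max_def split: if_splits)
        then show ?thesis using \<eta> by simp
      qed (use \<eta> in simp)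
      show "?z B = 0"
      proof (cases "B = 2")
        case False
        then have "w + h * B = 2" using h by (simp add: B min_def split: if_splits)
        then show ?thesis using \<eta> by simp
      qed (use \<eta> in simp)
      fix u assume u: "u \<in> {A..B}"
      show "((\<lambda>u. two_powers \<alpha> \<beta> n1 n2 (w + h * u) - two_powers \<alpha> \<beta> m1 m2 u) has_real_derivative q u) (at u within {A..B})"
      proof -
        have "((\<lambda>u. w + h * u) has_real_derivative h) (at u within {A..B})"
          by (auto intro!: derivative_eq_intros)
        from two_powers_derivative[OF this u12(3)[OF u]] two_powers_derivative[OF DERIV_ident u12(2)[OF u]]
        have "((\<lambda>u. two_powers \<alpha> \<beta> n1 n2 (w + h * u) - two_powers \<alpha> \<beta> m1 m2 u) has_real_derivative
          (two_powers (\<alpha> - 1) (\<beta> - 1) (n1 * \<alpha>) (n2 * \<beta>) (w + h * u) * h)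
          - two_powers (\<alpha> - 1) (\<beta> - 1) (m1 * \<alpha>) (m2 * \<beta>) u * 1) (at u within {A..B})"
          by (intro DERIV_diff)
        then show ?thesis
          by (rule DERIV_cong) (simp add: q_def phase1_def a_def b_def cd)
      qed
      show "(q has_real_derivative q' u) (at u within {A..B})"
        unfolding q_def q'_def by (rule phase1_derivative[OF u12(2,3)[OF u]])
      show "(?z has_vector_derivative ?zd u) (at u within {A..B})"
      proof -
        have "((\<lambda>u. w + h * u) has_vector_derivative h) (at u)"
          by (auto intro!: derivative_eq_intros simp: has_real_derivative_iff_has_vector_derivative[symmetric])
        from has_vector_derivative_at_within[OF vector_diff_chain_at[OF this \<eta>(1)[OF u12(3)[OF u]]], of "{A..B}"]
        have "((\<lambda>u. \<eta> (w + h * u)) has_vector_derivative of_real h * \<eta>' (w + h * u)) (at u within {A..B})"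
          by (simp add: o_def scaleR_conv_of_real)
        moreover have "((\<lambda>u. cnj (\<eta> u)) has_vector_derivative cnj (\<eta>' u)) (at u within {A..B})"
          by (rule has_vector_derivative_cnj[OF has_vector_derivative_at_within[OF \<eta>(1)[OF u12(2)[OF u]]]])
        ultimately show ?thesis by (rule has_vector_derivative_mult)
      qed
      show "\<bar>q' u\<bar> \<le> G * N" unfolding q'_def G_def
        by (rule phase1_bounds(1)[OF u12(4,5)[OF u] less_imp_le[OF h(1)] h(2) N_def])
      have "norm (?z u) \<le> Z * Z" unfolding norm_mult complex_mod_cnj using Z u12[OF u] wu[OF u]
        by (intro mult_mono) auto
      then show "norm (?z u) \<le> 2 * Z\<^sup>2" unfolding power2_eq_square using mult_pos_pos[OF Z(1) Z(1)] by linarith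
      have "norm (?zd u) \<le> norm (\<eta> (w + h * u) * cnj (\<eta>' u)) + norm ((of_real h * \<eta>' (w + h * u)) * cnj (\<eta> u))"
        by (rule norm_triangle_ineq)
      also have "\<dots> \<le> Z * Z + (1 * Z) * Z" unfolding norm_mult complex_mod_cnj
        using Z u12[OF u] wu[OF u] h by (intro add_mono mult_mono) auto
      finally show "norm (?zd u) \<le> 2 * Z\<^sup>2" by (simp add: power2_eq_square)
    qed
    also have "\<dots> \<le> 2 * Z\<^sup>2 * ((K + C0 + 1) * (\<omega> + (4 / \<omega>) * measure lborel ?T + ?I))"
    proof (intro mult_left_mono)
      have inv: "1 / N \<le> \<omega> ^ 137 / \<kappa>" using Nk N kap by (simp add: field_simps)
      have o1: "\<omega> ^ j \<le> \<omega>" if "1 \<le> j" for j using power_decreasing[OF that, of \<omega>] om by simp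
      have pw1: "\<omega> ^ 137 = \<omega> ^ 69 * \<omega> ^ 68" by (simp add: power_add[symmetric])
      have pw2: "\<omega> ^ 137 = \<omega> * \<omega> ^ 136" by (rule power_Suc[of _ 136, simplified])
      have e1: "1 / M \<le> \<omega> / (k ^ 4 * \<kappa>)"
      proof -
        have "1 / M = (1 / N) / (k ^ 4 * \<omega> ^ 68)" by (simp add: M_def)
        also have "\<dots> \<le> (\<omega> ^ 137 / \<kappa>) / (k ^ 4 * \<omega> ^ 68)" using inv kCE om by (intro divide_right_mono) auto
        also have "\<dots> = \<omega> ^ 69 / (k ^ 4 * \<kappa>)" using om kap kCE unfolding pw1
          by (simp add: divide_simps del: power_add_numeral power_add_numeral2)
        also have "\<dots> \<le> \<omega> / (k ^ 4 * \<kappa>)" using o1[of 69] kCE kap by (intro divide_right_mono) auto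
        finally show ?thesis .
      qed
      have e2: "G * N / M\<^sup>2 \<le> \<omega> * (G / (k ^ 8 * \<kappa>))"
      proof -
        have "G * N / M\<^sup>2 = (1 / N) * (G / (k ^ 8 * \<omega> ^ 136))" using N
          by (simp add: M_def power2_eq_square power_add[symmetric] field_simps)
        also have "\<dots> \<le> (\<omega> ^ 137 / \<kappa>) * (G / (k ^ 8 * \<omega> ^ 136))"
          using inv kCE om G by (intro mult_right_mono) auto
        also have "\<dots> = \<omega> * (G / (k ^ 8 * \<kappa>))" using om kap kCE unfolding pw2
          by (simp add: divide_simps del: power_add_numeral power_add_numeral2)
        finally show ?thesis .
      qed
      have e3: "M\<^sup>2 / L\<^sup>2 \<le> \<omega>"
      proof -
        have "M = \<omega> * L" using power_Suc[of \<omega> 67] by (simp add: M_def L_def del: power_Suc)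
        then have "M\<^sup>2 / L\<^sup>2 = \<omega> ^ 2" using posML by (simp add: power_mult_distrib)
        then show ?thesis using o1[of 2] by simp
      qed
      have sum0: "0 \<le> 1 / M + G * N / M\<^sup>2 + M\<^sup>2 / L\<^sup>2" using posML G N by simp
      have "B - A \<le> 1" using sAB AB by auto
      then have "(B - A) * (1 / M + G * N / M\<^sup>2 + M\<^sup>2 / L\<^sup>2) \<le> 1 * (1 / M + G * N / M\<^sup>2 + M\<^sup>2 / L\<^sup>2)"
        by (rule mult_right_mono[OF _ sum0])
      also have "\<dots> \<le> K * \<omega>" using e1 e2 e3 by (simp add: K_def algebra_simps)
      finally have p1: "(B - A) * (1 / M + G * N / M\<^sup>2 + M\<^sup>2 / L\<^sup>2) \<le> K * \<omega>" .
      have p2: "measure lborel {u \<in> {A..B}. \<bar>q u\<bar> \<le> L} \<le> C0 * \<omega> + (4 / \<omega>) * measure lborel ?T + ?I"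
        unfolding q_def L_def N_def
        by (rule sub[OF om n0[folded cd] m0 h AB sAB wu])
      define Y where "Y = (4 / \<omega>) * measure lborel ?T + ?I"
      have Y: "0 \<le> Y" using om by (simp add: Y_def)
      have "(B - A) * (1 / M + G * N / M\<^sup>2 + M\<^sup>2 / L\<^sup>2) + measure lborel {u \<in> {A..B}. \<bar>q u\<bar> \<le> L}
        \<le> K * \<omega> + (C0 * \<omega> + Y)" using p1 p2 by (simp add: Y_def)
      also have "\<dots> \<le> K * \<omega> + (C0 * \<omega> + Y) + (\<omega> + (K + C0) * Y)"
        using om Y K kCE by simp
      also have "\<dots> = (K + C0 + 1) * (\<omega> + Y)" by (simp add: algebra_simps)
      finally show "(B - A) * (1 / M + G * N / M\<^sup>2 + M\<^sup>2 / L\<^sup>2) + measure lborel {u \<in> {A..B}. \<bar>q u\<bar> \<le> L}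
        \<le> (K + C0 + 1) * (\<omega> + (4 / \<omega>) * measure lborel ?T + ?I)" by (simp only: Y_def add.assoc)
    qed simp
    finally show "norm (integral {A..B} (\<lambda>u. exp (\<i> * of_real (two_powers \<alpha> \<beta> n1 n2 (w + h * u) - two_powers \<alpha> \<beta> m1 m2 u))
         * (\<eta> (w + h * u) * cnj (\<eta> u))))
      \<le> C * (\<omega> + (4 / \<omega>) * measure lborel (resid_set (\<alpha> - 1) (\<beta> - 1) (n1 * \<alpha>) (n2 * \<beta>) w (\<omega> ^ 15 * l1 (n1 * \<alpha>) (n2 * \<beta>)))
        + indicator (power_set (\<alpha> - 1) (\<beta> - 1) (n1 * \<alpha>) (n2 * \<beta>) (E * \<omega> * l1 (n1 * \<alpha>) (n2 * \<beta>))) w)"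
      by (simp only: C_def a_def b_def cd mult.assoc)
  qed
qed

(*PART s9/T9*)
text \<open>The set where \<open>\<psi>\<close> is nonzero is open, so it lies in the interior of \<open>[1, 2]\<close>; in particular \<open>\<psi>\<close>
vanishes at the end points.\<close>

lemma smooth_amplitude:
  assumes "smooth \<psi>" "closure {t. \<psi> t \<noteq> 0} \<subseteq> {1..2}"
  obtains \<eta>' where "\<And>t. 0 < t \<Longrightarrow> ((\<lambda>t. \<psi> t / of_real t) has_vector_derivative \<eta>' t) (at t)"
    "continuous_on {0<..} \<eta>'" "\<And>t. t \<notin> {1<..<2} \<Longrightarrow> \<psi> t = 0" "continuous_on UNIV \<psi>"
proof -
  define \<psi>' where "\<psi>' = (\<lambda>s. vector_derivative \<psi> (at s))"
  have d0: "\<psi> differentiable (at t)" for t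
    using assms(1)[unfolded smooth_def, rule_format, of 0] by simp
  have d1: "\<psi>' differentiable (at t)" for t
    using assms(1)[unfolded smooth_def, rule_format, of 1] by (simp add: \<psi>'_def)
  have D: "(\<psi> has_vector_derivative \<psi>' t) (at t)" for t
    using d0 by (simp add: \<psi>'_def vector_derivative_works[symmetric])
  have c0: "continuous_on S \<psi>" for S
    using differentiable_imp_continuous_within[OF d0] by (intro continuous_at_imp_continuous_on ballI)
  have c1: "continuous_on S \<psi>'" for S
    using differentiable_imp_continuous_within[OF d1] by (intro continuous_at_imp_continuous_on ballI)
  have "open (\<psi> -` (- {0}))" by (rule open_vimage[OF _ c0]) auto
  moreover have "\<psi> -` (- {0}) = {t. \<psi> t \<noteq> 0}" by auto
  ultimately have "open {t. \<psi> t \<noteq> 0}" by simp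
  then have "{t. \<psi> t \<noteq> 0} \<subseteq> interior {1..2}"
    by (rule interior_maximal[OF order_trans[OF closure_subset assms(2)]])
  then have z: "\<psi> t = 0" if "t \<notin> {1<..<2}" for t using that by (auto simp: interior_atLeastAtMost_real)
  define \<eta>' where "\<eta>' = (\<lambda>t. \<psi> t * of_real (- (1 / t\<^sup>2)) + \<psi>' t * of_real (1 / t))"
  show ?thesis
  proof
    show "continuous_on {0<..} \<eta>'" unfolding \<eta>'_def
      by (intro continuous_intros c0 c1) auto
    fix t :: real assume t: "0 < t"
    have "((\<lambda>t. 1 / t) has_real_derivative - (1 / t\<^sup>2)) (at t)"
      using t by (auto intro!: derivative_eq_intros simp: power2_eq_square)
    then have "((\<lambda>t. complex_of_real (1 / t)) has_vector_derivative of_real (- (1 / t\<^sup>2))) (at t)"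
      by (intro has_vector_derivative_of_real) (simp add: has_real_derivative_iff_has_vector_derivative)
    from has_vector_derivative_mult[OF D this]
    show "((\<lambda>t. \<psi> t / of_real t) has_vector_derivative \<eta>' t) (at t)"
      by (simp add: \<eta>'_def divide_inverse)
  qed (use z c0 in auto)
qed

lemma emeasure_resid_section_measurable:
  "(\<lambda>w. emeasure lborel (resid_set a b c d w e)) \<in> borel_measurable borel"
proof -
  have m: "(\<lambda>(w, t). if 1 \<le> t \<and> t \<le> 2 \<and> \<bar>resid a b c d w t\<bar> \<le> e then 1 else 0 :: ennreal)
    \<in> borel_measurable (borel \<Otimes>\<^sub>M lborel)"
    unfolding case_prod_beta by measurable
  have "(\<lambda>w. \<integral>\<^sup>+t. (if 1 \<le> t \<and> t \<le> 2 \<and> \<bar>resid a b c d w t\<bar> \<le> e then 1 else 0) \<partial>lborel) \<in> borel_measurable borel"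
    by (rule lborel.borel_measurable_nn_integral[OF m])
  moreover have "(\<integral>\<^sup>+t. (if 1 \<le> t \<and> t \<le> 2 \<and> \<bar>resid a b c d w t\<bar> \<le> e then 1 else 0) \<partial>lborel)
    = emeasure lborel (resid_set a b c d w e)" for w
  proof -
    have "(\<integral>\<^sup>+t. (if 1 \<le> t \<and> t \<le> 2 \<and> \<bar>resid a b c d w t\<bar> \<le> e then 1 else 0) \<partial>lborel)
      = (\<integral>\<^sup>+t. indicator (resid_set a b c d w e) t \<partial>lborel)"
      by (intro nn_integral_cong) (auto simp: indicator_def)
    also have "\<dots> = emeasure lborel (resid_set a b c d w e)"
      by (intro nn_integral_indicator) measurable
    finally show ?thesis .
  qed
  ultimately show ?thesis by simp
qed

lemma power4_sum3_le:
  fixes x y z :: real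
  assumes "0 \<le> x" "0 \<le> y" "0 \<le> z"
  shows "(x + y + z) ^ 4 \<le> 81 * (x ^ 4 + y ^ 4 + z ^ 4)"
proof -
  define m where "m = max x (max y z)"
  have "(x + y + z) ^ 4 \<le> (3 * m) ^ 4" using assms by (intro power_mono) (auto simp: m_def)
  also have "\<dots> = 81 * m ^ 4" by (simp add: power_mult_distrib)
  also have "m ^ 4 \<le> x ^ 4 + y ^ 4 + z ^ 4"
    using assms by (auto simp: m_def max_def)
  finally show ?thesis by simp
qed

abbreviation (input) corr :: "real \<Rightarrow> real \<Rightarrow> (real \<Rightarrow> complex) \<Rightarrow> real \<times> real \<Rightarrow> real \<times> real \<Rightarrow> real \<Rightarrow> real \<Rightarrow> complex" where
  "corr \<alpha> \<beta> \<psi> n m h w \<equiv> LINT u|lborel. Phi \<alpha> \<beta> \<psi> n (w + h * u) * cnj (Phi \<alpha> \<beta> \<psi> m u)"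

text \<open>The bounds \<open>A\<close> and \<open>B\<close> are the conditions that \<open>u\<close> and \<open>w + h u\<close> both lie in \<open>[1, 2]\<close>.\<close>

lemma Phi_product_integral:
  fixes w h :: real
  assumes h: "0 < h" and z: "\<And>t. t \<notin> {1<..<2} \<Longrightarrow> \<psi> t = 0" and c: "continuous_on UNIV \<psi>"
    and A: "A = max 1 ((1 - w) / h)" and B: "B = min 2 ((2 - w) / h)"
  shows "corr \<alpha> \<beta> \<psi> n m h w =
    integral {A..B} (\<lambda>u. exp (\<i> * of_real (two_powers \<alpha> \<beta> (fst n) (snd n) (w + h * u) - two_powers \<alpha> \<beta> (fst m) (snd m) u))
         * (\<psi> (w + h * u) / of_real (w + h * u) * cnj (\<psi> u / of_real u)))"
    (is "_ = integral _ ?f")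
proof -
  have pos: "0 < u" "0 < w + h * u" if "u \<in> {A..B}" for u
  proof -
    have "(1 - w) / h \<le> u" "1 \<le> u" using that by (auto simp: A)
    then show "0 < u" "0 < w + h * u" using h by (auto simp: field_simps)
  qed
  have eq: "Phi \<alpha> \<beta> \<psi> n (w + h * u) * cnj (Phi \<alpha> \<beta> \<psi> m u) = indicator {A..B} u *\<^sub>R ?f u" for u
  proof (cases "u \<in> {A..B}")
    case True
    have "exp (\<i> * of_real x) * cnj (exp (\<i> * of_real y)) = exp (\<i> * of_real (x - y))" for x y
      by (simp add: exp_cnj exp_add[symmetric] algebra_simps)
    then have "exp (\<i> * of_real (two_powers \<alpha> \<beta> (fst n) (snd n) (w + h * u) - two_powers \<alpha> \<beta> (fst m) (snd m) u))
      = exp (\<i> * of_real (two_powers \<alpha> \<beta> (fst n) (snd n) (w + h * u))) * cnj (exp (\<i> * of_real (two_powers \<alpha> \<beta> (fst m) (snd m) u)))"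
      by simp
    then show ?thesis using True pos[OF True] by (simp add: Phi_def two_powers_def mult_ac)
  next
    case False
    have "u \<notin> {1<..<2} \<or> w + h * u \<notin> {1<..<2}"
    proof (rule ccontr)
      assume "\<not> ?thesis"
      then have "u \<in> {A..B}" using h by (auto simp: A B field_simps)
      then show False using False by simp
    qed
    then show ?thesis using False z by (auto simp: Phi_def)
  qed
  have "continuous_on {A..B} ?f"
  proof -
    have "continuous_on {A..B} (\<lambda>u. \<psi> (w + h * u))"
      by (rule continuous_on_compose2[OF c]) (auto intro!: continuous_intros)
    moreover have "continuous_on {A..B} \<psi>" using c by (rule continuous_on_subset) auto
    moreover have "complex_of_real (w + h * u) \<noteq> 0" "complex_of_real u \<noteq> 0" if "u \<in> {A..B}" for u
      using pos[OF that] by (simp_all only: of_real_eq_0_iff less_imp_neq[symmetric] not_False_eq_True)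
    ultimately show ?thesis using pos by (intro continuous_intros) auto
  qed
  then have "set_integrable lborel {A..B} ?f"
    unfolding set_integrable_def by (intro borel_integrable_compact) auto
  from set_borel_integral_eq_integral(2)[OF this]
  have "(LINT u|lborel. indicator {A..B} u *\<^sub>R ?f u) = integral {A..B} ?f"
    by (simp add: set_lebesgue_integral_def)
  then show ?thesis by (simp only: eq)
qed

text \<open>The majorant is \<open>C * (\<omega> + (4 / \<omega>) * s w + indicator E2 w)\<close> on \<open>[-1, 2]\<close>, with the measure \<open>s w\<close> of
the section of the residual set at \<open>w\<close>. The fourth power of the factor \<open>4 / \<omega>\<close> is the price of small
dilation quotients \<open>h\<close>; the area of the residual set, \<open>O (\<omega> ^ 5)\<close> by its threshold \<open>\<omega> ^ 15\<close>, pays for it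
and leaves \<open>O (\<omega>)\<close>.\<close>

lemma kernel_majorant:
  fixes \<alpha> \<beta> :: real and \<psi> :: "real \<Rightarrow> complex"
  assumes ab: "0 < \<alpha>" "0 < \<beta>" "\<alpha> \<noteq> \<beta>" "\<alpha> \<noteq> 1" "\<beta> \<noteq> 1"
    and psi: "smooth \<psi>" "closure {t. \<psi> t \<noteq> 0} \<subseteq> {1..2}"
  obtains K where "0 < K"
    "\<And>r n. 1 \<le> r \<Longrightarrow> r \<le> \<bar>fst n\<bar> + \<bar>snd n\<bar> \<Longrightarrow>
       \<exists>H :: real \<Rightarrow> real. H \<in> borel_measurable borel \<and> (\<forall>w. 0 \<le> H w) \<and> (\<forall>w. w \<notin> {-1..2} \<longrightarrow> H w = 0) \<and>
         (\<integral>\<^sup>+w. ennreal (H w ^ 4) \<partial>lborel) \<le> ennreal (K * r powr (-1 / 137)) \<and>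
         (\<forall>m h w. r \<le> \<bar>fst m\<bar> + \<bar>snd m\<bar> \<longrightarrow> 0 < h \<longrightarrow> h \<le> 1 \<longrightarrow>
           norm (corr \<alpha> \<beta> \<psi> n m h w) \<le> H w)"
proof -
  define a where "a = \<alpha> - 1"
  define b where "b = \<beta> - 1"
  have abn: "a \<noteq> b" "a \<noteq> 0" "b \<noteq> 0" using ab by (auto simp: a_def b_def)
  obtain \<eta>' where e: "\<And>t. 0 < t \<Longrightarrow> ((\<lambda>t. \<psi> t / of_real t) has_vector_derivative \<eta>' t) (at t)"
    "continuous_on {0<..} \<eta>'" and z: "\<And>t. t \<notin> {1<..<2} \<Longrightarrow> \<psi> t = 0" and c\<psi>: "continuous_on UNIV \<psi>"
    using smooth_amplitude[OF psi] by blast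
  have e0: "\<psi> 1 / of_real 1 = 0" "\<psi> 2 / of_real 2 = 0" using z by auto
  define \<kappa> where "\<kappa> = min \<alpha> \<beta>"
  have kap: "0 < \<kappa>" using ab by (simp add: \<kappa>_def)
  obtain C E where C: "0 < C" and E: "0 < E" and kb: "\<And>\<omega> n1 n2 m1 m2 h w A B. 0 < \<omega> \<Longrightarrow> \<omega> \<le> 1 \<Longrightarrow> 0 < l1 (n1 * \<alpha>) (n2 * \<beta>) \<Longrightarrow>
      \<kappa> \<le> \<omega> ^ 137 * l1 (m1 * \<alpha>) (m2 * \<beta>) \<Longrightarrow>
      0 < h \<Longrightarrow> h \<le> 1 \<Longrightarrow> A = max 1 ((1 - w) / h) \<Longrightarrow> B = min 2 ((2 - w) / h) \<Longrightarrow> A \<le> B \<Longrightarrow>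
      norm (integral {A..B} (\<lambda>u. exp (\<i> * of_real (two_powers \<alpha> \<beta> n1 n2 (w + h * u) - two_powers \<alpha> \<beta> m1 m2 u))
         * (\<psi> (w + h * u) / of_real (w + h * u) * cnj (\<psi> u / of_real u))))
      \<le> C * (\<omega> + (4 / \<omega>) * measure lborel (resid_set (\<alpha> - 1) (\<beta> - 1) (n1 * \<alpha>) (n2 * \<beta>) w (\<omega> ^ 15 * l1 (n1 * \<alpha>) (n2 * \<beta>)))
        + indicator (power_set (\<alpha> - 1) (\<beta> - 1) (n1 * \<alpha>) (n2 * \<beta>) (E * \<omega> * l1 (n1 * \<alpha>) (n2 * \<beta>))) w)"
  proof (rule kernel_pointwise_bound[OF ab e e0 kap], goal_cases)
    case (1 t)
    show ?case by (rule 1(2))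
  next
    case (2 C E)
    show ?case by (rule 2(1)[OF 2(2-4)])
  qed
  obtain C1 where C1: "0 < C1" "\<And>c d \<delta>. 0 < l1 c d \<Longrightarrow> 0 < \<delta> \<Longrightarrow>
    (\<integral>\<^sup>+w. indicator {-1..2} w *
       emeasure lborel (resid_set a b c d w (\<delta> ^ 3 * l1 c d)) \<partial>lborel) \<le> ennreal (C1 * \<delta>)"
    using resid_sublevel_area[OF abn] by blast
  obtain C2 where C2: "0 < C2" "\<And>c d \<epsilon>. 0 < l1 c d \<Longrightarrow> 0 < \<epsilon> \<Longrightarrow>
    measure lborel (power_set a b c d (\<epsilon> * l1 c d)) \<le> C2 * \<epsilon>"
    using two_powers_sublevel[OF abn(1)] by blast
  define K where "K = 81 * C ^ 4 * (3 + 256 * C1 + C2 * E)"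
  have K: "0 < K" unfolding K_def using C C1 C2 E by (intro mult_pos_pos add_pos_pos) auto
  show ?thesis
  proof (rule that[OF K])
    fix r :: real and n :: "real \<times> real"
    assume r: "1 \<le> r" and rn: "r \<le> \<bar>fst n\<bar> + \<bar>snd n\<bar>"
    \<comment> \<open>Up to a constant, the smallest \<open>\<omega>\<close> for which the hypothesis of \<open>kernel_pointwise_bound\<close> holds for all
      frequencies of size \<open>r\<close>.\<close>
    define \<omega> where "\<omega> = r powr (-1 / 137)"
    have om: "0 < \<omega>" "\<omega> \<le> 1" using r powr_mono[of "-1/137" 0 r] by (auto simp: \<omega>_def)
    have om137: "\<omega> ^ 137 = 1 / r"
    proof -
      have "\<omega> ^ 137 = r powr (-1 / 137 * real 137)" unfolding \<omega>_def using r
        by (subst powr_powr[symmetric]) (simp add: powr_realpow)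
      then show ?thesis using r by (simp add: powr_minus_divide)
    qed
    have mk: "\<kappa> \<le> \<omega> ^ 137 * l1 (fst m * \<alpha>) (snd m * \<beta>)" if "r \<le> \<bar>fst m\<bar> + \<bar>snd m\<bar>" for m
    proof -
      have "\<kappa> * r \<le> \<kappa> * l1 (fst m) (snd m)" using that kap by (intro mult_left_mono) auto
      also have "\<dots> = \<bar>fst m\<bar> * \<kappa> + \<bar>snd m\<bar> * \<kappa>" by (simp add: algebra_simps)
      also have "\<dots> \<le> \<bar>fst m\<bar> * \<alpha> + \<bar>snd m\<bar> * \<beta>" by (intro add_mono mult_left_mono) (auto simp: \<kappa>_def)
      also have "\<dots> = \<bar>fst m * \<alpha>\<bar> + \<bar>snd m * \<beta>\<bar>" using ab by (simp add: abs_mult)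
      finally show ?thesis using r by (simp add: om137 field_simps)
    qed
    define c where "c = fst n * \<alpha>"
    define d where "d = snd n * \<beta>"
    have n0: "0 < l1 c d"
    proof (rule ccontr)
      assume "\<not> 0 < l1 c d"
      then have "\<bar>fst n * \<alpha>\<bar> + \<bar>snd n * \<beta>\<bar> = 0" unfolding c_def d_def by linarith
      with mk[OF rn] kap show False by (simp only: mult_zero_right)
    qed
    define s where "s = (\<lambda>w. measure lborel (resid_set a b c d w (\<omega> ^ 15 * l1 c d)))"
    define E2 where "E2 = power_set a b c d (E * \<omega> * l1 c d)"
    define H where "H = (\<lambda>w. indicator {-1..2} w * (C * (\<omega> + (4 / \<omega>) * s w + indicator E2 w)))"
    have Sm: "(resid_set a b c d w (\<omega> ^ 15 * l1 c d)) \<in> sets borel" for w by measurable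
    have es: "emeasure lborel (resid_set a b c d w (\<omega> ^ 15 * l1 c d)) = ennreal (s w)" for w
      unfolding s_def by (rule emeasure_eq_measure_bounded[OF Sm, of w 1 2]) auto
    have s01: "0 \<le> s w" "s w \<le> 1" for w
    proof -
      have "s w \<le> 2 - 1" unfolding s_def by (rule measure_le_length[OF Sm]) auto
      then show "s w \<le> 1" by simp
    qed (simp add: s_def)
    have sm [measurable]: "s \<in> borel_measurable borel"
    proof -
      have "(\<lambda>w. enn2real (emeasure lborel (resid_set a b c d w (\<omega> ^ 15 * l1 c d)))) \<in> borel_measurable borel"
        using emeasure_resid_section_measurable by measurable
      moreover have "enn2real (emeasure lborel (resid_set a b c d w (\<omega> ^ 15 * l1 c d))) = s w" for w
        unfolding s_def measure_def by (rule refl)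
      ultimately show ?thesis by (simp only:)
    qed
    have E2m [measurable]: "E2 \<in> sets borel" unfolding E2_def by measurable
    have Hm: "H \<in> borel_measurable borel" unfolding H_def by measurable
    have H0: "0 \<le> H w" for w unfolding H_def using C om s01 by (intro mult_nonneg_nonneg add_nonneg_nonneg) auto
    have Hz: "H w = 0" if "w \<notin> {-1..2}" for w using that by (simp add: H_def)
    have H4: "(\<integral>\<^sup>+w. ennreal (H w ^ 4) \<partial>lborel) \<le> ennreal (K * \<omega>)"
    proof -
      have o4: "\<omega> ^ 4 \<le> \<omega>" using power_decreasing[of 1 4 \<omega>] om by simp
      have pt: "ennreal (H w ^ 4) \<le> ennreal (81 * C ^ 4 * \<omega>) * indicator {-1..2} w
         + (ennreal (81 * C ^ 4 * (256 / \<omega> ^ 4)) * (indicator {-1..2} w * ennreal (s w)) + ennreal (81 * C ^ 4) * indicator E2 w)" for w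
      proof (cases "w \<in> {-1..2}")
        case True
        have "H w ^ 4 = C ^ 4 * (\<omega> + (4 / \<omega>) * s w + indicator E2 w) ^ 4"
          using True by (simp add: H_def power_mult_distrib)
        also have "\<dots> \<le> C ^ 4 * (81 * (\<omega> ^ 4 + ((4 / \<omega>) * s w) ^ 4 + (indicator E2 w) ^ 4))"
          using C om s01 by (intro mult_left_mono power4_sum3_le) auto
        also have "\<dots> \<le> C ^ 4 * (81 * (\<omega> + (256 / \<omega> ^ 4) * s w + indicator E2 w))"
        proof (intro mult_left_mono add_mono o4)
          have "((4 / \<omega>) * s w) ^ 4 = (256 / \<omega> ^ 4) * s w ^ 4" by (simp add: power_mult_distrib power_divide)
          also have "\<dots> \<le> (256 / \<omega> ^ 4) * s w"
            using power_decreasing[of 1 4 "s w"] s01[of w] om by (intro mult_left_mono) auto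
          finally show "((4 / \<omega>) * s w) ^ 4 \<le> (256 / \<omega> ^ 4) * s w" .
          show "(indicator E2 w) ^ 4 \<le> (indicator E2 w :: real)" by (auto simp: indicator_def)
        qed (use C in auto)
        also have "\<dots> = 81 * C ^ 4 * \<omega> + ((81 * C ^ 4 * (256 / \<omega> ^ 4)) * s w + 81 * C ^ 4 * indicator E2 w)"
          by (simp add: algebra_simps)
        finally have "ennreal (H w ^ 4) \<le> ennreal (81 * C ^ 4 * \<omega> + ((81 * C ^ 4 * (256 / \<omega> ^ 4)) * s w + 81 * C ^ 4 * indicator E2 w))"
          by (rule ennreal_leI)
        also have "\<dots> = ennreal (81 * C ^ 4 * \<omega>) + (ennreal ((81 * C ^ 4 * (256 / \<omega> ^ 4)) * s w) + ennreal (81 * C ^ 4 * indicator E2 w))"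
          using C om s01 by (simp del: ennreal_plus add: ennreal_plus[symmetric])
        also have "ennreal ((81 * C ^ 4 * (256 / \<omega> ^ 4)) * s w) = ennreal (81 * C ^ 4 * (256 / \<omega> ^ 4)) * ennreal (s w)"
          using C om s01 by (intro ennreal_mult) auto
        also have "ennreal (81 * C ^ 4 * indicator E2 w) = ennreal (81 * C ^ 4) * indicator E2 w"
          by (auto simp: indicator_def)
        finally show ?thesis using True by simp
      qed (use Hz in simp)
      have "(\<integral>\<^sup>+w. ennreal (H w ^ 4) \<partial>lborel) \<le> (\<integral>\<^sup>+w. ennreal (81 * C ^ 4 * \<omega>) * indicator {-1..2} w
         + (ennreal (81 * C ^ 4 * (256 / \<omega> ^ 4)) * (indicator {-1..2} w * ennreal (s w)) + ennreal (81 * C ^ 4) * indicator E2 w) \<partial>lborel)"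
        by (intro nn_integral_mono pt)
      also have "\<dots> = ennreal (81 * C ^ 4 * \<omega>) * emeasure lborel {-1..2::real}
        + (ennreal (81 * C ^ 4 * (256 / \<omega> ^ 4)) * (\<integral>\<^sup>+w. indicator {-1..2} w * ennreal (s w) \<partial>lborel) + ennreal (81 * C ^ 4) * emeasure lborel E2)"
        by (subst nn_integral_add; (measurable; fail)?; (subst nn_integral_add; (measurable; fail)?)?)
           (simp add: nn_integral_cmult)
      also have "\<dots> \<le> ennreal (81 * C ^ 4 * \<omega>) * ennreal 3
        + (ennreal (81 * C ^ 4 * (256 / \<omega> ^ 4)) * ennreal (C1 * \<omega> ^ 5) + ennreal (81 * C ^ 4) * ennreal (C2 * (E * \<omega>)))"
      proof (intro add_mono mult_left_mono)
        show "emeasure lborel {-1..2::real} \<le> ennreal 3" by simp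
        have "(\<omega> ^ 5) ^ 3 = \<omega> ^ 15" by (simp add: power_mult[symmetric])
        with C1(2)[OF n0, of "\<omega> ^ 5"] om es
        show "(\<integral>\<^sup>+w. indicator {-1..2} w * ennreal (s w) \<partial>lborel) \<le> ennreal (C1 * \<omega> ^ 5)" by simp
        have "emeasure lborel E2 = ennreal (measure lborel E2)"
          by (rule emeasure_eq_measure_bounded[OF E2m, of "1/2" 2]) (auto simp: E2_def)
        also have "\<dots> \<le> ennreal (C2 * (E * \<omega>))"
          using C2(2)[OF n0, of "E * \<omega>"] E om by (intro ennreal_leI) (simp add: E2_def)
        finally show "emeasure lborel E2 \<le> ennreal (C2 * (E * \<omega>))" .
      qed auto
      also have "\<dots> = ennreal (81 * C ^ 4 * \<omega> * 3 + (81 * C ^ 4 * (256 / \<omega> ^ 4) * (C1 * \<omega> ^ 5) + 81 * C ^ 4 * (C2 * (E * \<omega>))))"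
      proof -
        have nn: "0 \<le> 81 * C ^ 4 * \<omega>" "0 \<le> 81 * C ^ 4 * (256 / \<omega> ^ 4)" "0 \<le> C1 * \<omega> ^ 5" "0 \<le> 81 * C ^ 4" "0 \<le> C2 * (E * \<omega>)"
          using C C1 C2 E om by auto
        show ?thesis
          by (subst ennreal_mult[symmetric, OF nn(1)], simp, subst ennreal_mult[symmetric, OF nn(2,3)],
              subst ennreal_mult[symmetric, OF nn(4,5)], subst ennreal_plus[symmetric],
              (use nn in \<open>auto intro!: mult_nonneg_nonneg\<close>)[2], subst ennreal_plus[symmetric])
            (use nn in \<open>auto intro!: mult_nonneg_nonneg add_nonneg_nonneg\<close>)
      qed
      also have "81 * C ^ 4 * \<omega> * 3 + (81 * C ^ 4 * (256 / \<omega> ^ 4) * (C1 * \<omega> ^ 5) + 81 * C ^ 4 * (C2 * (E * \<omega>))) = K * \<omega>"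
      proof -
        have "(256 / \<omega> ^ 4) * (C1 * \<omega> ^ 5) = 256 * C1 * \<omega>" using om power_Suc[of \<omega> 4] by simp
        then have "81 * C ^ 4 * (256 / \<omega> ^ 4) * (C1 * \<omega> ^ 5) = 81 * C ^ 4 * (256 * C1 * \<omega>)"
          by (simp only: mult.assoc)
        then show ?thesis by (simp only:) (simp add: K_def algebra_simps)
      qed
      finally show ?thesis .
    qed
    have bound: "norm (corr \<alpha> \<beta> \<psi> n m h w) \<le> H w"
      if m: "r \<le> \<bar>fst m\<bar> + \<bar>snd m\<bar>" and h: "0 < h" "h \<le> 1" for m h w
    proof -
      define A where "A = max 1 ((1 - w) / h)"
      define B where "B = min 2 ((2 - w) / h)"
      have J: "corr \<alpha> \<beta> \<psi> n m h w =
        integral {A..B} (\<lambda>u. exp (\<i> * of_real (two_powers \<alpha> \<beta> (fst n) (snd n) (w + h * u) - two_powers \<alpha> \<beta> (fst m) (snd m) u))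
         * (\<psi> (w + h * u) / of_real (w + h * u) * cnj (\<psi> u / of_real u)))"
        by (rule Phi_product_integral[OF h(1) z c\<psi> A_def B_def])
      show ?thesis
      proof (cases "A \<le> B")
        case True
        have w: "w \<in> {-1..2}"
        proof -
          have "A \<in> {A..B}" using True by simp
          then have "1 \<le> A" "A \<le> 2" "(1 - w) / h \<le> A" "A \<le> (2 - w) / h" by (auto simp: A_def B_def)
          then have "1 - w \<le> A * h" "A * h \<le> 2 - w" using h by (auto simp: field_simps)
          moreover have "A * h \<le> 2 * 1" using \<open>1 \<le> A\<close> \<open>A \<le> 2\<close> h by (intro mult_mono) auto
          moreover have "0 \<le> A * h" using \<open>1 \<le> A\<close> h by simp
          ultimately show ?thesis by auto
        qed
        show ?thesis unfolding J
          using kb[OF om n0[unfolded c_def d_def] mk[OF m] h A_def B_def True]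
          unfolding H_def s_def E2_def a_def b_def c_def d_def indicator_simps(1)[OF w] mult_1 .
      next
        case False
        then show ?thesis unfolding J using H0 by simp
      qed
    qed
    show "\<exists>H :: real \<Rightarrow> real. H \<in> borel_measurable borel \<and> (\<forall>w. 0 \<le> H w) \<and> (\<forall>w. w \<notin> {-1..2} \<longrightarrow> H w = 0) \<and>
         (\<integral>\<^sup>+w. ennreal (H w ^ 4) \<partial>lborel) \<le> ennreal (K * r powr (-1 / 137)) \<and>
         (\<forall>m h w. r \<le> \<bar>fst m\<bar> + \<bar>snd m\<bar> \<longrightarrow> 0 < h \<longrightarrow> h \<le> 1 \<longrightarrow>
           norm (corr \<alpha> \<beta> \<psi> n m h w) \<le> H w)"
      using Hm H0 Hz H4[unfolded \<omega>_def] bound by (intro exI[of _ H]) (intro conjI allI impI)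
  qed
qed

section \<open>A Hardy--Littlewood maximal inequality\<close>

text \<open>By Vitali's lemma the given balls contain a disjoint subfamily whose fivefold enlargements still
cover \<open>K\<close>. The balls have bounded radii because \<open>R\<close> is finite.\<close>

lemma weak_type_maximal:
  fixes g :: "real \<Rightarrow> ennreal" and R :: "real set"
  assumes g [measurable]: "g \<in> borel_measurable borel" and R: "finite R" "\<And>\<rho>. \<rho> \<in> R \<Longrightarrow> 0 < \<rho>"
    and s: "0 < s" and K: "K \<in> sets borel"
    and KR: "\<And>x. x \<in> K \<Longrightarrow> \<exists>\<rho>\<in>R. ennreal (s * \<rho>) \<le> (\<integral>\<^sup>+y. g y * indicator (cball x \<rho>) y \<partial>lborel)"
  shows "emeasure lborel K \<le> ennreal (10 / s) * (\<integral>\<^sup>+y. g y \<partial>lborel)"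
proof -
  obtain \<rho> where \<rho>: "\<And>x. x \<in> K \<Longrightarrow> \<rho> x \<in> R \<and> ennreal (s * \<rho> x) \<le> (\<integral>\<^sup>+y. g y * indicator (cball x (\<rho> x)) y \<partial>lborel)"
    using KR by metis
  have pos: "0 < \<rho> x" if "x \<in> K" for x using R \<rho>[OF that] by auto
  have "K \<subseteq> (\<Union>x\<in>K. cball x (\<rho> x))" using pos by force
  moreover have "0 < \<rho> x \<and> \<rho> x \<le> Max R" if "x \<in> K" for x using pos[OF that] \<rho>[OF that] R(1) by simp
  ultimately obtain C where C: "countable C" "C \<subseteq> K"
     "pairwise (\<lambda>i j. disjnt (cball i (\<rho> i)) (cball j (\<rho> j))) C"
     "K \<subseteq> (\<Union>i\<in>C. cball i (5 * \<rho> i))"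
    by (rule Vitali_covering_lemma_cballs[where a = "\<lambda>x. x" and r = \<rho> and K = K])
  have "emeasure lborel K = (\<integral>\<^sup>+x. indicator K x \<partial>lborel)" using K by simp
  also have "\<dots> \<le> (\<integral>\<^sup>+x. \<integral>\<^sup>+i. indicator (cball i (5 * \<rho> i)) x \<partial>count_space C \<partial>lborel)"
  proof (rule nn_integral_mono)
    fix x show "indicator K x \<le> (\<integral>\<^sup>+i. indicator (cball i (5 * \<rho> i)) x \<partial>count_space C)"
    proof (cases "x \<in> K")
      case True
      then obtain i where i: "i \<in> C" "x \<in> cball i (5 * \<rho> i)" using C(4) by auto
      have "1 = (\<integral>\<^sup>+j. indicator {i} j \<partial>count_space C)" using i by simp
      also have "\<dots> \<le> (\<integral>\<^sup>+i. indicator (cball i (5 * \<rho> i)) x \<partial>count_space C)"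
        using i by (intro nn_integral_mono) (auto simp: indicator_def)
      finally show ?thesis using True by simp
    qed simp
  qed
  also have "\<dots> = (\<integral>\<^sup>+i. \<integral>\<^sup>+x. indicator (cball i (5 * \<rho> i)) x \<partial>lborel \<partial>count_space C)"
    using C(1) by (intro nn_integral_count_space_nn_integral borel_measurable_indicator) auto
  also have "\<dots> \<le> (\<integral>\<^sup>+i. \<integral>\<^sup>+x. ennreal (10 / s) * (g x * indicator (cball i (\<rho> i)) x) \<partial>lborel \<partial>count_space C)"
  proof (rule nn_integral_mono)
    fix i assume "i \<in> space (count_space C)"
    then have i: "i \<in> K" using C(2) by auto
    have "cball i (5 * \<rho> i) = {i - 5 * \<rho> i..i + 5 * \<rho> i}" by (auto simp: dist_real_def)
    then have "(\<integral>\<^sup>+x. indicator (cball i (5 * \<rho> i)) x \<partial>lborel) = ennreal ((10 / s) * (s * \<rho> i))"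
      using pos[OF i] s by simp
    also have "\<dots> = ennreal (10 / s) * ennreal (s * \<rho> i)" using pos[OF i] s by (intro ennreal_mult) auto
    also have "\<dots> \<le> ennreal (10 / s) * (\<integral>\<^sup>+x. g x * indicator (cball i (\<rho> i)) x \<partial>lborel)"
      using \<rho>[OF i] by (intro mult_left_mono) auto
    also have "\<dots> = (\<integral>\<^sup>+x. ennreal (10 / s) * (g x * indicator (cball i (\<rho> i)) x) \<partial>lborel)"
      unfolding cball_eq_atLeastAtMost by (intro nn_integral_cmult[symmetric]) measurable
    finally show "(\<integral>\<^sup>+x. indicator (cball i (5 * \<rho> i)) x \<partial>lborel)
      \<le> (\<integral>\<^sup>+x. ennreal (10 / s) * (g x * indicator (cball i (\<rho> i)) x) \<partial>lborel)" .
  qed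
  also have "\<dots> = (\<integral>\<^sup>+x. \<integral>\<^sup>+i. ennreal (10 / s) * (g x * indicator (cball i (\<rho> i)) x) \<partial>count_space C \<partial>lborel)"
    unfolding cball_eq_atLeastAtMost
    using C(1) by (intro nn_integral_count_space_nn_integral[symmetric]) measurable
  also have "\<dots> \<le> (\<integral>\<^sup>+x. ennreal (10 / s) * g x \<partial>lborel)"
  proof (rule nn_integral_mono)
    fix x
    have "(\<integral>\<^sup>+i. indicator (cball i (\<rho> i)) x \<partial>count_space C) \<le> 1"
    proof (cases "\<exists>i\<in>C. x \<in> cball i (\<rho> i)")
      case True
      then obtain i where i: "i \<in> C" "x \<in> cball i (\<rho> i)" by auto
      have "j = i" if "j \<in> C" "x \<in> cball j (\<rho> j)" for j
        using C(3) i that unfolding pairwise_def disjnt_iff by blast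
      then have "(\<integral>\<^sup>+i. indicator (cball i (\<rho> i)) x \<partial>count_space C) \<le> (\<integral>\<^sup>+j. indicator {i} j \<partial>count_space C)"
        by (intro nn_integral_mono) (auto simp: indicator_def)
      also have "\<dots> = 1" using i by simp
      finally show ?thesis .
    next
      case False
      then have "(\<integral>\<^sup>+i. indicator (cball i (\<rho> i)) x \<partial>count_space C) = (\<integral>\<^sup>+i. 0 \<partial>count_space C)"
        by (intro nn_integral_cong) (auto simp: indicator_def)
      then show ?thesis by simp
    qed
    then have "ennreal (10 / s) * g x * (\<integral>\<^sup>+i. indicator (cball i (\<rho> i)) x \<partial>count_space C) \<le> ennreal (10 / s) * g x * 1"
      by (intro mult_left_mono) auto
    then show "(\<integral>\<^sup>+i. ennreal (10 / s) * (g x * indicator (cball i (\<rho> i)) x) \<partial>count_space C) \<le> ennreal (10 / s) * g x"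
      by (simp add: nn_integral_cmult[symmetric] mult.assoc)
  qed
  also have "\<dots> = ennreal (10 / s) * (\<integral>\<^sup>+y. g y \<partial>lborel)" by (intro nn_integral_cmult) measurable
  finally show ?thesis .
qed

lemma nn_integral_cube_layers:
  fixes m :: real
  assumes "0 \<le> m"
  shows "ennreal (m ^ 3) = (\<integral>\<^sup>+t. ennreal (3 * t\<^sup>2) * indicator {0<..<m} t \<partial>lborel)"
proof -
  have "(\<integral>\<^sup>+t. ennreal (3 * t\<^sup>2) * indicator {0 .. m} t \<partial>lborel) = ennreal (m ^ 3 - 0 ^ 3)"
    using assms by (intro nn_integral_FTC_Icc) (auto intro!: derivative_eq_intros)
  moreover have "(\<integral>\<^sup>+t. ennreal (3 * t\<^sup>2) * indicator {0 .. m} t \<partial>lborel)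
    = (\<integral>\<^sup>+t. ennreal (3 * t\<^sup>2) * indicator {0<..<m} t \<partial>lborel)"
  proof (rule nn_integral_cong_AE)
    have "AE t in lborel. t \<noteq> 0" "AE t in lborel. t \<noteq> m" by (auto simp: AE_lborel_singleton)
    then show "AE t in lborel. ennreal (3 * t\<^sup>2) * indicator {0 .. m} t = ennreal (3 * t\<^sup>2) * indicator {0<..<m} t"
      by eventually_elim (auto simp: indicator_def)
  qed
  ultimately show ?thesis by simp
qed

text \<open>With \<open>g = e ^ 4\<close> the hypothesis says that \<open>m\<^sup>2\<close> is at most \<open>1 / \<rho>\<close> times the integral of \<open>g\<close> over a ball of
radius \<open>\<rho>\<close> about \<open>x\<close>, and the conclusion is the bound of the maximal operator on \<open>L powr (3/2)\<close>, in the form that avoids fractional powers.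
The level \<open>t\<close> is taken for \<open>m\<close>, that is, \<open>t\<^sup>2\<close> for this quotient. The part of \<open>g\<close> below \<open>t\<^sup>2 / 4\<close> contributes at
most \<open>t\<^sup>2 / 2\<close> to it, so that the weak type inequality applies to the rest.\<close>

lemma strong_type_maximal:
  fixes e m :: "real \<Rightarrow> real" and R :: "real set"
  assumes e [measurable]: "e \<in> borel_measurable borel" and m [measurable]: "m \<in> borel_measurable borel"
    and nn: "\<And>x. 0 \<le> e x" "\<And>x. 0 \<le> m x" and R: "finite R" "\<And>\<rho>. \<rho> \<in> R \<Longrightarrow> 0 < \<rho>"
    and mR: "\<And>x. \<exists>\<rho>\<in>R. ennreal ((m x)\<^sup>2 * \<rho>) \<le> (\<integral>\<^sup>+y. ennreal (e y ^ 4) * indicator (cball x \<rho>) y \<partial>lborel)"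
  shows "(\<integral>\<^sup>+x. ennreal (m x ^ 3) \<partial>lborel) \<le> 120 * (\<integral>\<^sup>+x. ennreal (e x ^ 6) \<partial>lborel)"
proof -
  have "(\<integral>\<^sup>+x. ennreal (m x ^ 3) \<partial>lborel) = (\<integral>\<^sup>+x. \<integral>\<^sup>+t. ennreal (3 * t\<^sup>2) * indicator {0<..<m x} t \<partial>lborel \<partial>lborel)"
    using nn by (intro nn_integral_cong nn_integral_cube_layers)
  also have "\<dots> = (\<integral>\<^sup>+x. \<integral>\<^sup>+t. (if 0 < t \<and> t < m x then ennreal (3 * t\<^sup>2) else 0) \<partial>lborel \<partial>lborel)"
    by (intro nn_integral_cong) (auto simp: indicator_def)
  also have "\<dots> = (\<integral>\<^sup>+t. \<integral>\<^sup>+x. (if 0 < t \<and> t < m x then ennreal (3 * t\<^sup>2) else 0) \<partial>lborel \<partial>lborel)"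
  proof -
    have "(\<lambda>(x, t). (if 0 < t \<and> t < m x then ennreal (3 * t\<^sup>2) else 0)) \<in> borel_measurable (lborel \<Otimes>\<^sub>M lborel)"
      unfolding case_prod_beta by measurable
    from lborel_pair.Fubini'[OF this] show ?thesis by simp
  qed
  also have "\<dots> \<le> (\<integral>\<^sup>+t. \<integral>\<^sup>+x. (if 0 < t \<and> t < 2 * (e x)\<^sup>2 then ennreal (60 * e x ^ 4) else 0) \<partial>lborel \<partial>lborel)"
  proof (rule nn_integral_mono)
    fix t :: real
    show "(\<integral>\<^sup>+x. (if 0 < t \<and> t < m x then ennreal (3 * t\<^sup>2) else 0) \<partial>lborel)
      \<le> (\<integral>\<^sup>+x. (if 0 < t \<and> t < 2 * (e x)\<^sup>2 then ennreal (60 * e x ^ 4) else 0) \<partial>lborel)"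
    proof (cases "0 < t")
      case t: True
      define g where "g = (\<lambda>x. if t < 2 * (e x)\<^sup>2 then ennreal (e x ^ 4) else 0)"
      have gm [measurable]: "g \<in> borel_measurable borel" unfolding g_def by measurable
      let ?K = "{x. t < m x}"
      have K: "?K \<in> sets borel" by measurable
      have "emeasure lborel ?K \<le> ennreal (10 / (t\<^sup>2 / 2)) * (\<integral>\<^sup>+y. g y \<partial>lborel)"
      proof (rule weak_type_maximal[OF gm R _ K])
        show "0 < t\<^sup>2 / 2" using t by simp
        fix x assume x: "x \<in> ?K"
        obtain \<rho> where \<rho>: "\<rho> \<in> R" "ennreal ((m x)\<^sup>2 * \<rho>) \<le> (\<integral>\<^sup>+y. ennreal (e y ^ 4) * indicator (cball x \<rho>) y \<partial>lborel)"
          using mR by blast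
        have r: "0 < \<rho>" using R \<rho> by auto
        have "ennreal (t\<^sup>2 * \<rho>) \<le> ennreal ((m x)\<^sup>2 * \<rho>)" using x t r
          by (intro ennreal_leI mult_right_mono power_mono) auto
        also note \<rho>(2)
        also have "(\<integral>\<^sup>+y. ennreal (e y ^ 4) * indicator (cball x \<rho>) y \<partial>lborel)
           \<le> (\<integral>\<^sup>+y. g y * indicator (cball x \<rho>) y + ennreal (t\<^sup>2 / 4) * indicator (cball x \<rho>) y \<partial>lborel)"
        proof (rule nn_integral_mono)
          fix y
          have "ennreal (e y ^ 4) \<le> g y + ennreal (t\<^sup>2 / 4)"
          proof (cases "t < 2 * (e y)\<^sup>2")
            case False
            then have "((e y)\<^sup>2)\<^sup>2 \<le> (t / 2)\<^sup>2" by (intro power_mono) auto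
            then have "e y ^ 4 \<le> t\<^sup>2 / 4" by (simp add: power_divide)
            then show ?thesis using False by (simp add: g_def)
          qed (simp add: g_def)
          then show "ennreal (e y ^ 4) * indicator (cball x \<rho>) y
            \<le> g y * indicator (cball x \<rho>) y + ennreal (t\<^sup>2 / 4) * indicator (cball x \<rho>) y"
            by (auto simp: indicator_def)
        qed
        also have "\<dots> = (\<integral>\<^sup>+y. g y * indicator (cball x \<rho>) y \<partial>lborel) + ennreal (t\<^sup>2 / 4) * emeasure lborel (cball x \<rho>)"
          unfolding cball_eq_atLeastAtMost
          by (subst nn_integral_add) (simp_all add: nn_integral_cmult)
        also have "cball x \<rho> = {x - \<rho>..x + \<rho>}" by (auto simp: dist_real_def)
        also have "ennreal (t\<^sup>2 / 4) * emeasure lborel {x - \<rho>..x + \<rho>} = ennreal (t\<^sup>2 / 2 * \<rho>)"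
          using r by (simp add: ennreal_mult[symmetric])
        finally have 1: "ennreal (t\<^sup>2 * \<rho>) \<le> (\<integral>\<^sup>+y. g y * indicator {x - \<rho>..x + \<rho>} y \<partial>lborel) + ennreal (t\<^sup>2 / 2 * \<rho>)" .
        have "ennreal (t\<^sup>2 * \<rho>) = ennreal (t\<^sup>2 / 2 * \<rho>) + ennreal (t\<^sup>2 / 2 * \<rho>)"
          using r by (simp add: ennreal_plus[symmetric] del: ennreal_plus)
        with 1 have "ennreal (t\<^sup>2 / 2 * \<rho>) \<le> (\<integral>\<^sup>+y. g y * indicator {x - \<rho>..x + \<rho>} y \<partial>lborel)"
          by (simp add: ennreal_add_left_cancel_le add.commute)
        then show "\<exists>\<rho>\<in>R. ennreal (t\<^sup>2 / 2 * \<rho>) \<le> (\<integral>\<^sup>+y. g y * indicator (cball x \<rho>) y \<partial>lborel)"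
          using \<rho>(1) by (intro bexI[of _ \<rho>]) (auto simp: cball_eq_atLeastAtMost)
      qed
      then have w: "ennreal (3 * t\<^sup>2) * emeasure lborel ?K \<le> ennreal (3 * t\<^sup>2) * (ennreal (10 / (t\<^sup>2 / 2)) * (\<integral>\<^sup>+y. g y \<partial>lborel))"
        by (intro mult_left_mono) auto
      have "(\<integral>\<^sup>+x. (if 0 < t \<and> t < m x then ennreal (3 * t\<^sup>2) else 0) \<partial>lborel) = (\<integral>\<^sup>+x. ennreal (3 * t\<^sup>2) * indicator ?K x \<partial>lborel)"
        using t by (intro nn_integral_cong) (auto simp: indicator_def)
      also have "\<dots> = ennreal (3 * t\<^sup>2) * emeasure lborel ?K" using K by (simp add: nn_integral_cmult)
      also note w
      also have "ennreal (3 * t\<^sup>2) * (ennreal (10 / (t\<^sup>2 / 2)) * (\<integral>\<^sup>+y. g y \<partial>lborel)) = ennreal (3 * t\<^sup>2 * (10 / (t\<^sup>2 / 2))) * (\<integral>\<^sup>+y. g y \<partial>lborel)"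
        by (subst ennreal_mult) (auto simp: mult.assoc)
      also have "3 * t\<^sup>2 * (10 / (t\<^sup>2 / 2)) = 60" using t by simp
      also have "ennreal 60 * (\<integral>\<^sup>+y. g y \<partial>lborel) = (\<integral>\<^sup>+y. ennreal 60 * g y \<partial>lborel)"
        by (intro nn_integral_cmult[symmetric]) measurable
      also have "\<dots> = (\<integral>\<^sup>+x. (if 0 < t \<and> t < 2 * (e x)\<^sup>2 then ennreal (60 * e x ^ 4) else 0) \<partial>lborel)"
        using t by (intro nn_integral_cong) (auto simp: g_def ennreal_mult'')
      finally show ?thesis .
    next
      case False
      then have "(if 0 < t \<and> t < m x then ennreal (3 * t\<^sup>2) else 0) = 0" for x by simp
      then show ?thesis by simp
    qed
  qed
  also have "\<dots> = (\<integral>\<^sup>+x. \<integral>\<^sup>+t. (if 0 < t \<and> t < 2 * (e x)\<^sup>2 then ennreal (60 * e x ^ 4) else 0) \<partial>lborel \<partial>lborel)"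
  proof -
    have "(\<lambda>(x, t). (if 0 < t \<and> t < 2 * (e x)\<^sup>2 then ennreal (60 * e x ^ 4) else 0)) \<in> borel_measurable (lborel \<Otimes>\<^sub>M lborel)"
      unfolding case_prod_beta by measurable
    from lborel_pair.Fubini'[OF this] show ?thesis by simp
  qed
  also have "\<dots> = (\<integral>\<^sup>+x. 120 * ennreal (e x ^ 6) \<partial>lborel)"
  proof (rule nn_integral_cong)
    fix x
    have "(\<integral>\<^sup>+t. (if 0 < t \<and> t < 2 * (e x)\<^sup>2 then ennreal (60 * e x ^ 4) else 0) \<partial>lborel)
      = (\<integral>\<^sup>+t. ennreal (60 * e x ^ 4) * indicator {0<..<2 * (e x)\<^sup>2} t \<partial>lborel)"
      by (intro nn_integral_cong) (auto simp: indicator_def)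
    also have "\<dots> = ennreal (60 * e x ^ 4) * ennreal (2 * (e x)\<^sup>2)" by (simp add: nn_integral_cmult)
    also have "\<dots> = ennreal (120 * e x ^ 6)" by (simp add: ennreal_mult[symmetric] power_add[symmetric])
    also have "\<dots> = 120 * ennreal (e x ^ 6)" by (simp add: ennreal_mult)
    finally show "(\<integral>\<^sup>+t. (if 0 < t \<and> t < 2 * (e x)\<^sup>2 then ennreal (60 * e x ^ 4) else 0) \<partial>lborel) = 120 * ennreal (e x ^ 6)" .
  qed
  also have "\<dots> = 120 * (\<integral>\<^sup>+x. ennreal (e x ^ 6) \<partial>lborel)" by (intro nn_integral_cmult) measurable
  finally show ?thesis .
qed

section \<open>The TT* method\<close>

lemma borel_measurable_cnj [measurable]:
  fixes f :: "'a \<Rightarrow> complex"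
  assumes "f \<in> borel_measurable M"
  shows "(\<lambda>x. cnj (f x)) \<in> borel_measurable M"
  by (rule measurable_compose[OF assms borel_measurable_continuous_onI]) (intro continuous_intros)

lemma integrable_bounded_support:
  fixes f :: "real \<Rightarrow> complex"
  assumes "f \<in> borel_measurable borel" "\<And>x. norm (f x) \<le> B" "\<And>x. x \<notin> {a..b} \<Longrightarrow> f x = 0"
  shows "integrable lborel f"
proof (rule integrableI_bounded_set[where A = "{a..b}" and B = B])
  show "emeasure lborel {a..b} < \<infinity>" by (cases "a \<le> b") auto
qed (use assms in auto)

lemma integrable_bounded_box:
  fixes f :: "real \<times> real \<Rightarrow> complex"
  assumes "f \<in> borel_measurable (lborel \<Otimes>\<^sub>M lborel)" "\<And>p. norm (f p) \<le> B"
    "\<And>x y. x \<notin> {a..b} \<or> y \<notin> {c..d} \<Longrightarrow> f (x, y) = 0"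
  shows "integrable (lborel \<Otimes>\<^sub>M lborel) f"
proof (rule integrableI_bounded_set[where A = "{a..b} \<times> {c..d}" and B = B])
  show "{a..b} \<times> {c..d} \<in> sets (lborel \<Otimes>\<^sub>M lborel)" by simp
  have "emeasure (lborel \<Otimes>\<^sub>M lborel) ({a..b} \<times> {c..d}) = emeasure lborel {a..b} * emeasure lborel {c..d}"
    by (rule lborel.emeasure_pair_measure_Times) auto
  also have "\<dots> < \<infinity>" by (cases "a \<le> b"; cases "c \<le> d") (auto simp: ennreal_mult_less_top)
  finally show "emeasure (lborel \<Otimes>\<^sub>M lborel) ({a..b} \<times> {c..d}) < \<infinity>" .
  show "AE p in lborel \<Otimes>\<^sub>M lborel. p \<notin> {a..b} \<times> {c..d} \<longrightarrow> f p = 0"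
  proof (rule AE_I2, rule impI)
    fix p assume "p \<notin> {a..b} \<times> {c..d}"
    then show "f p = 0" using assms(3)[of "fst p" "snd p"] by (cases p) auto
  qed
qed (use assms in auto)

lemma integrable_indicator_L2:
  fixes F :: "real \<Rightarrow> complex"
  assumes [measurable]: "F \<in> borel_measurable borel" and F2: "sqnorm F < \<infinity>"
  shows "integrable lborel (\<lambda>z. indicator {c..d} z *\<^sub>R F z)"
proof (rule integrableI_bounded)
  have "(\<integral>\<^sup>+z. ennreal (norm (indicator {c..d} z *\<^sub>R F z)) \<partial>lborel)
    \<le> (\<integral>\<^sup>+z. indicator {c..d} z + (ennreal (norm (F z)))\<^sup>2 \<partial>lborel)"
  proof (rule nn_integral_mono)
    fix z
    have "norm (F z) \<le> 1 + (norm (F z))\<^sup>2"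
    proof -
      have "0 \<le> (norm (F z) - 1)\<^sup>2" by simp
      then have "2 * norm (F z) \<le> 1 + (norm (F z))\<^sup>2" by (simp add: power2_eq_square algebra_simps)
      then show ?thesis using norm_ge_zero[of "F z"] by linarith
    qed
    then have "ennreal (norm (F z)) \<le> 1 + (ennreal (norm (F z)))\<^sup>2"
      by (simp add: ennreal_power ennreal_plus[symmetric] ennreal_1[symmetric] del: ennreal_plus ennreal_1)
    then show "ennreal (norm (indicator {c..d} z *\<^sub>R F z)) \<le> indicator {c..d} z + (ennreal (norm (F z)))\<^sup>2"
      by (auto simp: indicator_def)
  qed
  also have "\<dots> = emeasure lborel {c..d} + sqnorm F"
    by (subst nn_integral_add) auto
  also have "\<dots> < \<infinity>" using F2 by (cases "c \<le> d") auto
  finally show "(\<integral>\<^sup>+z. ennreal (norm (indicator {c..d} z *\<^sub>R F z)) \<partial>lborel) < \<infinity>" .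
qed measurable

lemma norm_lebesgue_integral_le_nn:
  fixes f :: "'a \<Rightarrow> complex"
  shows "ennreal (norm (integral\<^sup>L M f)) \<le> (\<integral>\<^sup>+x. ennreal (norm (f x)) \<partial>M)"
proof (cases "integrable M f")
  case True
  then show ?thesis by (rule integral_norm_bound_ennreal)
qed (simp add: not_integrable_integral_eq)

text \<open>With \<open>G = T F\<close> and \<open>D = T* G\<close>, up to conjugation, \<open>\<parallel>G\<parallel>\<^sup>2 = \<langle>F, D\<rangle> \<le> \<parallel>F\<parallel> \<parallel>D\<parallel>\<close> and
\<open>\<parallel>D\<parallel>\<^sup>2 = \<langle>TT* G, G\<rangle> \<le> q \<parallel>G\<parallel>\<^sup>2\<close>. Dividing by \<open>\<parallel>G\<parallel>\<^sup>2\<close> is possible because it is finite: the kernel is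
bounded and has bounded support.\<close>

lemma TTstar_bound:
  fixes k :: "real \<Rightarrow> real \<Rightarrow> complex" and F :: "real \<Rightarrow> complex"
  assumes km: "(\<lambda>(x, z). k x z) \<in> borel_measurable (lborel \<Otimes>\<^sub>M lborel)"
    and kb: "\<And>x z. norm (k x z) \<le> B" and k0: "\<And>x z. x \<notin> {a..b} \<or> z \<notin> {c..d} \<Longrightarrow> k x z = 0"
    and Fm [measurable]: "F \<in> borel_measurable borel" and F2: "sqnorm F < \<infinity>"
    and key: "\<And>G :: real \<Rightarrow> complex. G \<in> borel_measurable borel \<Longrightarrow>
      (\<integral>\<^sup>+x. ennreal (norm (G x)) * (\<integral>\<^sup>+y. ennreal (norm (G y)) * ennreal (norm (LINT z|lborel. k x z * cnj (k y z))) \<partial>lborel) \<partial>lborel)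
        \<le> ennreal q * sqnorm G"
  shows "(\<integral>\<^sup>+x. (ennreal (norm (LINT z|lborel. k x z * F z)))\<^sup>2 \<partial>lborel)
      \<le> ennreal q * sqnorm F"
proof -
  have B: "0 \<le> B" by (rule order_trans[OF norm_ge_zero kb])
  have km2: "(\<lambda>(z, x). k x z) \<in> borel_measurable (lborel \<Otimes>\<^sub>M lborel)"
    using measurable_compose[OF measurable_Pair[OF measurable_snd measurable_fst] km] by (simp add: case_prod_beta)
  have kmx [measurable]: "k x \<in> borel_measurable borel" for x
    using measurable_compose[OF measurable_Pair1' km, of x] by simp
  have kmz [measurable]: "(\<lambda>x. k x z) \<in> borel_measurable borel" for z
    using measurable_compose[OF measurable_Pair1' km2, of z] by simp
  define F1 where "F1 = (\<lambda>z. indicator {c..d} z *\<^sub>R F z)"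
  have F1m [measurable]: "F1 \<in> borel_measurable borel" unfolding F1_def by measurable
  have kF: "k x z * F z = k x z * F1 z" for x z using k0[of x z] by (auto simp: F1_def indicator_def)
  have F1le: "sqnorm F1 \<le> sqnorm F"
    by (rule nn_integral_mono) (auto simp: F1_def indicator_def)
  have F1int: "integrable lborel F1" unfolding F1_def by (rule integrable_indicator_L2[OF Fm F2])
  then have F1i: "(\<integral>\<^sup>+z. ennreal (norm (F1 z)) \<partial>lborel) < \<infinity>" by (simp add: integrable_iff_bounded)
  define L where "L = (LINT z|lborel. norm (F1 z))"
  have L0: "0 \<le> L" unfolding L_def by simp
  define G where "G = (\<lambda>x. LINT z|lborel. k x z * F1 z)"
  have Gm [measurable]: "G \<in> borel_measurable borel"
  proof -
    have "(\<lambda>(x, z). k x z * F1 z) \<in> borel_measurable (lborel \<Otimes>\<^sub>M lborel)"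
      using km unfolding case_prod_beta by measurable
    then have "G \<in> borel_measurable lborel" unfolding G_def by (rule lborel.borel_measurable_lebesgue_integral)
    then show ?thesis by simp
  qed
  have kFint: "integrable lborel (\<lambda>z. k x z * F1 z)" for x
  proof (rule Bochner_Integration.integrable_bound[of _ "\<lambda>z. B * norm (F1 z)"])
    show "integrable lborel (\<lambda>z. B * norm (F1 z))" using F1int by simp
    show "AE z in lborel. norm (k x z * F1 z) \<le> norm (B * norm (F1 z))"
      using B by (intro AE_I2) (auto simp: norm_mult kb intro!: mult_right_mono)
  qed measurable
  have Gb: "norm (G x) \<le> B * L" for x
  proof -
    have "norm (G x) \<le> (LINT z|lborel. norm (k x z * F1 z))" unfolding G_def by (rule integral_norm_bound)
    also have "\<dots> \<le> (LINT z|lborel. B * norm (F1 z))"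
    proof (rule integral_mono)
      show "integrable lborel (\<lambda>z. norm (k x z * F1 z))" by (rule integrable_norm[OF kFint])
      show "integrable lborel (\<lambda>z. B * norm (F1 z))" using F1int by simp
    qed (auto simp: norm_mult kb intro!: mult_right_mono)
    finally show ?thesis by (simp add: L_def)
  qed
  have G0: "G x = 0" if "x \<notin> {a..b}" for x using that k0 by (simp add: G_def)
  define W where "W = B * L"
  have W: "0 \<le> W" using B L0 by (simp add: W_def)
  have Gb: "norm (G x) \<le> W" for x using Gb by (simp add: W_def)
  define D where "D = (\<lambda>z. LINT x|lborel. cnj (G x) * k x z)"
  have Dm [measurable]: "D \<in> borel_measurable borel"
  proof -
    have "(\<lambda>(z, x). cnj (G x) * k x z) \<in> borel_measurable (lborel \<Otimes>\<^sub>M lborel)"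
      using km2 unfolding case_prod_beta by measurable
    then have "D \<in> borel_measurable lborel" unfolding D_def by (rule lborel.borel_measurable_lebesgue_integral)
    then show ?thesis by simp
  qed
  have GkB: "norm (cnj (G x) * k x z) \<le> W * B" for x z
    unfolding norm_mult complex_mod_cnj using W by (intro mult_mono Gb kb) auto
  have D0: "D z = 0" if "z \<notin> {c..d}" for z using that k0 by (simp add: D_def)
  define V where "V = (LINT x|lborel. indicator {a..b} x * (W * B))"
  have iab: "integrable lborel (\<lambda>x. indicator {a..b} x * (W * B) :: real)"
  proof -
    have "emeasure lborel {a..b} < \<infinity>" by (cases "a \<le> b") auto
    then show ?thesis by (intro integrable_mult_left integrable_real_indicator) auto
  qed
  have Db: "norm (D z) \<le> V" for z
  proof -
    have "norm (D z) \<le> (LINT x|lborel. norm (cnj (G x) * k x z))" unfolding D_def by (rule integral_norm_bound)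
    also have "\<dots> \<le> V" unfolding V_def
    proof (intro integral_mono iab)
      show "integrable lborel (\<lambda>x. norm (cnj (G x) * k x z))"
      proof (intro integrable_norm integrable_bounded_support)
        show "(\<lambda>x. cnj (G x) * k x z) \<in> borel_measurable borel" by measurable
        show "norm (cnj (G x) * k x z) \<le> W * B" for x by (rule GkB)
        show "cnj (G x) * k x z = 0" if "x \<notin> {a..b}" for x using k0 that by simp
      qed
      show "norm (cnj (G x) * k x z) \<le> indicator {a..b} x * (W * B)" for x
        using GkB[of x z] k0[of x z] by (auto simp: indicator_def)
    qed
    finally show ?thesis .
  qed
  have V: "0 \<le> V" by (rule order_trans[OF norm_ge_zero Db])
  define I where "I = sqnorm G"
  define Df where "Df = sqnorm D"
  define Ff where "Ff = sqnorm F1"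
  have sq: "sqnorm g = ennreal (norm (LINT x|lborel. g x * cnj (g x)))"
    if "integrable lborel (\<lambda>x. g x * cnj (g x))" for g :: "real \<Rightarrow> complex"
  proof -
    have e: "g x * cnj (g x) = complex_of_real ((norm (g x))\<^sup>2)" for x
      by (simp add: complex_norm_square[symmetric])
    have i: "integrable lborel (\<lambda>x. (norm (g x))\<^sup>2)"
      using that unfolding e complex_of_real_integrable_eq .
    have "sqnorm g = (\<integral>\<^sup>+x. ennreal ((norm (g x))\<^sup>2) \<partial>lborel)"
      by (simp add: ennreal_power)
    also have "\<dots> = ennreal (LINT x|lborel. (norm (g x))\<^sup>2)"
      using i by (intro nn_integral_eq_integral) auto
    also have "(LINT x|lborel. (norm (g x))\<^sup>2) = norm (LINT x|lborel. g x * cnj (g x))"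
      unfolding e integral_complex_of_real by simp
    finally show ?thesis .
  qed
  have step1: "I\<^sup>2 \<le> Ff * Df"
  proof -
    have iG: "integrable lborel (\<lambda>x. G x * cnj (G x))"
    proof (rule integrable_bounded_support[where B = "W * W"])
      show "norm (G x * cnj (G x)) \<le> W * W" for x
        unfolding norm_mult complex_mod_cnj using W by (intro mult_mono Gb) auto
      show "G x * cnj (G x) = 0" if "x \<notin> {a..b}" for x using G0 that by simp
    qed measurable
    have pm: "(\<lambda>(x, z). cnj (G x) * (k x z * F1 z)) \<in> borel_measurable (lborel \<Otimes>\<^sub>M lborel)"
      using km unfolding case_prod_beta by measurable
    have pint: "integrable (lborel \<Otimes>\<^sub>M lborel) (\<lambda>(x, z). cnj (G x) * (k x z * F1 z))"
    proof (rule integrableI_bounded[OF pm])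
      have "(\<integral>\<^sup>+p. ennreal (norm (case p of (x, z) \<Rightarrow> cnj (G x) * (k x z * F1 z))) \<partial>(lborel \<Otimes>\<^sub>M lborel))
        = (\<integral>\<^sup>+x. \<integral>\<^sup>+z. ennreal (norm (cnj (G x) * (k x z * F1 z))) \<partial>lborel \<partial>lborel)"
        using pm by (subst lborel.nn_integral_fst[symmetric]) auto
      also have "\<dots> \<le> (\<integral>\<^sup>+x. \<integral>\<^sup>+z. ennreal (indicator {a..b} x * (W * B)) * ennreal (norm (F1 z)) \<partial>lborel \<partial>lborel)"
      proof (intro nn_integral_mono)
        fix x z
        have "norm (cnj (G x) * (k x z * F1 z)) \<le> indicator {a..b} x * (W * B) * norm (F1 z)"
        proof (cases "x \<in> {a..b}")
          case True
          have "norm (cnj (G x) * k x z) * norm (F1 z) \<le> (W * B) * norm (F1 z)"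
            by (intro mult_right_mono GkB) auto
          then show ?thesis using True by (simp add: norm_mult mult_ac)
        qed (use k0 in simp)
        then have "ennreal (norm (cnj (G x) * (k x z * F1 z))) \<le> ennreal (indicator {a..b} x * (W * B) * norm (F1 z))"
          by (rule ennreal_leI)
        also have "\<dots> = ennreal (indicator {a..b} x * (W * B)) * ennreal (norm (F1 z))"
          using W B by (intro ennreal_mult) auto
        finally show "ennreal (norm (cnj (G x) * (k x z * F1 z))) \<le> ennreal (indicator {a..b} x * (W * B)) * ennreal (norm (F1 z))" .
      qed
      also have "\<dots> = (\<integral>\<^sup>+x. ennreal (indicator {a..b} x * (W * B)) \<partial>lborel) * (\<integral>\<^sup>+z. ennreal (norm (F1 z)) \<partial>lborel)"
        by (simp add: nn_integral_cmult nn_integral_multc)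
      also have "\<dots> < \<infinity>"
      proof -
        have "(\<integral>\<^sup>+x. ennreal (indicator {a..b} x * (W * B)) \<partial>lborel) = ennreal V"
          unfolding V_def using W B by (intro nn_integral_eq_integral iab) auto
        then show ?thesis using F1i by (simp add: ennreal_mult_less_top)
      qed
      finally show "(\<integral>\<^sup>+p. ennreal (norm (case p of (x, z) \<Rightarrow> cnj (G x) * (k x z * F1 z))) \<partial>(lborel \<Otimes>\<^sub>M lborel)) < \<infinity>" .
    qed
    have "(LINT x|lborel. G x * cnj (G x)) = (LINT x|lborel. LINT z|lborel. cnj (G x) * (k x z * F1 z))"
      using kFint by (intro Bochner_Integration.integral_cong refl) (simp add: G_def mult.commute)
    also have "\<dots> = (LINT z|lborel. LINT x|lborel. cnj (G x) * (k x z * F1 z))"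
      by (rule lborel_pair.Fubini_integral[symmetric, OF pint])
    also have "\<dots> = (LINT z|lborel. F1 z * D z)"
    proof (intro Bochner_Integration.integral_cong refl)
      fix z
      have "(LINT x|lborel. cnj (G x) * (k x z * F1 z)) = (LINT x|lborel. F1 z * (cnj (G x) * k x z))"
        by (simp add: mult_ac)
      also have "\<dots> = F1 z * D z" unfolding D_def by simp
      finally show "(LINT x|lborel. cnj (G x) * (k x z * F1 z)) = F1 z * D z" .
    qed
    finally have "I \<le> (\<integral>\<^sup>+z. ennreal (norm (F1 z * D z)) \<partial>lborel)"
      unfolding I_def sq[OF iG] by (simp only: norm_lebesgue_integral_le_nn)
    also have "\<dots> = (\<integral>\<^sup>+z. ennreal (norm (F1 z)) * ennreal (norm (D z)) \<partial>lborel)"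
      by (simp add: norm_mult ennreal_mult)
    finally have "I\<^sup>2 \<le> (\<integral>\<^sup>+z. ennreal (norm (F1 z)) * ennreal (norm (D z)) \<partial>lborel)\<^sup>2"
      by (intro power_mono) auto
    also have "\<dots> \<le> Ff * Df" unfolding Ff_def Df_def by (rule Cauchy_Schwarz_nn_integral) measurable
    finally show ?thesis .
  qed
  have step2: "Df \<le> ennreal q * I"
  proof -
    have iD: "integrable lborel (\<lambda>x. D x * cnj (D x))"
    proof (rule integrable_bounded_support[where B = "V * V"])
      show "norm (D x * cnj (D x)) \<le> V * V" for x
        unfolding norm_mult complex_mod_cnj using V by (intro mult_mono Db) auto
      show "D x * cnj (D x) = 0" if "x \<notin> {c..d}" for x using D0 that by simp
    qed measurable
    have pint: "integrable (lborel \<Otimes>\<^sub>M lborel) (\<lambda>(x, z). cnj (G x) * k x z * cnj (D z))"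
    proof (rule integrable_bounded_box[where B = "(W * B) * V"])
      show "(\<lambda>(x, z). cnj (G x) * k x z * cnj (D z)) \<in> borel_measurable (lborel \<Otimes>\<^sub>M lborel)"
        using km unfolding case_prod_beta by measurable
      show "norm (case p of (x, z) \<Rightarrow> cnj (G x) * k x z * cnj (D z)) \<le> (W * B) * V" for p
        unfolding case_prod_beta norm_mult[of _ "cnj (D (snd p))"] complex_mod_cnj using W B V
        by (intro mult_mono GkB Db) auto
      show "(case (x, y) of (x, z) \<Rightarrow> cnj (G x) * k x z * cnj (D z)) = 0"
        if "x \<notin> {a..b} \<or> y \<notin> {c..d}" for x y using k0[OF that] by simp
    qed
    have inner: "(LINT z|lborel. k x z * cnj (D z)) = (LINT y|lborel. G y * (LINT z|lborel. k x z * cnj (k y z)))" for x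
    proof -
      have qint: "integrable (lborel \<Otimes>\<^sub>M lborel) (\<lambda>(y, z). G y * (k x z * cnj (k y z)))"
      proof (rule integrable_bounded_box[where B = "W * (B * B)"])
        show "(\<lambda>(y, z). G y * (k x z * cnj (k y z))) \<in> borel_measurable (lborel \<Otimes>\<^sub>M lborel)"
          using km unfolding case_prod_beta by measurable
        show "norm (case p of (y, z) \<Rightarrow> G y * (k x z * cnj (k y z))) \<le> W * (B * B)" for p
          unfolding case_prod_beta norm_mult complex_mod_cnj using W B
          by (intro mult_mono Gb kb) auto
        show "(case (y, z) of (y, z) \<Rightarrow> G y * (k x z * cnj (k y z))) = 0"
          if "y \<notin> {a..b} \<or> z \<notin> {c..d}" for y z using k0[OF that] by simp
      qed
      have "(LINT z|lborel. k x z * cnj (D z)) = (LINT z|lborel. LINT y|lborel. G y * (k x z * cnj (k y z)))"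
      proof (intro Bochner_Integration.integral_cong refl)
        fix z
        have "cnj (D z) = (LINT y|lborel. cnj (cnj (G y) * k y z))"
          unfolding D_def by (rule Bochner_Integration.integral_cnj[symmetric])
        also have "\<dots> = (LINT y|lborel. G y * cnj (k y z))" by simp
        finally have "k x z * cnj (D z) = (LINT y|lborel. k x z * (G y * cnj (k y z)))" by simp
        then show "k x z * cnj (D z) = (LINT y|lborel. G y * (k x z * cnj (k y z)))" by (simp add: mult_ac)
      qed
      also have "\<dots> = (LINT y|lborel. LINT z|lborel. G y * (k x z * cnj (k y z)))"
        by (rule lborel_pair.Fubini_integral[OF qint])
      also have "\<dots> = (LINT y|lborel. G y * (LINT z|lborel. k x z * cnj (k y z)))" by simp
      finally show ?thesis .
    qed
    have "(LINT z|lborel. D z * cnj (D z)) = (LINT z|lborel. LINT x|lborel. cnj (G x) * k x z * cnj (D z))"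
      by (intro Bochner_Integration.integral_cong refl) (simp add: D_def)
    also have "\<dots> = (LINT x|lborel. LINT z|lborel. cnj (G x) * k x z * cnj (D z))"
      by (rule lborel_pair.Fubini_integral[OF pint])
    also have "\<dots> = (LINT x|lborel. cnj (G x) * (LINT y|lborel. G y * (LINT z|lborel. k x z * cnj (k y z))))"
      by (simp add: mult.assoc inner)
    finally have "Df \<le> (\<integral>\<^sup>+x. ennreal (norm (cnj (G x) * (LINT y|lborel. G y * (LINT z|lborel. k x z * cnj (k y z))))) \<partial>lborel)"
      unfolding Df_def sq[OF iD] by (simp only: norm_lebesgue_integral_le_nn)
    also have "\<dots> \<le> (\<integral>\<^sup>+x. ennreal (norm (G x)) * (\<integral>\<^sup>+y. ennreal (norm (G y)) * ennreal (norm (LINT z|lborel. k x z * cnj (k y z))) \<partial>lborel) \<partial>lborel)"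
    proof (rule nn_integral_mono)
      fix x
      have "ennreal (norm (cnj (G x) * (LINT y|lborel. G y * (LINT z|lborel. k x z * cnj (k y z)))))
        = ennreal (norm (G x)) * ennreal (norm (LINT y|lborel. G y * (LINT z|lborel. k x z * cnj (k y z))))"
        by (simp add: norm_mult ennreal_mult)
      also have "\<dots> \<le> ennreal (norm (G x)) * (\<integral>\<^sup>+y. ennreal (norm (G y * (LINT z|lborel. k x z * cnj (k y z)))) \<partial>lborel)"
        by (intro mult_left_mono norm_lebesgue_integral_le_nn) auto
      finally show "ennreal (norm (cnj (G x) * (LINT y|lborel. G y * (LINT z|lborel. k x z * cnj (k y z)))))
        \<le> ennreal (norm (G x)) * (\<integral>\<^sup>+y. ennreal (norm (G y)) * ennreal (norm (LINT z|lborel. k x z * cnj (k y z))) \<partial>lborel)"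
        by (simp add: norm_mult ennreal_mult)
    qed
    also have "\<dots> \<le> ennreal q * I" unfolding I_def by (rule key[OF Gm])
    finally show ?thesis .
  qed
  have Ifin: "I < \<infinity>"
  proof -
    have "I \<le> (\<integral>\<^sup>+x. ennreal (W\<^sup>2) * indicator {a..b} x \<partial>lborel)" unfolding I_def
    proof (rule nn_integral_mono)
      fix x
      have "(norm (G x))\<^sup>2 \<le> W\<^sup>2" using Gb by (intro power_mono) auto
      then show "(ennreal (norm (G x)))\<^sup>2 \<le> ennreal (W\<^sup>2) * indicator {a..b} x"
        using G0[of x] by (auto simp: indicator_def ennreal_power intro!: ennreal_leI)
    qed
    also have "\<dots> < \<infinity>" by (cases "a \<le> b") (auto simp: nn_integral_cmult ennreal_mult_less_top)
    finally show ?thesis .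
  qed
  have "I \<le> ennreal q * Ff"
  proof (cases "I = 0")
    case False
    have "I * I \<le> Ff * (ennreal q * I)"
      using step1 mult_left_mono[OF step2, of Ff] by (simp add: power2_eq_square)
    then have "I * I \<le> I * (ennreal q * Ff)" by (simp add: mult_ac)
    then show ?thesis using False Ifin ennreal_mult_le_mult_iff by (metis infinity_ennreal_def less_irrefl)
  qed simp
  also have "\<dots> \<le> ennreal q * sqnorm F"
    unfolding Ff_def by (intro mult_left_mono F1le) auto
  finally show ?thesis by (simp only: I_def G_def kF)
qed

section \<open>The linearised maximal operator\<close>

lemma ennreal_power2_le_imp_le:
  fixes x y :: ennreal
  assumes "x\<^sup>2 \<le> y\<^sup>2"
  shows "x \<le> y"
proof (cases y rule: ennreal_cases)
  case (real r)
  show ?thesis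
  proof (cases x rule: ennreal_cases)
    case (real s)
    have "s\<^sup>2 \<le> r\<^sup>2" using assms unfolding real \<open>y = ennreal r\<close>
      using \<open>0 \<le> r\<close> \<open>0 \<le> s\<close> by (simp add: ennreal_power)
    then show ?thesis using \<open>0 \<le> r\<close> \<open>0 \<le> s\<close> real \<open>y = ennreal r\<close> by (auto intro!: ennreal_leI power2_le_imp_le)
  next
    case top
    then show ?thesis using assms real by (simp add: ennreal_power power2_eq_square ennreal_mult_eq_top_iff ennreal_top_mult top_unique)
  qed
qed simp

lemma incseq_SUP_power2:
  fixes f :: "nat \<Rightarrow> ennreal"
  assumes "incseq f"
  shows "(SUP i. f i)\<^sup>2 = (SUP i. (f i)\<^sup>2)"
proof (rule antisym)
  have "(SUP i. f i)\<^sup>2 = (SUP i. f i * (SUP j. f j))" by (simp add: power2_eq_square SUP_mult_right_ennreal)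
  also have "\<dots> = (SUP i. SUP j. f i * f j)" by (simp add: SUP_mult_left_ennreal)
  also have "\<dots> \<le> (SUP i. (f i)\<^sup>2)"
  proof (intro SUP_least)
    fix i j
    have "f i * f j \<le> f (max i j) * f (max i j)" by (intro mult_mono incseqD[OF assms]) auto
    also have "\<dots> \<le> (SUP i. (f i)\<^sup>2)" by (intro SUP_upper2[of "max i j"]) (auto simp: power2_eq_square)
    finally show "f i * f j \<le> (SUP i. (f i)\<^sup>2)" .
  qed
  finally show "(SUP i. f i)\<^sup>2 \<le> (SUP i. (f i)\<^sup>2)" .
  show "(SUP i. (f i)\<^sup>2) \<le> (SUP i. f i)\<^sup>2" by (intro SUP_least power_mono SUP_upper) auto
qed

text \<open>Hoelder's inequality for the functions \<open>e ^ 3\<close> and \<open>h\<close> with the exponents \<open>4/3\<close> and \<open>4\<close>, by two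
applications of the Cauchy--Schwarz inequality.\<close>

lemma nn_integral_Holder4:
  fixes e h :: "real \<Rightarrow> real"
  assumes [measurable]: "e \<in> borel_measurable borel" "h \<in> borel_measurable borel" "S \<in> sets borel"
    and nn: "\<And>y. 0 \<le> e y" "\<And>y. 0 \<le> h y" and S: "\<And>y. y \<notin> S \<Longrightarrow> h y = 0"
  shows "(\<integral>\<^sup>+y. ennreal (e y ^ 3) * ennreal (h y) \<partial>lborel) ^ 4
    \<le> (\<integral>\<^sup>+y. ennreal (e y ^ 4) * indicator S y \<partial>lborel) ^ 3 * (\<integral>\<^sup>+y. ennreal (h y ^ 4) \<partial>lborel)"
proof -
  let ?A = "\<integral>\<^sup>+y. ennreal (e y ^ 4) * indicator S y \<partial>lborel"
  have "(\<integral>\<^sup>+y. ennreal (e y ^ 3) * ennreal (h y) \<partial>lborel)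
    = (\<integral>\<^sup>+y. (ennreal (e y ^ 2) * indicator S y) * ennreal (e y * h y) \<partial>lborel)"
  proof (rule nn_integral_cong)
    fix y
    show "ennreal (e y ^ 3) * ennreal (h y) = (ennreal (e y ^ 2) * indicator S y) * ennreal (e y * h y)"
      using nn S[of y] by (cases "y \<in> S") (simp_all add: ennreal_mult[symmetric] power2_eq_square power3_eq_cube mult_ac)
  qed
  then have "(\<integral>\<^sup>+y. ennreal (e y ^ 3) * ennreal (h y) \<partial>lborel)\<^sup>2
    \<le> (\<integral>\<^sup>+y. (ennreal (e y ^ 2) * indicator S y)\<^sup>2 \<partial>lborel) * (\<integral>\<^sup>+y. (ennreal (e y * h y))\<^sup>2 \<partial>lborel)"
    by (simp only:) (rule Cauchy_Schwarz_nn_integral; measurable)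
  also have "(\<integral>\<^sup>+y. (ennreal (e y ^ 2) * indicator S y)\<^sup>2 \<partial>lborel) = ?A"
    by (intro nn_integral_cong) (auto simp: indicator_def ennreal_power power_mult[symmetric])
  finally have 1: "(\<integral>\<^sup>+y. ennreal (e y ^ 3) * ennreal (h y) \<partial>lborel)\<^sup>2 \<le> ?A * (\<integral>\<^sup>+y. (ennreal (e y * h y))\<^sup>2 \<partial>lborel)" .
  have "(\<integral>\<^sup>+y. (ennreal (e y * h y))\<^sup>2 \<partial>lborel) = (\<integral>\<^sup>+y. (ennreal (e y ^ 2) * indicator S y) * ennreal (h y ^ 2) \<partial>lborel)"
  proof (rule nn_integral_cong)
    fix y
    show "(ennreal (e y * h y))\<^sup>2 = (ennreal (e y ^ 2) * indicator S y) * ennreal (h y ^ 2)"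
      using nn S[of y] by (cases "y \<in> S") (simp_all add: ennreal_mult[symmetric] ennreal_power power_mult_distrib)
  qed
  then have "(\<integral>\<^sup>+y. (ennreal (e y * h y))\<^sup>2 \<partial>lborel)\<^sup>2
    \<le> (\<integral>\<^sup>+y. (ennreal (e y ^ 2) * indicator S y)\<^sup>2 \<partial>lborel) * (\<integral>\<^sup>+y. (ennreal (h y ^ 2))\<^sup>2 \<partial>lborel)"
    by (simp only:) (rule Cauchy_Schwarz_nn_integral; measurable)
  also have "(\<integral>\<^sup>+y. (ennreal (e y ^ 2) * indicator S y)\<^sup>2 \<partial>lborel) = ?A"
    by (intro nn_integral_cong) (auto simp: indicator_def ennreal_power power_mult[symmetric])
  also have "(\<integral>\<^sup>+y. (ennreal (h y ^ 2))\<^sup>2 \<partial>lborel) = (\<integral>\<^sup>+y. ennreal (h y ^ 4) \<partial>lborel)"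
    by (intro nn_integral_cong) (auto simp: ennreal_power power_mult[symmetric])
  finally have 2: "(\<integral>\<^sup>+y. (ennreal (e y * h y))\<^sup>2 \<partial>lborel)\<^sup>2 \<le> ?A * (\<integral>\<^sup>+y. ennreal (h y ^ 4) \<partial>lborel)" .
  have "(\<integral>\<^sup>+y. ennreal (e y ^ 3) * ennreal (h y) \<partial>lborel) ^ 4
    = ((\<integral>\<^sup>+y. ennreal (e y ^ 3) * ennreal (h y) \<partial>lborel)\<^sup>2)\<^sup>2" by (simp add: power_mult[symmetric])
  also have "\<dots> \<le> (?A * (\<integral>\<^sup>+y. (ennreal (e y * h y))\<^sup>2 \<partial>lborel))\<^sup>2" by (intro power_mono 1) auto
  also have "\<dots> = ?A\<^sup>2 * (\<integral>\<^sup>+y. (ennreal (e y * h y))\<^sup>2 \<partial>lborel)\<^sup>2" by (rule power_mult_distrib)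
  also have "\<dots> \<le> ?A\<^sup>2 * (?A * (\<integral>\<^sup>+y. ennreal (h y ^ 4) \<partial>lborel))" by (intro mult_left_mono 2) auto
  also have "\<dots> = ?A ^ 3 * (\<integral>\<^sup>+y. ennreal (h y ^ 4) \<partial>lborel)" by (simp add: power2_eq_square power3_eq_cube mult_ac)
  finally show ?thesis .
qed

lemma measurable_selection_fst:
  fixes f :: "nat \<Rightarrow> real \<times> real \<Rightarrow> 'a :: topological_space"
  assumes f: "\<And>i. f i \<in> borel_measurable (lborel \<Otimes>\<^sub>M lborel)"
    and \<iota>: "\<iota> \<in> measurable borel (count_space UNIV)"
  shows "(\<lambda>p. f (\<iota> (fst p)) p) \<in> borel_measurable (lborel \<Otimes>\<^sub>M lborel)"
proof (rule measurable_compose_countable[OF f])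
  show "(\<lambda>p. \<iota> (fst p)) \<in> lborel \<Otimes>\<^sub>M lborel \<rightarrow>\<^sub>M count_space UNIV"
    using measurable_compose[OF measurable_fst, of \<iota> lborel "count_space UNIV" lborel] \<iota> by simp
qed

lemma measurable_selected_kernel:
  fixes H :: "nat \<Rightarrow> real \<Rightarrow> real"
  assumes H: "\<And>i. H i \<in> borel_measurable borel" and \<iota>: "\<iota> \<in> measurable borel (count_space UNIV)"
  shows "(\<lambda>(x, y). H (\<iota> x) ((x - y) / a (\<iota> x)) / a (\<iota> x)) \<in> borel_measurable (lborel \<Otimes>\<^sub>M lborel)"
proof -
  have "(\<lambda>p. H i ((fst p - snd p) / a i) / a i) \<in> borel_measurable (lborel \<Otimes>\<^sub>M lborel)" for i
  proof -
    have "(\<lambda>p. (fst p - snd p) / a i) \<in> borel_measurable (lborel \<Otimes>\<^sub>M lborel)" by measurable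
    from measurable_compose[OF this H] show ?thesis by measurable
  qed
  from measurable_selection_fst[OF this \<iota>] show ?thesis by (simp add: case_prod_beta)
qed

text \<open>The exponent \<open>4/3\<close> is applied to \<open>g = e ^ 3\<close>. By Hoelder's inequality the inner integral is at most a
constant times \<open>\<delta> * m powr (3/2)\<close>, where \<open>m\<^sup>2\<close> is the integral of \<open>e ^ 4\<close> over the ball of radius
\<open>2 * a (\<iota> x)\<close> about \<open>x\<close>, divided by this radius; the ball contains the support of the kernel, and its radius takes only finitely many
values.\<close>

lemma maximal_bilinear:
  fixes a :: "nat \<Rightarrow> real" and H :: "nat \<Rightarrow> real \<Rightarrow> real" and \<iota> :: "real \<Rightarrow> nat" and g :: "real \<Rightarrow> real"
  assumes a: "\<And>i. 0 < a i" and Hm: "\<And>i. H i \<in> borel_measurable borel" and H0: "\<And>i w. 0 \<le> H i w"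
    and Hz: "\<And>i w. w \<notin> {-1..2} \<Longrightarrow> H i w = 0"
    and H4: "\<And>i. (\<integral>\<^sup>+w. ennreal (H i w ^ 4) \<partial>lborel) \<le> ennreal (\<delta> ^ 4)" and \<delta>: "0 < \<delta>"
    and \<iota>: "\<iota> \<in> measurable borel (count_space UNIV)" "\<And>x. \<iota> x \<le> N"
    and g [measurable]: "g \<in> borel_measurable borel" and g0: "\<And>y. 0 \<le> g y"
  shows "(\<integral>\<^sup>+x. ennreal (g x) * (\<integral>\<^sup>+y. ennreal (g y) * ennreal (H (\<iota> x) ((x - y) / a (\<iota> x)) / a (\<iota> x)) \<partial>lborel) \<partial>lborel)
     \<le> ennreal (20 * \<delta>) * (\<integral>\<^sup>+x. (ennreal (g x))\<^sup>2 \<partial>lborel)"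
proof (cases "(\<integral>\<^sup>+x. (ennreal (g x))\<^sup>2 \<partial>lborel) = \<infinity>")
  case True
  then show ?thesis using \<delta> by (simp add: ennreal_mult_top)
next
  case False
  define e where "e = (\<lambda>y. root 3 (g y))"
  have em [measurable]: "e \<in> borel_measurable borel" unfolding e_def by measurable
  have e0: "0 \<le> e y" for y using g0 by (simp add: e_def)
  have e3: "e y ^ 3 = g y" for y using g0 by (simp add: e_def)
  have e6: "ennreal (e y ^ 6) = (ennreal (g y))\<^sup>2" for y
  proof -
    have "e y ^ 6 = (e y ^ 3)\<^sup>2" by (simp add: power_mult[symmetric])
    then show ?thesis using e3 g0 by (simp add: ennreal_power)
  qed
  have am [measurable]: "(\<lambda>x. a (\<iota> x)) \<in> borel_measurable borel"
    using measurable_compose[OF \<iota>(1), of a borel] by simp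
  define h where "h = (\<lambda>x y. H (\<iota> x) ((x - y) / a (\<iota> x)) / a (\<iota> x))"
  have hm: "(\<lambda>(x, y). h x y) \<in> borel_measurable (lborel \<Otimes>\<^sub>M lborel)"
    unfolding h_def by (rule measurable_selected_kernel[OF Hm \<iota>(1)])
  define Av where "Av = (\<lambda>x. \<integral>\<^sup>+y. ennreal (e y ^ 4) * indicator (cball x (2 * a (\<iota> x))) y \<partial>lborel)"
  have Avm [measurable]: "Av \<in> borel_measurable borel"
  proof -
    have "(\<lambda>(x, y). if \<bar>x - y\<bar> \<le> 2 * a (\<iota> x) then ennreal (e y ^ 4) else 0) \<in> borel_measurable (lborel \<Otimes>\<^sub>M lborel)"
      unfolding case_prod_beta by measurable
    then have "(\<lambda>x. \<integral>\<^sup>+y. (if \<bar>x - y\<bar> \<le> 2 * a (\<iota> x) then ennreal (e y ^ 4) else 0) \<partial>lborel) \<in> borel_measurable lborel"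
      by (rule lborel.borel_measurable_nn_integral)
    moreover have "Av = (\<lambda>x. \<integral>\<^sup>+y. (if \<bar>x - y\<bar> \<le> 2 * a (\<iota> x) then ennreal (e y ^ 4) else 0) \<partial>lborel)"
      unfolding Av_def by (intro ext nn_integral_cong) (auto simp: indicator_def dist_real_def)
    ultimately have "Av \<in> borel_measurable lborel" by (simp only:)
    then show ?thesis by simp
  qed
  have Avfin: "Av x < \<infinity>" for x
  proof -
    have "Av x \<le> (\<integral>\<^sup>+y. indicator {x - 2 * a (\<iota> x)..x + 2 * a (\<iota> x)} y + (ennreal (g y))\<^sup>2 \<partial>lborel)"
      unfolding Av_def
    proof (rule nn_integral_mono)
      fix y
      have "e y ^ 4 \<le> 1 + e y ^ 6"
      proof (cases "e y \<le> 1")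
        case True
        then have "e y ^ 4 \<le> 1" using e0 by (simp add: power_le_one)
        then show ?thesis by (simp add: add_increasing2)
      next
        case False
        then have "e y ^ 4 \<le> e y ^ 6" by (intro power_increasing) auto
        then show ?thesis by simp
      qed
      then have "ennreal (e y ^ 4) \<le> 1 + (ennreal (g y))\<^sup>2"
        unfolding e6[symmetric] using e0 by (simp add: ennreal_plus[symmetric] ennreal_1[symmetric] ennreal_leI del: ennreal_plus ennreal_1)
      then show "ennreal (e y ^ 4) * indicator (cball x (2 * a (\<iota> x))) y
         \<le> indicator {x - 2 * a (\<iota> x)..x + 2 * a (\<iota> x)} y + (ennreal (g y))\<^sup>2"
        by (auto simp: indicator_def dist_real_def)
    qed
    also have "\<dots> = emeasure lborel {x - 2 * a (\<iota> x)..x + 2 * a (\<iota> x)} + (\<integral>\<^sup>+y. (ennreal (g y))\<^sup>2 \<partial>lborel)"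
      by (subst nn_integral_add) auto
    also have "\<dots> < \<infinity>" using False a[of "\<iota> x"] by (simp add: less_top)
    finally show ?thesis .
  qed
  define m where "m = (\<lambda>x. sqrt (enn2real (Av x) / (2 * a (\<iota> x))))"
  have mm [measurable]: "m \<in> borel_measurable borel" unfolding m_def by measurable
  have m0: "0 \<le> m x" for x using a[of "\<iota> x"] by (simp add: m_def)
  have mAv: "Av x = ennreal ((m x)\<^sup>2 * (2 * a (\<iota> x)))" for x
    using a[of "\<iota> x"] Avfin[of x] by (simp add: m_def less_top)
  have strong: "(\<integral>\<^sup>+x. ennreal (m x ^ 3) \<partial>lborel) \<le> 120 * (\<integral>\<^sup>+x. ennreal (e x ^ 6) \<partial>lborel)"
  proof (rule strong_type_maximal[where R = "(\<lambda>i. 2 * a i) ` {..N}"])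
    fix x
    show "\<exists>\<rho>\<in>(\<lambda>i. 2 * a i) ` {..N}. ennreal ((m x)\<^sup>2 * \<rho>) \<le> (\<integral>\<^sup>+y. ennreal (e y ^ 4) * indicator (cball x \<rho>) y \<partial>lborel)"
      using \<iota>(2)[of x] mAv[of x] unfolding Av_def by (intro bexI[of _ "2 * a (\<iota> x)"]) auto
  qed (use a e0 m0 in auto)
  define inn where "inn = (\<lambda>x. \<integral>\<^sup>+y. ennreal (g y) * ennreal (h x y) \<partial>lborel)"
  have innm [measurable]: "inn \<in> borel_measurable borel"
  proof -
    have "(\<lambda>(x, y). ennreal (g y) * ennreal (h x y)) \<in> borel_measurable (lborel \<Otimes>\<^sub>M lborel)"
      using hm unfolding case_prod_beta by measurable
    then have "inn \<in> borel_measurable lborel" unfolding inn_def by (rule lborel.borel_measurable_nn_integral)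
    then show ?thesis by simp
  qed
  have inn2: "(inn x)\<^sup>2 \<le> ennreal (3 * \<delta>\<^sup>2 * m x ^ 3)" for x
  proof (rule ennreal_power2_le_imp_le)
    let ?a = "a (\<iota> x)"
    have apos: "0 < ?a" by (rule a)
    have hx [measurable]: "h x \<in> borel_measurable borel"
      using measurable_compose[OF measurable_Pair1' hm, of x] by simp
    have h4: "(\<integral>\<^sup>+y. ennreal (h x y ^ 4) \<partial>lborel) \<le> ennreal (\<delta> ^ 4 / ?a ^ 3)"
    proof -
      have [measurable]: "H (\<iota> x) \<in> borel_measurable borel" by (rule Hm)
      have "(\<integral>\<^sup>+y. ennreal (h x y ^ 4) \<partial>lborel) = ennreal \<bar>- ?a\<bar> * (\<integral>\<^sup>+w. ennreal (h x (x + (- ?a) * w) ^ 4) \<partial>lborel)"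
        using apos by (intro nn_integral_real_affine) auto
      also have "\<dots> = ennreal ?a * (\<integral>\<^sup>+w. ennreal (1 / ?a ^ 4) * ennreal (H (\<iota> x) w ^ 4) \<partial>lborel)"
      proof -
        have "h x (x + (- ?a) * w) ^ 4 = (1 / ?a ^ 4) * H (\<iota> x) w ^ 4" for w
          using apos by (simp add: h_def power_divide)
        then have "ennreal (h x (x + (- ?a) * w) ^ 4) = ennreal (1 / ?a ^ 4) * ennreal (H (\<iota> x) w ^ 4)" for w
          using apos H0 by (simp only:) (intro ennreal_mult; simp)
        then show ?thesis using apos by (simp only: abs_minus_cancel abs_of_pos)
      qed
      also have "\<dots> = ennreal ?a * (ennreal (1 / ?a ^ 4) * (\<integral>\<^sup>+w. ennreal (H (\<iota> x) w ^ 4) \<partial>lborel))"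
        by (subst nn_integral_cmult) auto
      also have "\<dots> \<le> ennreal ?a * (ennreal (1 / ?a ^ 4) * ennreal (\<delta> ^ 4))"
        by (intro mult_left_mono H4) auto
      also have "\<dots> = ennreal (?a * (1 / ?a ^ 4 * \<delta> ^ 4))"
        using apos \<delta> by (simp add: ennreal_mult[symmetric])
      also have "?a * (1 / ?a ^ 4 * \<delta> ^ 4) = \<delta> ^ 4 / ?a ^ 3"
        using apos by (simp add: power3_eq_cube power4_eq_xxxx)
      finally show ?thesis .
    qed
    have "((inn x)\<^sup>2)\<^sup>2 = inn x ^ 4" by (simp add: power_mult[symmetric])
    also have "\<dots> \<le> Av x ^ 3 * (\<integral>\<^sup>+y. ennreal (h x y ^ 4) \<partial>lborel)"
      unfolding inn_def Av_def e3[symmetric]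
    proof (rule nn_integral_Holder4)
      show "0 \<le> h x y" for y using H0 apos by (simp add: h_def)
      show "h x y = 0" if "y \<notin> cball x (2 * ?a)" for y
      proof -
        have "(x - y) / ?a \<notin> {-1..2}"
        proof
          assume "(x - y) / ?a \<in> {-1..2}"
          then have "- ?a \<le> x - y" "x - y \<le> 2 * ?a" using apos by (auto simp: field_simps)
          then have "\<bar>x - y\<bar> \<le> 2 * ?a" using apos by linarith
          then show False using that by (simp add: dist_real_def)
        qed
        then show ?thesis using Hz by (simp add: h_def)
      qed
    qed (use e0 in auto)
    also have "\<dots> \<le> Av x ^ 3 * ennreal (\<delta> ^ 4 / ?a ^ 3)" by (intro mult_left_mono h4) auto
    also have "\<dots> = ennreal (((m x)\<^sup>2 * (2 * ?a)) ^ 3 * (\<delta> ^ 4 / ?a ^ 3))"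
    proof -
      have p: "0 \<le> (m x)\<^sup>2 * (2 * ?a)" using apos by simp
      show ?thesis unfolding mAv ennreal_power[OF p] using apos by (intro ennreal_mult[symmetric]) auto
    qed
    also have "((m x)\<^sup>2 * (2 * ?a)) ^ 3 * (\<delta> ^ 4 / ?a ^ 3) = 8 * (\<delta>\<^sup>2 * m x ^ 3)\<^sup>2"
      using apos by (simp add: power_mult_distrib power_mult[symmetric])
    also have "ennreal (8 * (\<delta>\<^sup>2 * m x ^ 3)\<^sup>2) \<le> ennreal ((3 * \<delta>\<^sup>2 * m x ^ 3)\<^sup>2)"
      by (intro ennreal_leI) (simp add: power_mult_distrib)
    also have "\<dots> = (ennreal (3 * \<delta>\<^sup>2 * m x ^ 3))\<^sup>2"
      using \<delta> m0[of x] by (intro ennreal_power[symmetric]) simp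
    finally show "((inn x)\<^sup>2)\<^sup>2 \<le> (ennreal (3 * \<delta>\<^sup>2 * m x ^ 3))\<^sup>2" .
  qed
  let ?I = "\<integral>\<^sup>+x. (ennreal (g x))\<^sup>2 \<partial>lborel"
  have "(\<integral>\<^sup>+x. ennreal (g x) * inn x \<partial>lborel)\<^sup>2 \<le> ?I * (\<integral>\<^sup>+x. (inn x)\<^sup>2 \<partial>lborel)"
    by (rule Cauchy_Schwarz_nn_integral) measurable
  also have "\<dots> \<le> ?I * (ennreal (400 * \<delta>\<^sup>2) * ?I)"
  proof (intro mult_left_mono)
    have "(\<integral>\<^sup>+x. (inn x)\<^sup>2 \<partial>lborel) \<le> (\<integral>\<^sup>+x. ennreal (3 * \<delta>\<^sup>2) * ennreal (m x ^ 3) \<partial>lborel)"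
      using inn2 m0 by (intro nn_integral_mono) (simp add: ennreal_mult[symmetric])
    also have "\<dots> = ennreal (3 * \<delta>\<^sup>2) * (\<integral>\<^sup>+x. ennreal (m x ^ 3) \<partial>lborel)" by (rule nn_integral_cmult) measurable
    also have "\<dots> \<le> ennreal (3 * \<delta>\<^sup>2) * (120 * ?I)" using strong unfolding e6 by (intro mult_left_mono) auto
    also have "\<dots> = (ennreal (3 * \<delta>\<^sup>2) * ennreal 120) * ?I" by (simp add: mult_ac)
    also have "ennreal (3 * \<delta>\<^sup>2) * ennreal 120 = ennreal (360 * \<delta>\<^sup>2)" by (subst ennreal_mult[symmetric]) auto
    also have "ennreal (360 * \<delta>\<^sup>2) * ?I \<le> ennreal (400 * \<delta>\<^sup>2) * ?I" by (intro mult_right_mono ennreal_leI) auto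
    finally show "(\<integral>\<^sup>+x. (inn x)\<^sup>2 \<partial>lborel) \<le> ennreal (400 * \<delta>\<^sup>2) * ?I" .
  qed simp
  also have "\<dots> = (ennreal (20 * \<delta>) * ?I)\<^sup>2"
  proof -
    have "(ennreal (20 * \<delta>))\<^sup>2 = ennreal (400 * \<delta>\<^sup>2)" using \<delta> by (simp add: ennreal_power power_mult_distrib)
    then show ?thesis unfolding power_mult_distrib by (simp add: mult_ac power2_eq_square[of "integral\<^sup>N _ _"])
  qed
  finally have "(\<integral>\<^sup>+x. ennreal (g x) * inn x \<partial>lborel) \<le> ennreal (20 * \<delta>) * ?I"
    by (rule ennreal_power2_le_imp_le)
  then show ?thesis by (simp only: inn_def h_def)
qed

text \<open>For the finitely many indices up to \<open>N\<close>, and for \<open>x\<close> in a bounded interval, \<open>\<iota> x\<close> is the first index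
at which the maximum is attained. The bound for the kernel of \<open>TT*\<close> is available when the first of the two points
has the larger dilation. In the other case the two points change places, so the kernel is bounded by
\<open>h x y + h y x\<close>, and both terms give the same integral.\<close>

lemma maximal_sequence:
  fixes a :: "nat \<Rightarrow> real" and H :: "nat \<Rightarrow> real \<Rightarrow> real" and \<phi> :: "nat \<Rightarrow> real \<Rightarrow> complex" and F :: "real \<Rightarrow> complex"
  assumes a: "\<And>i. 0 < a i" and Hm: "\<And>i. H i \<in> borel_measurable borel" and H0: "\<And>i w. 0 \<le> H i w"
    and Hz: "\<And>i w. w \<notin> {-1..2} \<Longrightarrow> H i w = 0"
    and H4: "\<And>i. (\<integral>\<^sup>+w. ennreal (H i w ^ 4) \<partial>lborel) \<le> ennreal (\<delta> ^ 4)" and \<delta>: "0 < \<delta>"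
    and \<phi>m: "\<And>i. \<phi> i \<in> borel_measurable borel" and \<phi>b: "\<And>i t. norm (\<phi> i t) \<le> B i"
    and \<phi>z: "\<And>i t. t \<notin> {0..R i} \<Longrightarrow> \<phi> i t = 0"
    and kern: "\<And>i j x y. a j \<le> a i \<Longrightarrow> norm (LINT z|lborel. \<phi> i (x - z) * cnj (\<phi> j (y - z))) \<le> H i ((x - y) / a i) / a i"
    and Fm [measurable]: "F \<in> borel_measurable borel" and F2: "sqnorm F < \<infinity>"
  shows "(\<integral>\<^sup>+x. (SUP i. ennreal (norm (LINT z|lborel. \<phi> i (x - z) * F z)))\<^sup>2 \<partial>lborel)
      \<le> ennreal (40 * \<delta>) * sqnorm F"
proof -
  define c where "c = (\<lambda>i x. norm (LINT z|lborel. \<phi> i (x - z) * F z))"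
  have pm: "(\<lambda>(x, z). \<phi> i (x - z)) \<in> borel_measurable (lborel \<Otimes>\<^sub>M lborel)" for i
  proof -
    have "(\<lambda>p. fst p - snd p :: real) \<in> borel_measurable (lborel \<Otimes>\<^sub>M lborel)" by measurable
    from measurable_compose[OF this \<phi>m] show ?thesis by (simp add: case_prod_beta)
  qed
  have cm [measurable]: "c i \<in> borel_measurable borel" for i
  proof -
    have "(\<lambda>(x, z). \<phi> i (x - z) * F z) \<in> borel_measurable (lborel \<Otimes>\<^sub>M lborel)"
      using pm[of i] unfolding case_prod_beta by measurable
    then have "(\<lambda>x. LINT z|lborel. \<phi> i (x - z) * F z) \<in> borel_measurable lborel"
      by (rule lborel.borel_measurable_lebesgue_integral)
    then show ?thesis unfolding c_def by simp
  qed
  let ?F = "\<integral>\<^sup>+z. (ennreal (norm (F z)))\<^sup>2 \<partial>lborel"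
  define g where "g = (\<lambda>N x. if \<bar>x\<bar> \<le> real N then (SUP i\<in>{..N}. ennreal (c i x)) else 0)"
  have fin: "(\<integral>\<^sup>+x. (g N x)\<^sup>2 \<partial>lborel) \<le> ennreal (40 * \<delta>) * ?F" for N
  proof -
    define \<iota> where "\<iota> = (\<lambda>x. LEAST i. i \<le> N \<and> (\<forall>j\<in>{..N}. c j x \<le> c i x))"
    have \<iota>m: "\<iota> \<in> measurable borel (count_space UNIV)" unfolding \<iota>_def by measurable
    have \<iota>: "\<iota> x \<le> N \<and> (\<forall>j\<in>{..N}. c j x \<le> c (\<iota> x) x)" for x
    proof -
      have fin: "finite ((\<lambda>j. c j x) ` {..N})" "(\<lambda>j. c j x) ` {..N} \<noteq> {}" by auto
      from Max_in[OF fin] obtain i where "i \<le> N" "Max ((\<lambda>j. c j x) ` {..N}) = c i x" unfolding image_iff by auto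
      then have "i \<le> N \<and> (\<forall>j\<in>{..N}. c j x \<le> c i x)" using Max_ge[OF fin(1)] by auto
      then show ?thesis unfolding \<iota>_def by (rule LeastI)
    qed
    define k where "k = (\<lambda>x z. indicator {- real N..real N} x *\<^sub>R \<phi> (\<iota> x) (x - z))"
    define B' where "B' = Max ((\<lambda>i. \<bar>B i\<bar>) ` {..N})"
    define R' where "R' = Max ((\<lambda>i. \<bar>R i\<bar>) ` {..N})"
    have B': "\<bar>B i\<bar> \<le> B'" "\<bar>R i\<bar> \<le> R'" if "i \<le> N" for i
      using that unfolding B'_def R'_def by (auto intro!: Max_ge)
    have km: "(\<lambda>(x, z). k x z) \<in> borel_measurable (lborel \<Otimes>\<^sub>M lborel)"
    proof -
      have "(\<lambda>p. \<phi> i (fst p - snd p)) \<in> borel_measurable (lborel \<Otimes>\<^sub>M lborel)" for i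
        using pm[of i] by (simp add: case_prod_beta)
      from measurable_selection_fst[OF this \<iota>m] show ?thesis unfolding k_def case_prod_beta by measurable
    qed
    have kb: "norm (k x z) \<le> B'" for x z
    proof -
      have "norm (\<phi> (\<iota> x) (x - z)) \<le> B'" using \<phi>b[of "\<iota> x" "x - z"] B'(1)[of "\<iota> x"] \<iota>[of x] by simp
      moreover have "0 \<le> B'" using B'(1)[of 0] by simp
      ultimately show ?thesis by (auto simp: k_def indicator_def)
    qed
    have k0: "k x z = 0" if "x \<notin> {- real N..real N} \<or> z \<notin> {- real N - R'..real N}" for x z
    proof (cases "x \<in> {- real N..real N}")
      case True
      then have "x - z \<notin> {0..R (\<iota> x)}" using that B'(2)[of "\<iota> x"] \<iota>[of x] by auto
      then show ?thesis by (simp add: k_def \<phi>z)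
    qed (simp add: k_def)
    have key: "(\<integral>\<^sup>+x. ennreal (norm (G x)) * (\<integral>\<^sup>+y. ennreal (norm (G y)) * ennreal (norm (LINT z|lborel. k x z * cnj (k y z))) \<partial>lborel) \<partial>lborel)
        \<le> ennreal (40 * \<delta>) * sqnorm G"
      if [measurable]: "G \<in> borel_measurable borel" for G :: "real \<Rightarrow> complex"
    proof -
      define h where "h = (\<lambda>x y. H (\<iota> x) ((x - y) / a (\<iota> x)) / a (\<iota> x))"
      have h0: "0 \<le> h x y" for x y using H0 a[of "\<iota> x"] by (simp add: h_def)
      have hm: "(\<lambda>(x, y). h x y) \<in> borel_measurable (lborel \<Otimes>\<^sub>M lborel)"
        unfolding h_def by (rule measurable_selected_kernel[OF Hm \<iota>m])
      have hm2: "(\<lambda>(y, x). h x y) \<in> borel_measurable (lborel \<Otimes>\<^sub>M lborel)"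
        using measurable_compose[OF measurable_Pair[OF measurable_snd measurable_fst] hm] by (simp add: case_prod_beta)
      have K: "norm (LINT z|lborel. k x z * cnj (k y z)) \<le> h x y + h y x" for x y
      proof (cases "x \<in> {- real N..real N} \<and> y \<in> {- real N..real N}")
        case True
        then have e: "k x z * cnj (k y z) = \<phi> (\<iota> x) (x - z) * cnj (\<phi> (\<iota> y) (y - z))" for z by (simp add: k_def)
        show ?thesis
        proof (cases "a (\<iota> y) \<le> a (\<iota> x)")
          case True
          from kern[OF this, of x y] show ?thesis using h0[of y x] by (simp add: e h_def)
        next
          case False
          then have "a (\<iota> x) \<le> a (\<iota> y)" by simp
          have "(LINT z|lborel. k x z * cnj (k y z)) = (LINT z|lborel. cnj (\<phi> (\<iota> y) (y - z) * cnj (\<phi> (\<iota> x) (x - z))))"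
            by (simp add: e mult.commute)
          also have "\<dots> = cnj (LINT z|lborel. \<phi> (\<iota> y) (y - z) * cnj (\<phi> (\<iota> x) (x - z)))"
            by (rule Bochner_Integration.integral_cnj)
          finally have "norm (LINT z|lborel. k x z * cnj (k y z)) = norm (LINT z|lborel. \<phi> (\<iota> y) (y - z) * cnj (\<phi> (\<iota> x) (x - z)))"
            by (simp only: complex_mod_cnj)
          then show ?thesis using kern[OF \<open>a (\<iota> x) \<le> a (\<iota> y)\<close>, of y x] h0[of x y] by (simp add: h_def)
        qed
      next
        case False
        then have kk: "k x z * cnj (k y z) = 0" for z by (auto simp: k_def)
        show ?thesis unfolding kk using h0[of x y] h0[of y x] by simp
      qed
      define b where "b = (\<lambda>x. ennreal (norm (G x)))"
      have bm [measurable]: "b \<in> borel_measurable borel" unfolding b_def by measurable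
      have bil: "(\<integral>\<^sup>+x. b x * (\<integral>\<^sup>+y. b y * ennreal (h x y) \<partial>lborel) \<partial>lborel)
        \<le> ennreal (20 * \<delta>) * (\<integral>\<^sup>+x. (b x)\<^sup>2 \<partial>lborel)"
        unfolding h_def b_def using \<iota>
        by (intro maximal_bilinear[OF a Hm H0 Hz H4 \<delta> \<iota>m, of N]) auto
      have mh: "(\<lambda>y. h x y) \<in> borel_measurable borel" "(\<lambda>y. h y x) \<in> borel_measurable borel" for x
        using measurable_compose[OF measurable_Pair1' hm, of x] measurable_compose[OF measurable_Pair1' hm2, of x] by simp_all
      note [measurable] = mh
      have pm1: "(\<lambda>(x, y). b x * (b y * ennreal (h x y))) \<in> borel_measurable (lborel \<Otimes>\<^sub>M lborel)"
        using hm unfolding case_prod_beta by measurable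
      have pm2: "(\<lambda>(x, y). b x * (b y * ennreal (h y x))) \<in> borel_measurable (lborel \<Otimes>\<^sub>M lborel)"
        using hm2 unfolding case_prod_beta by measurable
      have out: "(\<integral>\<^sup>+x. \<integral>\<^sup>+y. b x * (b y * ennreal (h x y)) \<partial>lborel \<partial>lborel)
         = (\<integral>\<^sup>+x. b x * (\<integral>\<^sup>+y. b y * ennreal (h x y) \<partial>lborel) \<partial>lborel)"
        by (rule nn_integral_cong, rule nn_integral_cmult) measurable
      have "(\<integral>\<^sup>+x. b x * (\<integral>\<^sup>+y. b y * ennreal (norm (LINT z|lborel. k x z * cnj (k y z))) \<partial>lborel) \<partial>lborel)
        \<le> (\<integral>\<^sup>+x. (\<integral>\<^sup>+y. b x * (b y * ennreal (h x y)) \<partial>lborel) + (\<integral>\<^sup>+y. b x * (b y * ennreal (h y x)) \<partial>lborel) \<partial>lborel)"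
      proof (rule nn_integral_mono)
        fix x
        have "(\<integral>\<^sup>+y. b y * ennreal (norm (LINT z|lborel. k x z * cnj (k y z))) \<partial>lborel)
          \<le> (\<integral>\<^sup>+y. b y * ennreal (h x y) + b y * ennreal (h y x) \<partial>lborel)"
        proof (rule nn_integral_mono)
          fix y
          have "ennreal (norm (LINT z|lborel. k x z * cnj (k y z))) \<le> ennreal (h x y) + ennreal (h y x)"
            using K[of x y] h0 by (simp add: ennreal_plus[symmetric] ennreal_leI del: ennreal_plus)
          then show "b y * ennreal (norm (LINT z|lborel. k x z * cnj (k y z))) \<le> b y * ennreal (h x y) + b y * ennreal (h y x)"
            unfolding distrib_left[symmetric] by (intro mult_left_mono) auto
        qed
        also have "\<dots> = (\<integral>\<^sup>+y. b y * ennreal (h x y) \<partial>lborel) + (\<integral>\<^sup>+y. b y * ennreal (h y x) \<partial>lborel)"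
          by (rule nn_integral_add) measurable
        finally have "b x * (\<integral>\<^sup>+y. b y * ennreal (norm (LINT z|lborel. k x z * cnj (k y z))) \<partial>lborel)
           \<le> b x * ((\<integral>\<^sup>+y. b y * ennreal (h x y) \<partial>lborel) + (\<integral>\<^sup>+y. b y * ennreal (h y x) \<partial>lborel))"
          by (intro mult_left_mono) auto
        also have "\<dots> = b x * (\<integral>\<^sup>+y. b y * ennreal (h x y) \<partial>lborel) + b x * (\<integral>\<^sup>+y. b y * ennreal (h y x) \<partial>lborel)"
          by (rule distrib_left)
        also have "b x * (\<integral>\<^sup>+y. b y * ennreal (h x y) \<partial>lborel) = (\<integral>\<^sup>+y. b x * (b y * ennreal (h x y)) \<partial>lborel)"
          by (rule nn_integral_cmult[symmetric]) measurable
        also have "b x * (\<integral>\<^sup>+y. b y * ennreal (h y x) \<partial>lborel) = (\<integral>\<^sup>+y. b x * (b y * ennreal (h y x)) \<partial>lborel)"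
          by (rule nn_integral_cmult[symmetric]) measurable
        finally show "b x * (\<integral>\<^sup>+y. b y * ennreal (norm (LINT z|lborel. k x z * cnj (k y z))) \<partial>lborel)
          \<le> (\<integral>\<^sup>+y. b x * (b y * ennreal (h x y)) \<partial>lborel) + (\<integral>\<^sup>+y. b x * (b y * ennreal (h y x)) \<partial>lborel)" .
      qed
      also have "\<dots> = (\<integral>\<^sup>+x. \<integral>\<^sup>+y. b x * (b y * ennreal (h x y)) \<partial>lborel \<partial>lborel)
          + (\<integral>\<^sup>+x. \<integral>\<^sup>+y. b x * (b y * ennreal (h y x)) \<partial>lborel \<partial>lborel)"
        by (rule nn_integral_add) (rule lborel.borel_measurable_nn_integral pm1 pm2)+
      also have "(\<integral>\<^sup>+x. \<integral>\<^sup>+y. b x * (b y * ennreal (h y x)) \<partial>lborel \<partial>lborel)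
        = (\<integral>\<^sup>+y. \<integral>\<^sup>+x. b x * (b y * ennreal (h y x)) \<partial>lborel \<partial>lborel)"
        using lborel_pair.Fubini'[OF pm2] by simp
      also have "\<dots> = (\<integral>\<^sup>+x. \<integral>\<^sup>+y. b x * (b y * ennreal (h x y)) \<partial>lborel \<partial>lborel)"
        by (simp add: mult.left_commute)
      finally have "(\<integral>\<^sup>+x. b x * (\<integral>\<^sup>+y. b y * ennreal (norm (LINT z|lborel. k x z * cnj (k y z))) \<partial>lborel) \<partial>lborel)
        \<le> (\<integral>\<^sup>+x. b x * (\<integral>\<^sup>+y. b y * ennreal (h x y) \<partial>lborel) \<partial>lborel) + (\<integral>\<^sup>+x. b x * (\<integral>\<^sup>+y. b y * ennreal (h x y) \<partial>lborel) \<partial>lborel)"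
        unfolding out .
      also have "\<dots> \<le> ennreal (20 * \<delta>) * (\<integral>\<^sup>+x. (b x)\<^sup>2 \<partial>lborel) + ennreal (20 * \<delta>) * (\<integral>\<^sup>+x. (b x)\<^sup>2 \<partial>lborel)"
        by (intro add_mono bil)
      also have "\<dots> = (ennreal (20 * \<delta>) + ennreal (20 * \<delta>)) * (\<integral>\<^sup>+x. (b x)\<^sup>2 \<partial>lborel)"
        by (rule distrib_right[symmetric])
      also have "ennreal (20 * \<delta>) + ennreal (20 * \<delta>) = ennreal (40 * \<delta>)"
        using \<delta> by (subst ennreal_plus[symmetric]) auto
      finally show ?thesis by (simp only: b_def)
    qed
    have "(\<integral>\<^sup>+x. (g N x)\<^sup>2 \<partial>lborel) \<le> (\<integral>\<^sup>+x. (ennreal (norm (LINT z|lborel. k x z * F z)))\<^sup>2 \<partial>lborel)"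
    proof (rule nn_integral_mono)
      fix x
      show "(g N x)\<^sup>2 \<le> (ennreal (norm (LINT z|lborel. k x z * F z)))\<^sup>2"
      proof (cases "\<bar>x\<bar> \<le> real N")
        case True
        then have "k x z = \<phi> (\<iota> x) (x - z)" for z by (auto simp: k_def indicator_def abs_le_iff)
        then have "norm (LINT z|lborel. k x z * F z) = c (\<iota> x) x" by (simp add: c_def)
        moreover have "g N x \<le> ennreal (c (\<iota> x) x)"
          using True \<iota>[of x] by (auto simp: g_def intro!: SUP_least ennreal_leI)
        ultimately show ?thesis by (intro power_mono) auto
      qed (simp add: g_def)
    qed
    also have "\<dots> \<le> ennreal (40 * \<delta>) * ?F" by (rule TTstar_bound[OF km kb k0 Fm F2 key])
    finally show ?thesis .
  qed
  have inc: "incseq (\<lambda>N. g N x)" for x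
  proof (rule incseq_SucI)
    fix N
    have "(SUP i\<in>{..N}. ennreal (c i x)) \<le> (SUP i\<in>{..Suc N}. ennreal (c i x))"
      by (rule SUP_subset_mono) auto
    then show "g N x \<le> g (Suc N) x" by (auto simp: g_def)
  qed
  have sup: "(SUP i. ennreal (c i x)) = (SUP N. g N x)" for x
  proof (rule antisym)
    show "(SUP i. ennreal (c i x)) \<le> (SUP N. g N x)"
    proof (rule SUP_least)
      fix i
      define N where "N = max i (nat \<lceil>\<bar>x\<bar>\<rceil>)"
      have "\<bar>x\<bar> \<le> real N" "i \<le> N" unfolding N_def by linarith+
      then have "ennreal (c i x) \<le> g N x" by (auto simp: g_def intro!: SUP_upper)
      then show "ennreal (c i x) \<le> (SUP N. g N x)" by (rule SUP_upper2[OF UNIV_I])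
    qed
    show "(SUP N. g N x) \<le> (SUP i. ennreal (c i x))"
      by (rule SUP_least) (auto simp: g_def intro!: SUP_subset_mono)
  qed
  have gm: "(\<lambda>x. (g N x)\<^sup>2) \<in> borel_measurable lborel" for N unfolding g_def by measurable
  have "(\<integral>\<^sup>+x. (SUP i. ennreal (c i x))\<^sup>2 \<partial>lborel) = (\<integral>\<^sup>+x. (SUP N. (g N x)\<^sup>2) \<partial>lborel)"
    by (simp only: sup incseq_SUP_power2[OF inc])
  also have "\<dots> = (SUP N. \<integral>\<^sup>+x. (g N x)\<^sup>2 \<partial>lborel)"
    using inc gm by (intro nn_integral_monotone_convergence_SUP)
      (auto simp: incseq_def le_fun_def intro!: power_mono)
  also have "\<dots> \<le> ennreal (40 * \<delta>) * ?F" by (rule SUP_least) (rule fin)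
  finally show ?thesis by (simp only: c_def)
qed

section \<open>Reduction to countably many parameters\<close>

text \<open>The sets where \<open>f p\<close> exceeds a rational \<open>q\<close> are open, so by Lindeloef's theorem countably many of them
have the same union as all.\<close>

lemma countable_subfamily_SUP:
  fixes f :: "'p \<Rightarrow> real \<Rightarrow> real"
  assumes c: "\<And>p. p \<in> P \<Longrightarrow> continuous_on UNIV (f p)"
  obtains D where "D \<subseteq> P" "countable D" "\<And>x. (SUP p\<in>P. ennreal (f p x)) = (SUP p\<in>D. ennreal (f p x))"
proof -
  define U where "U = (\<lambda>q p. {x. real_of_rat q < f p x})"
  have "\<exists>D. D \<subseteq> P \<and> countable D \<and> \<Union>(U q ` D) = \<Union>(U q ` P)" for q
  proof -
    have "open S" if "S \<in> U q ` P" for S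
      using that c by (auto simp: U_def intro!: open_Collect_less continuous_intros)
    then obtain F' where F': "F' \<subseteq> U q ` P" "countable F'" "\<Union>F' = \<Union>(U q ` P)"
      by (rule Lindelof)
    then obtain D where "countable D" "D \<subseteq> P" "F' = U q ` D"
      using countable_subset_image[of F' "U q" P] by auto
    then show ?thesis using F' by auto
  qed
  then obtain D where D: "\<And>q. D q \<subseteq> P" "\<And>q. countable (D q)" "\<And>q. \<Union>(U q ` D q) = \<Union>(U q ` P)"
    by metis
  show ?thesis
  proof
    show "(\<Union>q. D q) \<subseteq> P" using D(1) by auto
    show "countable (\<Union>q. D q)" using D(2) by auto
    fix x
    show "(SUP p\<in>P. ennreal (f p x)) = (SUP p\<in>(\<Union>q. D q). ennreal (f p x))"
    proof (rule antisym)
      show "(SUP p\<in>(\<Union>q. D q). ennreal (f p x)) \<le> (SUP p\<in>P. ennreal (f p x))"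
        using D(1) by (intro SUP_subset_mono) auto
      show "(SUP p\<in>P. ennreal (f p x)) \<le> (SUP p\<in>(\<Union>q. D q). ennreal (f p x))"
      proof (rule SUP_least, rule ccontr)
        fix p assume p: "p \<in> P"
        assume "\<not> ennreal (f p x) \<le> (SUP p\<in>(\<Union>q. D q). ennreal (f p x))"
        then have less: "(SUP p\<in>(\<Union>q. D q). ennreal (f p x)) < ennreal (f p x)" by simp
        then obtain s where s: "0 \<le> s" "(SUP p\<in>(\<Union>q. D q). ennreal (f p x)) = ennreal s"
          by (cases "(SUP p\<in>(\<Union>q. D q). ennreal (f p x))" rule: ennreal_cases) auto
        then have "s < f p x" using less by (simp add: ennreal_less_iff)
        then obtain q where q: "s < real_of_rat q" "real_of_rat q < f p x"
          using of_rat_dense by blast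
        then have "x \<in> \<Union>(U q ` P)" using p by (auto simp: U_def)
        then obtain p' where p': "p' \<in> D q" "real_of_rat q < f p' x" unfolding D(3)[symmetric] by (auto simp: U_def)
        have "ennreal (f p' x) \<le> ennreal s" unfolding s(2)[symmetric] using p' by (intro SUP_upper) auto
        then show False using p' q s by (simp add: ennreal_le_iff2)
      qed
    qed
  qed
qed

lemma lebesgue_borel_version:
  fixes F :: "real \<Rightarrow> complex"
  assumes "F \<in> borel_measurable lebesgue"
  obtains F' where "F' \<in> borel_measurable borel" "AE x in lborel. F x = F' x"
proof -
  have "(\<lambda>x. Re (F x)) \<in> borel_measurable lebesgue" "(\<lambda>x. Im (F x)) \<in> borel_measurable lebesgue"
    using assms by measurable
  from this[THEN completion_ex_borel_measurable_real]
  obtain u v where u: "u \<in> borel_measurable lborel" "AE x in lborel. Re (F x) = u x"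
    and v: "v \<in> borel_measurable lborel" "AE x in lborel. Im (F x) = v x" by auto
  show ?thesis
  proof
    show "(\<lambda>x. Complex (u x) (v x)) \<in> borel_measurable borel"
      using u(1) v(1) by (simp add: borel_measurable_complex_iff)
    show "AE x in lborel. F x = Complex (u x) (v x)"
      using u(2) v(2) by eventually_elim (simp add: complex_eq_iff)
  qed
qed

lemma convol_borel_version:
  fixes F F' g :: "real \<Rightarrow> complex"
  assumes F: "F \<in> borel_measurable lebesgue" and F' [measurable]: "F' \<in> borel_measurable borel"
    and ae: "AE x in lborel. F x = F' x" and g [measurable]: "g \<in> borel_measurable borel"
  shows "convol F g x = (LINT z|lborel. g (x - z) * F' z)"
proof -
  obtain N where N: "N \<in> null_sets lborel" "{x. F x \<noteq> F' x} \<subseteq> N"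
    using ae by (auto elim!: AE_E simp: null_sets_def)
  have Nb [measurable]: "N \<in> sets borel" using N(1) by auto
  have "AE y in lborel. y \<notin> N" using N(1) by (rule AE_not_in)
  then have "AE y in lborel. x + (-1) * y \<notin> N" by (intro AE_borel_affine) auto
  then have "AE y in lborel. F (x - y) * g y = F' (x - y) * g y"
    by eventually_elim (use N(2) in auto)
  then have ae2: "AE y in lebesgue. F (x - y) * g y = F' (x - y) * g y" by (rule AE_completion)
  have "(\<lambda>y. x - y) \<in> lebesgue \<rightarrow>\<^sub>M lebesgue"
    using lebesgue_affine_measurable[of "\<lambda>_. -1" x] by simp
  then have "(\<lambda>y. F (x - y)) \<in> borel_measurable lebesgue" using F by (rule measurable_compose)
  moreover have "g \<in> borel_measurable lebesgue" by (rule measurable_completion) simp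
  ultimately have m1: "(\<lambda>y. F (x - y) * g y) \<in> borel_measurable lebesgue" by simp
  have m2: "(\<lambda>y. F' (x - y) * g y) \<in> borel_measurable lborel" by measurable
  have "convol F g x = (LINT y|lebesgue. F' (x - y) * g y)"
    unfolding convol_def by (rule integral_cong_AE[OF m1 measurable_completion[OF m2] ae2])
  also have "\<dots> = (LINT y|lborel. F' (x - y) * g y)" by (rule integral_completion[OF m2])
  also have "\<dots> = \<bar>-1\<bar> *\<^sub>R (LINT z|lborel. F' (x - (x + (-1) * z)) * g (x + (-1) * z))"
    by (rule lborel_integral_real_affine) simp
  also have "\<dots> = (LINT z|lborel. g (x - z) * F' z)" by (simp add: mult.commute)
  finally show ?thesis .
qed

text \<open>The kernel has compact support and \<open>F\<close> is locally integrable, so dominated convergence applies.\<close>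

lemma continuous_convolution:
  fixes F g :: "real \<Rightarrow> complex"
  assumes Fm [measurable]: "F \<in> borel_measurable borel" and F2: "sqnorm F < \<infinity>"
    and gc: "continuous_on UNIV g" and gb: "\<And>t. norm (g t) \<le> B" and gz: "\<And>t. t \<notin> {0..R} \<Longrightarrow> g t = 0"
  shows "continuous_on UNIV (\<lambda>x. LINT z|lborel. g (x - z) * F z)"
proof -
  have gm [measurable]: "g \<in> borel_measurable borel" using gc by (rule borel_measurable_continuous_onI)
  have B: "0 \<le> B" by (rule order_trans[OF norm_ge_zero gb])
  show ?thesis unfolding continuous_on_sequentially
  proof (intro ballI allI impI, unfold o_def, elim conjE)
    fix x and X :: "nat \<Rightarrow> real"
    assume X: "X \<longlonglongrightarrow> x"
    from convergent_imp_bounded[OF X] obtain b where b: "\<And>n. \<bar>X n\<bar> \<le> b"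
      unfolding bounded_iff by auto
    define w where "w = (\<lambda>z. B * norm (indicator {- b - R..b} z *\<^sub>R F z))"
    have wi: "integrable lborel w" unfolding w_def
      by (intro integrable_mult_right integrable_norm integrable_indicator_L2[OF Fm F2])
    show "(\<lambda>n. LINT z|lborel. g (X n - z) * F z) \<longlonglongrightarrow> (LINT z|lborel. g (x - z) * F z)"
    proof (rule integral_dominated_convergence[where w = w])
      show "integrable lborel w" by (rule wi)
      show "AE z in lborel. (\<lambda>n. g (X n - z) * F z) \<longlonglongrightarrow> g (x - z) * F z"
      proof (rule AE_I2)
        fix z
        have "(\<lambda>n. X n - z) \<longlonglongrightarrow> x - z" using X by (intro tendsto_intros)
        then have "(\<lambda>n. g (X n - z)) \<longlonglongrightarrow> g (x - z)"
          using continuous_on_tendsto_compose[OF gc, of "\<lambda>n. X n - z"] by simp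
        then show "(\<lambda>n. g (X n - z) * F z) \<longlonglongrightarrow> g (x - z) * F z" by (intro tendsto_intros)
      qed
      show "AE z in lborel. norm (g (X n - z) * F z) \<le> w z" for n
      proof (rule AE_I2)
        fix z
        show "norm (g (X n - z) * F z) \<le> w z"
        proof (cases "z \<in> {- b - R..b}")
          case True
          then show ?thesis using gb by (simp add: w_def norm_mult mult_right_mono)
        next
          case False
          then have "X n - z \<notin> {0..R}" using b[of n] by auto
          then show ?thesis using gz B by (simp add: w_def)
        qed
      qed
    qed measurable
  qed
qed

lemma Phi_continuous:
  assumes z: "\<And>t. t \<notin> {1<..<2} \<Longrightarrow> \<psi> t = 0" and c: "continuous_on UNIV \<psi>"
  shows "continuous_on UNIV (Phi \<alpha> \<beta> \<psi> l)"
proof -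
  have "continuous_on {0<..} (\<lambda>t. exp (\<i> * of_real (fst l * t powr \<alpha> + snd l * t powr \<beta>)) * (\<psi> t / of_real t))"
    using continuous_on_subset[OF c, of "{0<..}"] by (intro continuous_intros) auto
  then have 1: "continuous_on {0<..} (Phi \<alpha> \<beta> \<psi> l)"
    by (subst continuous_on_cong[OF refl]) (auto simp: Phi_def)
  have 2: "continuous_on {..<1} (Phi \<alpha> \<beta> \<psi> l)"
    by (subst continuous_on_cong[OF refl, of _ _ "\<lambda>_. 0"]) (auto simp: Phi_def z)
  have "{0<..} \<union> {..<1} = (UNIV :: real set)" by auto
  then show ?thesis using continuous_on_open_Un[OF _ _ 1 2] by simp
qed

lemma dilate_properties:
  assumes a: "0 < a" and z: "\<And>t. t \<notin> {1<..<2} \<Longrightarrow> \<psi> t = 0" and c: "continuous_on UNIV \<psi>"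
  obtains B where "continuous_on UNIV (dilate a (Phi \<alpha> \<beta> \<psi> l))" "\<And>t. norm (dilate a (Phi \<alpha> \<beta> \<psi> l) t) \<le> B"
    "\<And>t. t \<notin> {0..2 * a} \<Longrightarrow> dilate a (Phi \<alpha> \<beta> \<psi> l) t = 0"
proof -
  have pc: "continuous_on S (Phi \<alpha> \<beta> \<psi> l)" for S
    by (rule continuous_on_subset[OF Phi_continuous[OF z c] subset_UNIV])
  have pz: "Phi \<alpha> \<beta> \<psi> l t = 0" if "t \<notin> {1..2}" for t using that z by (auto simp: Phi_def)
  have "bounded (Phi \<alpha> \<beta> \<psi> l ` {1..2})" by (intro compact_imp_bounded compact_continuous_image pc) auto
  then obtain Z where Z: "\<And>t. t \<in> {1..2} \<Longrightarrow> norm (Phi \<alpha> \<beta> \<psi> l t) \<le> Z" unfolding bounded_iff by blast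
  have Zb: "norm (Phi \<alpha> \<beta> \<psi> l t) \<le> \<bar>Z\<bar>" for t using Z[of t] pz[of t] by (cases "t \<in> {1..2}") auto
  show ?thesis
  proof (rule that[of "\<bar>inverse a\<bar> * \<bar>Z\<bar>"])
    show "continuous_on UNIV (dilate a (Phi \<alpha> \<beta> \<psi> l))" unfolding dilate_def [abs_def]
      by (intro continuous_intros continuous_on_compose2[OF pc[of UNIV]]) (use a in auto)
    show "norm (dilate a (Phi \<alpha> \<beta> \<psi> l) t) \<le> \<bar>inverse a\<bar> * \<bar>Z\<bar>" for t
      unfolding dilate_def norm_mult norm_of_real by (intro mult_left_mono Zb) auto
    show "dilate a (Phi \<alpha> \<beta> \<psi> l) t = 0" if "t \<notin> {0..2 * a}" for t
    proof -
      have "t / a \<notin> {1..2}"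
      proof
        assume "t / a \<in> {1..2}"
        then have "a \<le> t" "t \<le> 2 * a" using a by (auto simp: field_simps)
        then show False using that a by simp
      qed
      then show ?thesis by (simp add: dilate_def pz)
    qed
  qed
qed

lemma dilate_product_integral:
  assumes a: "0 < a" and b: "0 < b"
  shows "(LINT z|lborel. dilate a (Phi \<alpha> \<beta> \<psi> n) (x - z) * cnj (dilate b (Phi \<alpha> \<beta> \<psi> m) (y - z)))
    = of_real (1 / a) * (corr \<alpha> \<beta> \<psi> n m (b / a) ((x - y) / a))"
proof -
  have "(LINT z|lborel. dilate a (Phi \<alpha> \<beta> \<psi> n) (x - z) * cnj (dilate b (Phi \<alpha> \<beta> \<psi> m) (y - z)))
    = \<bar>- b\<bar> *\<^sub>R (LINT u|lborel. dilate a (Phi \<alpha> \<beta> \<psi> n) (x - (y + (- b) * u)) * cnj (dilate b (Phi \<alpha> \<beta> \<psi> m) (y - (y + (- b) * u))))"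
    using b by (intro lborel_integral_real_affine) simp
  also have "\<dots> = b *\<^sub>R (LINT u|lborel. of_real (1 / (a * b)) * (Phi \<alpha> \<beta> \<psi> n ((x - y) / a + (b / a) * u) * cnj (Phi \<alpha> \<beta> \<psi> m u)))"
  proof -
    have "dilate a (Phi \<alpha> \<beta> \<psi> n) (x - (y + (- b) * u)) * cnj (dilate b (Phi \<alpha> \<beta> \<psi> m) (y - (y + (- b) * u)))
      = of_real (1 / (a * b)) * (Phi \<alpha> \<beta> \<psi> n ((x - y) / a + (b / a) * u) * cnj (Phi \<alpha> \<beta> \<psi> m u))" for u
    proof -
      have 1: "(x - (y + (- b) * u)) / a = (x - y) / a + (b / a) * u" by (simp add: diff_divide_distrib add_divide_distrib)
      have 2: "(y - (y + (- b) * u)) / b = u" using b by simp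
      show ?thesis unfolding dilate_def 1 2 by (simp add: inverse_eq_divide)
    qed
    then show ?thesis using b by (simp only: abs_minus_cancel abs_of_pos)
  qed
  also have "\<dots> = of_real (1 / a) * (corr \<alpha> \<beta> \<psi> n m (b / a) ((x - y) / a))"
    using a b by (simp add: scaleR_conv_of_real)
  finally show ?thesis .
qed

text \<open>The convolutions are replaced by those with a Borel version of \<open>F\<close>, which are the same at every point;
the supremum is then measurable as that of countably many continuous functions, and \<open>maximal_sequence\<close> applies with
the majorants of the frequencies in the sequence.\<close>

theorem lemma2p1:
  fixes \<alpha> \<beta> :: real and \<psi> :: "real \<Rightarrow> complex"
  assumes "0 < \<alpha>" and "0 < \<beta>" and "\<alpha> \<noteq> \<beta>" and "\<alpha> \<noteq> 1" and "\<beta> \<noteq> 1"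
    and "smooth \<psi>" and "closure {t. \<psi> t \<noteq> 0} \<subseteq> {1..2}"
  shows "\<exists>\<gamma>\<^sub>0>0. \<exists>C\<ge>0. \<forall>r\<ge>1. \<forall>F. in_L2 F \<longrightarrow>
           max_fun \<alpha> \<beta> \<psi> r F \<in> borel_measurable lebesgue \<and>
           L2norm (max_fun \<alpha> \<beta> \<psi> r F)
             \<le> ennreal (C * r powr (- \<gamma>\<^sub>0)) * L2norm (\<lambda>x. ennreal (cmod (F x)))"
proof -
  obtain K where K: "0 < K" and maj:
    "\<And>r n. 1 \<le> r \<Longrightarrow> r \<le> \<bar>fst n\<bar> + \<bar>snd n\<bar> \<Longrightarrow>
       \<exists>H :: real \<Rightarrow> real. H \<in> borel_measurable borel \<and> (\<forall>w. 0 \<le> H w) \<and> (\<forall>w. w \<notin> {-1..2} \<longrightarrow> H w = 0) \<and>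
         (\<integral>\<^sup>+w. ennreal (H w ^ 4) \<partial>lborel) \<le> ennreal (K * r powr (-1 / 137)) \<and>
         (\<forall>m h w. r \<le> \<bar>fst m\<bar> + \<bar>snd m\<bar> \<longrightarrow> 0 < h \<longrightarrow> h \<le> 1 \<longrightarrow>
           norm (corr \<alpha> \<beta> \<psi> n m h w) \<le> H w)"
    by (rule kernel_majorant[OF assms]) blast
  have z: "\<psi> t = 0" if "t \<notin> {1<..<2}" for t using smooth_amplitude[OF assms(6,7)] that by metis
  have c: "continuous_on UNIV \<psi>" using smooth_amplitude[OF assms(6,7)] by metis
  define C where "C = sqrt (40 * K powr (1/4))"
  have main: "max_fun \<alpha> \<beta> \<psi> r F \<in> borel_measurable lebesgue \<and>
      L2norm (max_fun \<alpha> \<beta> \<psi> r F) \<le> ennreal (C * r powr (- (1 / 1096))) * L2norm (\<lambda>x. ennreal (cmod (F x)))"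
    if r: "1 \<le> r" and F: "in_L2 F" for r F
  proof -
    define P where "P = {(a :: real, l :: real \<times> real). 0 < a \<and> r \<le> \<bar>fst l\<bar> + \<bar>snd l\<bar>}"
    have Fl: "F \<in> borel_measurable lebesgue" using F by (simp add: in_L2_def)
    obtain F' where F' [measurable]: "F' \<in> borel_measurable borel" and ae: "AE x in lborel. F x = F' x"
      by (rule lebesgue_borel_version[OF Fl])
    define I where "I = (\<integral>\<^sup>+x. (ennreal (cmod (F x)))\<^sup>2 \<partial>lebesgue)"
    have I': "I = sqnorm F'"
      unfolding I_def nn_integral_completion using ae by (intro nn_integral_cong_AE) (auto elim: eventually_mono)
    have Ifin: "I < \<infinity>" using F unfolding in_L2_def L2norm_def I_def[symmetric] by (auto simp: Let_def less_top split: if_splits)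
    define f where "f = (\<lambda>p x. cmod (LINT z|lborel. dilate (fst p) (Phi \<alpha> \<beta> \<psi> (snd p)) (x - z) * F' z))"
    have fc: "continuous_on UNIV (f p)" if "p \<in> P" for p
    proof -
      have a: "0 < fst p" using that by (auto simp: P_def)
      obtain B where B: "continuous_on UNIV (dilate (fst p) (Phi \<alpha> \<beta> \<psi> (snd p)))"
        "\<And>t. norm (dilate (fst p) (Phi \<alpha> \<beta> \<psi> (snd p)) t) \<le> B"
        "\<And>t. t \<notin> {0..2 * fst p} \<Longrightarrow> dilate (fst p) (Phi \<alpha> \<beta> \<psi> (snd p)) t = 0"
        by (rule dilate_properties[OF a z c]) blast+
      show ?thesis unfolding f_def
        by (intro continuous_on_norm continuous_convolution[OF F' Ifin[unfolded I'] B])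
    qed
    have conv: "cmod (convol F (dilate (fst p) (Phi \<alpha> \<beta> \<psi> (snd p))) x) = f p x" if "p \<in> P" for p x
    proof -
      have a: "0 < fst p" using that by (auto simp: P_def)
      have "continuous_on UNIV (dilate (fst p) (Phi \<alpha> \<beta> \<psi> (snd p)))"
        by (rule dilate_properties[OF a z c]) blast+
      then have "dilate (fst p) (Phi \<alpha> \<beta> \<psi> (snd p)) \<in> borel_measurable borel"
        by (rule borel_measurable_continuous_onI)
      then show ?thesis unfolding f_def by (subst convol_borel_version[OF Fl F' ae]) auto
    qed
    have mf: "max_fun \<alpha> \<beta> \<psi> r F x = (SUP p\<in>P. ennreal (f p x))" for x
      unfolding max_fun_def P_def[symmetric] using conv by (intro SUP_cong) (auto simp: case_prod_beta)
    obtain D where D: "D \<subseteq> P" "countable D" "\<And>x. (SUP p\<in>P. ennreal (f p x)) = (SUP p\<in>D. ennreal (f p x))"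
      using countable_subfamily_SUP[of P f, OF fc] by blast
    \<comment> \<open>A parameter that is always admissible, so that the enumeration below is of a nonempty set.\<close>
    define p0 where "p0 = (1 :: real, (r, 0 :: real))"
    have p0: "p0 \<in> P" using r by (simp add: p0_def P_def)
    define E where "E = insert p0 D"
    have E: "E \<subseteq> P" "countable E" "E \<noteq> {}" using D p0 by (auto simp: E_def)
    define s where "s = from_nat_into E"
    have sE: "range s = E" unfolding s_def by (rule range_from_nat_into[OF E(3,2)])
    have sP: "0 < fst (s i)" "r \<le> \<bar>fst (snd (s i))\<bar> + \<bar>snd (snd (s i))\<bar>" "s i \<in> P" for i
    proof -
      have "s i \<in> P" using sE E(1) by auto
      then show "0 < fst (s i)" "r \<le> \<bar>fst (snd (s i))\<bar> + \<bar>snd (snd (s i))\<bar>" "s i \<in> P" by (auto simp: P_def)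
    qed
    have mfs: "max_fun \<alpha> \<beta> \<psi> r F x = (SUP i. ennreal (f (s i) x))" for x
    proof (rule antisym)
      have "max_fun \<alpha> \<beta> \<psi> r F x \<le> (SUP p\<in>E. ennreal (f p x))"
        unfolding mf D(3) by (rule SUP_subset_mono) (auto simp: E_def)
      also have "\<dots> = (SUP i. ennreal (f (s i) x))" unfolding sE[symmetric] by (simp add: image_comp)
      finally show "max_fun \<alpha> \<beta> \<psi> r F x \<le> (SUP i. ennreal (f (s i) x))" .
      show "(SUP i. ennreal (f (s i) x)) \<le> max_fun \<alpha> \<beta> \<psi> r F x"
        unfolding mf using sP(3) by (intro SUP_least SUP_upper) auto
    qed
    have meas: "max_fun \<alpha> \<beta> \<psi> r F \<in> borel_measurable lborel"
    proof -
      have "(\<lambda>x. ennreal (f (s i) x)) \<in> borel_measurable lborel" for i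
        using borel_measurable_continuous_onI[OF fc[OF sP(3)[of i]]] by simp
      then have "(\<lambda>x. SUP i. ennreal (f (s i) x)) \<in> borel_measurable lborel" by (intro borel_measurable_SUP) auto
      then show ?thesis by (simp only: mfs[symmetric])
    qed
    \<comment> \<open>The fourth root of the bound for the integral of \<open>H ^ 4\<close>. Since \<open>40 * \<delta>\<close> bounds the square of the
      operator norm, the exponent is \<open>1 / (2 * 4 * 137) = 1 / 1096\<close>.\<close>
    define \<delta> where "\<delta> = K powr (1/4) * r powr (- (1 / 548))"
    have \<delta>: "0 < \<delta>" using K r by (simp add: \<delta>_def)
    have \<delta>4: "\<delta> ^ 4 = K * r powr (-1 / 137)"
    proof -
      have "\<delta> ^ 4 = (K powr (1/4)) powr 4 * (r powr (- (1 / 548))) powr 4"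
        using K r by (simp add: \<delta>_def power_mult_distrib powr_numeral)
      then show ?thesis using K r by (simp add: powr_powr)
    qed
    have "\<exists>H. \<forall>i. H i \<in> borel_measurable borel \<and> (\<forall>w. 0 \<le> H i w) \<and> (\<forall>w. w \<notin> {-1..2} \<longrightarrow> H i w = 0) \<and>
         (\<integral>\<^sup>+w. ennreal (H i w ^ 4) \<partial>lborel) \<le> ennreal (K * r powr (-1 / 137)) \<and>
         (\<forall>m h w. r \<le> \<bar>fst m\<bar> + \<bar>snd m\<bar> \<longrightarrow> 0 < h \<longrightarrow> h \<le> 1 \<longrightarrow>
           norm (corr \<alpha> \<beta> \<psi> (snd (s i)) m h w) \<le> (H i w :: real))"
      by (rule choice, rule allI, rule maj[OF r sP(2)])
    then obtain H where H: "\<And>i. H i \<in> borel_measurable borel" "\<And>i w. 0 \<le> (H i w :: real)" "\<And>i w. w \<notin> {-1..2} \<Longrightarrow> H i w = 0"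
      "\<And>i. (\<integral>\<^sup>+w. ennreal (H i w ^ 4) \<partial>lborel) \<le> ennreal (K * r powr (-1 / 137))"
      "\<And>i m h w. r \<le> \<bar>fst m\<bar> + \<bar>snd m\<bar> \<Longrightarrow> 0 < h \<Longrightarrow> h \<le> 1 \<Longrightarrow>
           norm (corr \<alpha> \<beta> \<psi> (snd (s i)) m h w) \<le> H i w"
      by blast
    define \<phi> where "\<phi> = (\<lambda>i. dilate (fst (s i)) (Phi \<alpha> \<beta> \<psi> (snd (s i))))"
    have "\<exists>B. continuous_on UNIV (\<phi> i) \<and> (\<forall>t. norm (\<phi> i t) \<le> B) \<and> (\<forall>t. t \<notin> {0..2 * fst (s i)} \<longrightarrow> \<phi> i t = 0)" for i
      unfolding \<phi>_def by (rule dilate_properties[OF sP(1)[of i] z c]) blast+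
    then obtain B where B: "\<And>i. continuous_on UNIV (\<phi> i)" "\<And>i t. norm (\<phi> i t) \<le> B i"
      "\<And>i t. t \<notin> {0..2 * fst (s i)} \<Longrightarrow> \<phi> i t = 0" by metis
    have "(\<integral>\<^sup>+x. (SUP i. ennreal (norm (LINT z|lborel. \<phi> i (x - z) * F' z)))\<^sup>2 \<partial>lborel)
      \<le> ennreal (40 * \<delta>) * sqnorm F'"
    proof (rule maximal_sequence[where a = "\<lambda>i. fst (s i)" and H = H and R = "\<lambda>i. 2 * fst (s i)" and B = B])
      show "(\<integral>\<^sup>+w. ennreal (H i w ^ 4) \<partial>lborel) \<le> ennreal (\<delta> ^ 4)" for i unfolding \<delta>4 by (rule H(4))
      show "\<phi> i \<in> borel_measurable borel" for i using B(1) by (rule borel_measurable_continuous_onI)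
      show "sqnorm F' < \<infinity>" using Ifin I' by simp
      show "norm (LINT z|lborel. \<phi> i (x - z) * cnj (\<phi> j (y - z))) \<le> H i ((x - y) / fst (s i)) / fst (s i)"
        if le: "fst (s j) \<le> fst (s i)" for i j x y
      proof -
        have "0 < fst (s j) / fst (s i)" "fst (s j) / fst (s i) \<le> 1" using sP(1)[of i] sP(1)[of j] le by auto
        note bd = H(5)[OF sP(2)[of j] this, of i "(x - y) / fst (s i)"]
        have "norm (LINT z|lborel. \<phi> i (x - z) * cnj (\<phi> j (y - z)))
          = (1 / fst (s i)) * norm (corr \<alpha> \<beta> \<psi> (snd (s i)) (snd (s j)) (fst (s j) / fst (s i)) ((x - y) / fst (s i)))"
          unfolding \<phi>_def dilate_product_integral[OF sP(1) sP(1)] norm_mult norm_of_real using sP(1)[of i] by simp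
        also have "\<dots> \<le> (1 / fst (s i)) * H i ((x - y) / fst (s i))"
          using bd sP(1)[of i] by (intro mult_left_mono) auto
        finally show ?thesis by simp
      qed
    qed (use sP H \<delta> B F' in auto)
    then have bound: "(\<integral>\<^sup>+x. (max_fun \<alpha> \<beta> \<psi> r F x)\<^sup>2 \<partial>lebesgue) \<le> ennreal (40 * \<delta>) * I"
      unfolding nn_integral_completion I' mfs f_def \<phi>_def .
    define J where "J = (\<integral>\<^sup>+x. (max_fun \<alpha> \<beta> \<psi> r F x)\<^sup>2 \<partial>lebesgue)"
    obtain i where i: "0 \<le> i" "I = ennreal i" using Ifin by (cases I rule: ennreal_cases) auto
    have "J \<le> ennreal (40 * \<delta> * i)" using bound \<delta> i by (simp add: J_def ennreal_mult)
    then obtain j where j: "0 \<le> j" "J = ennreal j" "j \<le> 40 * \<delta> * i"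
      using \<delta> i by (cases J rule: ennreal_cases) (auto simp: top_unique)
    have C2: "sqrt (40 * \<delta>) = C * r powr (- (1 / 1096))"
    proof -
      have "(r powr (- (1 / 1096)))\<^sup>2 = r powr (- (1 / 548))"
        using r by (simp add: power2_eq_square powr_add[symmetric])
      then have "sqrt (r powr (- (1 / 548))) = r powr (- (1 / 1096))" by (intro real_sqrt_unique) auto
      then show ?thesis by (simp add: C_def \<delta>_def real_sqrt_mult mult.assoc)
    qed
    have "L2norm (max_fun \<alpha> \<beta> \<psi> r F) = ennreal (sqrt j)"
      unfolding L2norm_def J_def[symmetric] using j by (simp add: Let_def)
    also have "\<dots> \<le> ennreal (sqrt (40 * \<delta>) * sqrt i)"
      unfolding real_sqrt_mult[symmetric] using j by (intro ennreal_leI) simp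
    also have "\<dots> = ennreal (C * r powr (- (1 / 1096))) * ennreal (sqrt i)"
      unfolding C2[symmetric] using \<delta> i by (intro ennreal_mult) auto
    also have "ennreal (sqrt i) = L2norm (\<lambda>x. ennreal (cmod (F x)))"
      unfolding L2norm_def I_def[symmetric] using i by (simp add: Let_def)
    finally show ?thesis using measurable_completion[OF meas] by simp
  qed
  have "0 \<le> C" by (simp add: C_def)
  then show ?thesis using main by (intro exI[of _ "1 / 1096"] conjI exI[of _ C]) auto
qed

end
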